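(* Let $F, G \in \mathcal{F}(\mathbb{R})$ and let $W=(w_N)_{N\in\mathbb{N}}$ be a weight function system that satisfies $(\alpha)$ and $(N)$. Then the following statements are equivalent: (i) The Cauchy-Riemann operator $\overline{\partial} \colon \mathcal{K}_{W}(T^{F,G}) \to \mathcal{K}_{W}(T^{F,G})$ is surjective. (ii) The Laplace operator $\Delta\colon \mathcal{K}_{W}(T^{F,G}) \to \mathcal{K}_{W}(T^{F,G})$ is surjective. (iii) The weight function system $W$ satisfies $(\epsilon)_0$. (iv) The space $\mathcal{U}_{W}(T^{F,G})$ is non-trivial, i.e. $\mathcal{U}_{W}(T^{F,G})\neq\{0\}$.
   Context: $\mathcal{F}(\mathbb{R})$ is the family of all uniformly continuous functions $F\colon\mathbb{R}\to(0,\infty)$ with $0<\inf_{t\in\mathbb{R}}F(t)\le\sup_{t\in\mathbb{R}}F(t)<\infty$. For $F,G\in\mathcal{F}(\mathbb{R})$, the generalized strip is $T^{F,G}=\{z\in\mathbb{C} : -G(\operatorname{Re} z)<\operatorname{Im} z<F(\operatorname{Re} z)\}$. A weight function is a non-decreasing unbounded function $w\colon[0,\infty)\to[0,\infty)$. A weight function system is a pointwise non-decreasing sequence $W=(w_N)_{N\in\mathbb{N}}$ of weight functions. Conditions on $W$: $(\alpha)$: $\forall N\in\mathbb{N}\ \exists M>N,\ A>1\ \forall t\ge0:\ w_N(2t)\le w_M(t)+\log A$. $(\epsilon)_0$: $\forall N\in\mathbb{N}\ \forall\mu>0:\ \int_0^\infty w_N(t)e^{-\mu t}\,\mathrm{d}t<\infty$.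 $(N)$: $\forall N\in\mathbb{N}\ \exists M>N:\ \int_0^\infty e^{w_N(t)-w_M(t)}\,\mathrm{d}t<\infty$. $\mathcal{K}_W(T^{F,G})$ is the space of all $f\in C^\infty(T^{F,G})$ (complex-valued, smooth in the real sense) such that for all $N\in\mathbb{N}$, $\alpha\in\mathbb{N}^2$ (multi-indices, including $0$), $a\in(0,1)$: $$p_{N,\alpha,a}(f)=\sup_{\xi\in\overline{T^{aF,aG}}}e^{w_N(|\operatorname{Re}\xi|)}|f^{(\alpha)}(\xi)|<\infty,$$ where $f^{(\alpha)}=\partial_x^{\alpha_1}\partial_y^{\alpha_2}f$. $\mathcal{U}_W(T^{F,G})$ is the subspace of all functions in $\mathcal{K}_W(T^{F,G})$ that are holomorphic on $T^{F,G}$. $\overline{\partial}=\frac12\left(\frac{\partial}{\partial x}+i\frac{\partial}{\partial y}\right)$ and $\Delta=\frac{\partial^2}{\partial x^2}+\frac{\partial^2}{\partial y^2}$. *)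

theory Defs
  imports "HOL-Analysis.Analysis"
begin

definition strip_boundary_fun :: "(real \<Rightarrow> real) \<Rightarrow> bool" where
  "strip_boundary_fun F \<longleftrightarrow>
     uniformly_continuous_on UNIV F \<and> (\<forall>t. 0 < F t) \<and>
     0 < (INF t. F t) \<and> bdd_above (range F)"

definition strip :: "(real \<Rightarrow> real) \<Rightarrow> (real \<Rightarrow> real) \<Rightarrow> complex set" where
  "strip F G = {z. - G (Re z) < Im z \<and> Im z < F (Re z)}"

text \<open>Weights are functions on the closed half line: only their values at nonnegative
  arguments matter.\<close>

definition weight_function :: "(real \<Rightarrow> real) \<Rightarrow> bool" where
  "weight_function w \<longleftrightarrow>
     (\<forall>t\<ge>0. 0 \<le> w t) \<and> mono_on {0..} w \<and> \<not> bdd_above (w ` {0..})"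

definition weight_system :: "(nat \<Rightarrow> real \<Rightarrow> real) \<Rightarrow> bool" where
  "weight_system W \<longleftrightarrow>
     (\<forall>N. weight_function (W N)) \<and> (\<forall>N. \<forall>t\<ge>0. W N t \<le> W (Suc N) t)"

definition cond_alpha :: "(nat \<Rightarrow> real \<Rightarrow> real) \<Rightarrow> bool" where
  "cond_alpha W \<longleftrightarrow>
     (\<forall>N. \<exists>M>N. \<exists>A>1. \<forall>t\<ge>0. W N (2 * t) \<le> W M t + ln A)"

definition cond_eps0 :: "(nat \<Rightarrow> real \<Rightarrow> real) \<Rightarrow> bool" where
  "cond_eps0 W \<longleftrightarrow>
     (\<forall>N. \<forall>\<mu>>0. (\<integral>\<^sup>+ t\<in>{0..}. ennreal (W N t * exp (- \<mu> * t)) \<partial>lborel) < \<infinity>)"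

definition cond_N :: "(nat \<Rightarrow> real \<Rightarrow> real) \<Rightarrow> bool" where
  "cond_N W \<longleftrightarrow>
     (\<forall>N. \<exists>M>N. (\<integral>\<^sup>+ t\<in>{0..}. ennreal (exp (W N t - W M t)) \<partial>lborel) < \<infinity>)"

definition partial_x :: "(complex \<Rightarrow> complex) \<Rightarrow> complex \<Rightarrow> complex" where
  "partial_x f z = vector_derivative (\<lambda>x. f (Complex x (Im z))) (at (Re z))"

definition partial_y :: "(complex \<Rightarrow> complex) \<Rightarrow> complex \<Rightarrow> complex" where
  "partial_y f z = vector_derivative (\<lambda>y. f (Complex (Re z) y)) (at (Im z))"

text \<open>Real differentiability of class \<open>C^k\<close> on an open set; \<open>differentiable\<close> is
  Frechet differentiability over the reals.\<close>

primrec Ck_on :: "nat \<Rightarrow> (complex \<Rightarrow> complex) \<Rightarrow> complex set \<Rightarrow> bool" where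
  "Ck_on 0 f S \<longleftrightarrow> continuous_on S f"
| "Ck_on (Suc k) f S \<longleftrightarrow>
     (\<forall>z\<in>S. f differentiable (at z)) \<and> Ck_on k (partial_x f) S \<and> Ck_on k (partial_y f) S"

definition Cinf_on :: "(complex \<Rightarrow> complex) \<Rightarrow> complex set \<Rightarrow> bool" where
  "Cinf_on f S \<longleftrightarrow> (\<forall>k. Ck_on k f S)"

definition mixed_partial :: "nat \<times> nat \<Rightarrow> (complex \<Rightarrow> complex) \<Rightarrow> complex \<Rightarrow> complex" where
  "mixed_partial \<alpha> f = (partial_x ^^ fst \<alpha>) ((partial_y ^^ snd \<alpha>) f)"

definition cauchy_riemann :: "(complex \<Rightarrow> complex) \<Rightarrow> complex \<Rightarrow> complex" where
  "cauchy_riemann f z = 1 / 2 * (partial_x f z + \<i> * partial_y f z)"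

definition laplace :: "(complex \<Rightarrow> complex) \<Rightarrow> complex \<Rightarrow> complex" where
  "laplace f z = partial_x (partial_x f) z + partial_y (partial_y f) z"

text \<open>A function on the strip is represented by any total function extending it; the
  conditions below only constrain its values on the (open) strip, and two representatives
  are the same element of the space iff they agree on the strip. Finiteness of the
  supremum of the seminorm is \<open>bdd_above\<close>.\<close>

definition K_space ::
  "(nat \<Rightarrow> real \<Rightarrow> real) \<Rightarrow> (real \<Rightarrow> real) \<Rightarrow> (real \<Rightarrow> real) \<Rightarrow> (complex \<Rightarrow> complex) set" where
  "K_space W F G =
     {f. Cinf_on f (strip F G) \<and>
         (\<forall>N \<alpha> a. 0 < a \<and> a < 1 \<longrightarrow>
            bdd_above ((\<lambda>\<xi>. exp (W N \<bar>Re \<xi>\<bar>) * cmod (mixed_partial \<alpha> f \<xi>)) `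
                       closure (strip (\<lambda>t. a * F t) (\<lambda>t. a * G t))))}"

definition U_space ::
  "(nat \<Rightarrow> real \<Rightarrow> real) \<Rightarrow> (real \<Rightarrow> real) \<Rightarrow> (real \<Rightarrow> real) \<Rightarrow> (complex \<Rightarrow> complex) set" where
  "U_space W F G = {f \<in> K_space W F G. f holomorphic_on strip F G}"

text \<open>Surjectivity of an operator on a space \<open>X\<close> of functions on \<open>S\<close>, where functions are
  identified when they agree on \<open>S\<close>.\<close>

definition surjective_on ::
  "complex set \<Rightarrow> (complex \<Rightarrow> complex) set \<Rightarrow>
   ((complex \<Rightarrow> complex) \<Rightarrow> complex \<Rightarrow> complex) \<Rightarrow> bool" where
  "surjective_on S X D \<longleftrightarrow> (\<forall>g\<in>X. \<exists>f\<in>X. \<forall>z\<in>S. D f z = g z)"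

end

theory Submission
  imports Defs "HOL-Complex_Analysis.Complex_Analysis" "HOL-Probability.Sinc_Integral"
begin

text \<open>By condition \<open>(\<alpha>)\<close>, condition \<open>(\<epsilon>)\<^sub>0\<close> says that every weight is bounded by \<open>C exp (\<mu> t)\<close>, for
  one or equivalently for all \<open>\<mu> > 0\<close>.

  A holomorphic function on a half strip that decays like \<open>exp (- w)\<close> and does not vanish identically
  forces such a bound on \<open>w\<close>: transplant it to the disc and apply the maximum principle to the product
  of its rotates. This applies to the elements of \<open>U_space\<close>, and to the difference between a smooth
  step function and a solution of the corresponding Cauchy--Riemann equation.

  Conversely, exponential bounds make \<open>P z = exp (1 - cosh (\<mu> z))\<close> decay faster than all weights, and
  convolution with \<open>P z / (\<pi> z)\<close> solves the Cauchy--Riemann equation for right-hand sides supported in a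
  smaller strip. In general the right-hand side is cut into layers approaching the boundary; replacing
  \<open>P\<close> by \<open>P E\<^sup>k\<close> with a peak function \<open>E\<close> makes the solution for each layer small on the strips inside
  it, so that the solutions can be summed. Finally the Laplacian is \<open>4\<close> times the product of the
  Cauchy--Riemann operator and its conjugate.\<close>

section \<open>Partial derivatives and classes of smooth functions\<close>

text \<open>For every holomorphic \<open>h\<close> with \<open>h 0 = 1\<close>, the kernel
  \<open>h z / (pi z)\<close> is a fundamental solution of the Cauchy--Riemann operator, and the
  construction of solutions exploits exactly this freedom. Summing over layers usually calls for a
  weighted Runge theorem that supplies holomorphic corrections. Here the kernel of each layer is
  chosen so that its solution is already small further inside, and no correction follows.

  By the maximum principle, a function with \<open>E 0 = 1\<close> cannot have modulus at most
  \<open>1/2\<close> on a closed curve around \<open>0\<close>. A peak function therefore leaves one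
  direction uncontrolled, up or down, and each layer is treated in two parts. That one width of the
  exceptional half strip serves all base points rests on the uniform continuity and the positive
  lower bounds of \<open>F\<close> and \<open>G\<close>.

  The disc argument only yields growth of at most \<open>exp (\<mu> t)\<close> with a
  \<open>\<mu>\<close> dictated by the width of the strip; repeated halving by
  \<open>(\<alpha>)\<close> then reaches every \<open>\<mu> > 0\<close>. The same condition makes
  the weights submultiplicative up to a change of index, so that convolution preserves
  decay.\<close>

lemma partials_of_has_derivative:
  assumes "(f has_derivative D) (at z)"
  shows "partial_x f z = D 1" and "partial_y f z = D \<i>"
proof -
  have "((\<lambda>x. Complex x (Im z)) has_derivative (\<lambda>h. h *\<^sub>R 1)) (at (Re z))"
    unfolding Complex_eq by (auto intro!: derivative_eq_intros simp: scaleR_conv_of_real)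
  then have "((\<lambda>x. f (Complex x (Im z))) has_derivative (\<lambda>h. D (h *\<^sub>R 1))) (at (Re z))"
    by (rule has_derivative_compose) (use assms in simp)
  moreover have "D (h *\<^sub>R 1) = h *\<^sub>R D 1" for h
    using assms by (simp add: linear_simps has_derivative_bounded_linear)
  ultimately show "partial_x f z = D 1"
    unfolding partial_x_def by (intro vector_derivative_at) (simp add: has_vector_derivative_def)
  have "((\<lambda>y. Complex (Re z) y) has_derivative (\<lambda>h. h *\<^sub>R \<i>)) (at (Im z))"
    unfolding Complex_eq by (auto intro!: derivative_eq_intros simp: scaleR_conv_of_real)
  then have "((\<lambda>y. f (Complex (Re z) y)) has_derivative (\<lambda>h. D (h *\<^sub>R \<i>))) (at (Im z))"
    by (rule has_derivative_compose) (use assms in simp)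
  moreover have "D (h *\<^sub>R \<i>) = h *\<^sub>R D \<i>" for h
    using assms by (simp add: linear_simps has_derivative_bounded_linear)
  ultimately show "partial_y f z = D \<i>"
    unfolding partial_y_def by (intro vector_derivative_at) (simp add: has_vector_derivative_def)
qed

lemma has_derivative_partials:
  assumes "f differentiable (at z)"
  shows "(f has_derivative (\<lambda>h. Re h *\<^sub>R partial_x f z + Im h *\<^sub>R partial_y f z)) (at z)"
proof -
  obtain D where D: "(f has_derivative D) (at z)"
    using assms by (auto simp: differentiable_def)
  have "D h = Re h *\<^sub>R D 1 + Im h *\<^sub>R D \<i>" for h
  proof -
    have "h = Re h *\<^sub>R 1 + Im h *\<^sub>R \<i>"
      by (simp add: complex_eq_iff)
    then have "D h = D (Re h *\<^sub>R 1 + Im h *\<^sub>R \<i>)" by simp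
    also have "\<dots> = Re h *\<^sub>R D 1 + Im h *\<^sub>R D \<i>"
      using has_derivative_bounded_linear[OF D] by (simp add: linear_simps)
    finally show ?thesis .
  qed
  then have "D = (\<lambda>h. Re h *\<^sub>R partial_x f z + Im h *\<^sub>R partial_y f z)"
    unfolding partials_of_has_derivative[OF D] by (rule ext)
  with D show ?thesis by simp
qed

lemma partials_eqI:
  assumes "(f has_derivative (\<lambda>h. Re h *\<^sub>R a + Im h *\<^sub>R b)) (at z)"
  shows "partial_x f z = a" "partial_y f z = b" "f differentiable (at z)"
  using partials_of_has_derivative[OF assms] assms by (auto simp: differentiable_def)

lemma partials_cong:
  assumes "open S" "z \<in> S" "\<And>w. w \<in> S \<Longrightarrow> f w = g w" "f differentiable (at z)"
  shows "partial_x g z = partial_x f z" "partial_y g z = partial_y f z" "g differentiable (at z)"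
proof -
  have "(g has_derivative (\<lambda>h. Re h *\<^sub>R partial_x f z + Im h *\<^sub>R partial_y f z)) (at z)"
    using has_derivative_transform_within_open[OF has_derivative_partials[OF assms(4)] assms(1,2)]
      assms(3) by blast
  then show "partial_x g z = partial_x f z" "partial_y g z = partial_y f z"
    "g differentiable (at z)" by (auto dest: partials_eqI)
qed

lemma partials_add:
  assumes "f differentiable (at z)" "g differentiable (at z)"
  shows "partial_x (\<lambda>w. f w + g w) z = partial_x f z + partial_x g z"
    "partial_y (\<lambda>w. f w + g w) z = partial_y f z + partial_y g z"
proof -
  have "((\<lambda>w. f w + g w) has_derivative (\<lambda>h. Re h *\<^sub>R (partial_x f z + partial_x g z)
      + Im h *\<^sub>R (partial_y f z + partial_y g z))) (at z)"
    by (rule has_derivative_eq_rhs[OF has_derivative_add[OF has_derivative_partials[OF assms(1)]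
          has_derivative_partials[OF assms(2)]]]) (auto simp: algebra_simps)
  then show "partial_x (\<lambda>w. f w + g w) z = partial_x f z + partial_x g z"
    "partial_y (\<lambda>w. f w + g w) z = partial_y f z + partial_y g z"
    by (auto dest: partials_eqI)
qed

lemma partials_mult:
  assumes "f differentiable (at z)" "g differentiable (at z)"
  shows "partial_x (\<lambda>w. f w * g w) z = partial_x f z * g z + f z * partial_x g z"
    "partial_y (\<lambda>w. f w * g w) z = partial_y f z * g z + f z * partial_y g z"
proof -
  have "((\<lambda>w. f w * g w) has_derivative (\<lambda>h. Re h *\<^sub>R (partial_x f z * g z + f z * partial_x g z)
      + Im h *\<^sub>R (partial_y f z * g z + f z * partial_y g z))) (at z)"
    by (rule has_derivative_eq_rhs[OF has_derivative_mult[OF has_derivative_partials[OF assms(1)]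
          has_derivative_partials[OF assms(2)]]]) (auto simp: algebra_simps)
  then show "partial_x (\<lambda>w. f w * g w) z = partial_x f z * g z + f z * partial_x g z"
    "partial_y (\<lambda>w. f w * g w) z = partial_y f z * g z + f z * partial_y g z"
    by (auto dest: partials_eqI)
qed

lemma partials_const [simp]: "partial_x (\<lambda>w. c) z = 0" "partial_y (\<lambda>w. c) z = 0"
  by (simp_all add: partial_x_def partial_y_def)

lemma partials_cmult:
  assumes "f differentiable (at z)"
  shows "partial_x (\<lambda>w. c * f w) z = c * partial_x f z"
    "partial_y (\<lambda>w. c * f w) z = c * partial_y f z"
  using partials_mult[OF differentiable_const assms, of c] by auto

lemma partials_cnj:
  assumes "f differentiable (at z)"
  shows "partial_x (\<lambda>w. cnj (f w)) z = cnj (partial_x f z)"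
    "partial_y (\<lambda>w. cnj (f w)) z = cnj (partial_y f z)"
    "(\<lambda>w. cnj (f w)) differentiable (at z)"
proof -
  have "((\<lambda>w. cnj (f w)) has_derivative (\<lambda>h. Re h *\<^sub>R cnj (partial_x f z)
      + Im h *\<^sub>R cnj (partial_y f z))) (at z)"
    by (rule has_derivative_eq_rhs[OF has_derivative_cnj[OF has_derivative_partials[OF assms]]])
      (auto simp: scaleR_conv_of_real)
  then show "partial_x (\<lambda>w. cnj (f w)) z = cnj (partial_x f z)"
    "partial_y (\<lambda>w. cnj (f w)) z = cnj (partial_y f z)"
    "(\<lambda>w. cnj (f w)) differentiable (at z)"
    by (auto dest: partials_eqI)
qed

lemma partials_holomorphic:
  assumes "f holomorphic_on S" "open S" "z \<in> S"
  shows "partial_x f z = deriv f z" "partial_y f z = \<i> * deriv f z" "f differentiable (at z)"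
proof -
  have "(f has_field_derivative deriv f z) (at z)"
    using assms holomorphic_derivI by blast
  then have "(f has_derivative (\<lambda>h. deriv f z * h)) (at z)"
    by (simp add: has_field_derivative_def)
  from partials_of_has_derivative[OF this] this
  show "partial_x f z = deriv f z" "partial_y f z = \<i> * deriv f z" "f differentiable (at z)"
    by (auto simp: differentiable_def)
qed

lemma field_differentiable_if_cauchy_riemann:
  assumes "f differentiable (at z)" "cauchy_riemann f z = 0"
  shows "f field_differentiable (at z)"
proof -
  have "\<i> * (partial_x f z + \<i> * partial_y f z) = 0"
    using assms(2) by (simp add: cauchy_riemann_def)
  then have y: "partial_y f z = \<i> * partial_x f z" by (simp add: algebra_simps)
  have "(\<lambda>h. Re h *\<^sub>R partial_x f z + Im h *\<^sub>R partial_y f z) = (*) (partial_x f z)"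
    unfolding y by (rule ext) (simp add: complex_eq_iff algebra_simps)
  with has_derivative_partials[OF assms(1)] show ?thesis
    by (auto simp: field_differentiable_def has_field_derivative_def)
qed

lemma cauchy_riemann_holomorphic:
  assumes "f holomorphic_on S" "open S" "z \<in> S"
  shows "cauchy_riemann f z = 0"
  using partials_holomorphic[OF assms] by (simp add: cauchy_riemann_def)

lemma cauchy_riemann_add:
  assumes "f differentiable (at z)" "g differentiable (at z)"
  shows "cauchy_riemann (\<lambda>w. f w + g w) z = cauchy_riemann f z + cauchy_riemann g z"
  using partials_add[OF assms] by (simp add: cauchy_riemann_def algebra_simps)

lemma cauchy_riemann_cmult:
  assumes "f differentiable (at z)"
  shows "cauchy_riemann (\<lambda>w. c * f w) z = c * cauchy_riemann f z"
  using partials_cmult[OF assms] by (simp add: cauchy_riemann_def algebra_simps)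

lemma cauchy_riemann_cong:
  assumes "open S" "z \<in> S" "\<And>w. w \<in> S \<Longrightarrow> f w = g w" "f differentiable (at z)"
  shows "cauchy_riemann g z = cauchy_riemann f z"
  using partials_cong[OF assms] by (simp add: cauchy_riemann_def)

section \<open>Symmetry of the mixed partial derivatives\<close>

lemma vector_derivative_increment_bound:
  fixes f :: "real \<Rightarrow> 'a::real_normed_vector"
  assumes "\<And>t. t \<in> {0..h} \<Longrightarrow> (f has_vector_derivative f' t) (at t within {0..h})"
    "\<And>t. t \<in> {0..h} \<Longrightarrow> norm (f' t) \<le> B" "0 \<le> h"
  shows "norm (f h - f 0) \<le> B * norm (h - 0)"
proof (rule differentiable_bound[of "{0..h}"])
  fix t assume "t \<in> {0..h}"
  then show "(f has_derivative (\<lambda>s. s *\<^sub>R f' t)) (at t within {0..h})"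
    using assms(1) by (simp add: has_vector_derivative_def)
  show "onorm (\<lambda>s. s *\<^sub>R f' t) \<le> B"
    by (rule onorm_le) (use assms(2)[OF \<open>t \<in> {0..h}\<close>] in \<open>simp add: mult.commute[of B] mult_left_mono\<close>)
qed (use assms in auto)

text \<open>The mean value inequality is applied to the difference in direction \<open>v\<close> as
  a function of the step in direction \<open>u\<close>, after removing its expected linear part. The
  derivative compares \<open>D _ u\<close> at two points at distance at most \<open>2 * h\<close>
  and \<open>h\<close> from \<open>z\<close>; with error rate \<open>e / 3\<close> this gives the
  bound \<open>e * h\<close>, hence \<open>e * (h * h)\<close> for the increment.\<close>

lemma second_difference_quotient:
  fixes f :: "complex \<Rightarrow> complex"
  assumes "open S" "z \<in> S" "\<And>w. w \<in> S \<Longrightarrow> (f has_derivative D w) (at w)"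
    and "((\<lambda>w. D w u) has_derivative E) (at z)" "norm u = 1" "norm v = 1" "0 < e"
  shows "\<exists>d>0. \<forall>h. 0 < h \<and> h < d \<longrightarrow>
    norm (f (z + h *\<^sub>R u + h *\<^sub>R v) - f (z + h *\<^sub>R u) - f (z + h *\<^sub>R v) + f z - (h * h) *\<^sub>R E v)
      \<le> e * (h * h)"
proof -
  obtain r where r: "r > 0" "ball z r \<subseteq> S" using assms(1,2) openE by blast
  have E: "bounded_linear E" using assms(4) has_derivative_bounded_linear by blast
  obtain d where d: "d > 0" "\<And>y. norm (y - z) < d \<Longrightarrow>
      norm (D y u - D z u - E (y - z)) \<le> (e / 3) * norm (y - z)"
    using assms(4,7) unfolding has_derivative_at_alt
    by (metis zero_less_divide_iff zero_less_numeral)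
  define d' where "d' = min r d / 2"
  have d': "d' > 0" using r d by (simp add: d'_def)
  show ?thesis
  proof (intro exI[of _ d'] conjI d' allI impI)
    fix h :: real assume h: "0 < h \<and> h < d'"
    have nb: "norm (t *\<^sub>R u + s *\<^sub>R v) < min r d \<and> norm (t *\<^sub>R u + s *\<^sub>R v) \<le> \<bar>t\<bar> + \<bar>s\<bar>"
      if "\<bar>t\<bar> \<le> h" "\<bar>s\<bar> \<le> h" for t s
    proof -
      have "norm (t *\<^sub>R u + s *\<^sub>R v) \<le> \<bar>t\<bar> + \<bar>s\<bar>"
        using norm_triangle_ineq[of "t *\<^sub>R u" "s *\<^sub>R v"] assms(5,6) by simp
      with that h show ?thesis by (auto simp: d'_def)
    qed
    define \<psi> where "\<psi> t = f (z + t *\<^sub>R u + h *\<^sub>R v) - f (z + t *\<^sub>R u) - (t * h) *\<^sub>R E v" for t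
    have inS: "z + t *\<^sub>R u + s *\<^sub>R v \<in> S" if "\<bar>t\<bar> \<le> h" "\<bar>s\<bar> \<le> h" for t s
    proof -
      have "norm (t *\<^sub>R u + s *\<^sub>R v) < r" using nb[OF that] by simp
      then have "dist (z + t *\<^sub>R u + s *\<^sub>R v) z < r"
        by (simp add: dist_norm add.assoc)
      then have "z + t *\<^sub>R u + s *\<^sub>R v \<in> ball z r"
        by (metis mem_ball dist_commute)
      then show ?thesis using r by blast
    qed
    define p where "p t = D (z + t *\<^sub>R u + h *\<^sub>R v) u - D (z + t *\<^sub>R u) u - h *\<^sub>R E v" for t
    have der: "(\<psi> has_vector_derivative p t) (at t within {0..h})" if "t \<in> {0..h}" for t
    proof -
      have l: "((\<lambda>t. z + t *\<^sub>R u + c) has_derivative (\<lambda>s. s *\<^sub>R u)) (at t within {0..h})" for c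
        by (auto intro!: derivative_eq_intros)
      have 1: "((\<lambda>t. f (z + t *\<^sub>R u + c)) has_derivative (\<lambda>s. s *\<^sub>R D (z + t *\<^sub>R u + c) u)) (at t within {0..h})"
        if "z + t *\<^sub>R u + c \<in> S" for c
      proof -
        have "((\<lambda>t. f (z + t *\<^sub>R u + c)) has_derivative (\<lambda>s. D (z + t *\<^sub>R u + c) (s *\<^sub>R u))) (at t within {0..h})"
          by (rule has_derivative_compose[OF l assms(3)[OF that]])
        moreover have "D (z + t *\<^sub>R u + c) (s *\<^sub>R u) = s *\<^sub>R D (z + t *\<^sub>R u + c) u" for s
          using has_derivative_bounded_linear[OF assms(3)[OF that]] by (simp add: linear_simps)
        ultimately show ?thesis by simp
      qed
      have A: "z + t *\<^sub>R u + h *\<^sub>R v \<in> S" using inS[of t h] that h by auto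
      have B: "z + t *\<^sub>R u + 0 \<in> S" using inS[of t 0] that h by auto
      show ?thesis unfolding \<psi>_def p_def has_vector_derivative_def
        by (rule has_derivative_eq_rhs, rule has_derivative_diff, rule has_derivative_diff,
            rule 1[OF A], use 1[OF B] in simp, (rule derivative_intros)+)
          (auto simp: algebra_simps)
    qed
    have pb: "norm (p t) \<le> e * h" if "t \<in> {0..h}" for t
    proof -
      have a1: "norm (D (z + (t *\<^sub>R u + h *\<^sub>R v)) u - D z u - E (t *\<^sub>R u + h *\<^sub>R v)) \<le> (e/3) * norm (t *\<^sub>R u + h *\<^sub>R v)"
        using d(2)[of "z + (t *\<^sub>R u + h *\<^sub>R v)"] nb[of t h] that h by auto
      have a2: "norm (D (z + t *\<^sub>R u) u - D z u - E (t *\<^sub>R u)) \<le> (e/3) * norm (t *\<^sub>R u)"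
        using d(2)[of "z + t *\<^sub>R u"] nb[of t 0] that h by auto
      have "p t = (D (z + (t *\<^sub>R u + h *\<^sub>R v)) u - D z u - E (t *\<^sub>R u + h *\<^sub>R v))
         - (D (z + t *\<^sub>R u) u - D z u - E (t *\<^sub>R u))"
        unfolding p_def by (simp add: linear_simps[OF E] add.assoc)
      then have "norm (p t) \<le> (e/3) * norm (t *\<^sub>R u + h *\<^sub>R v) + (e/3) * norm (t *\<^sub>R u)"
        using norm_triangle_ineq4[of "D (z + (t *\<^sub>R u + h *\<^sub>R v)) u - D z u - E (t *\<^sub>R u + h *\<^sub>R v)"
          "D (z + t *\<^sub>R u) u - D z u - E (t *\<^sub>R u)"] a1 a2 by simp
      also have "\<dots> \<le> (e/3) * (2 * h) + (e/3) * h"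
        using nb[of t h] nb[of t 0] that h assms(5,7) by (intro add_mono mult_left_mono) auto
      finally show ?thesis by (simp add: algebra_simps)
    qed
    have "norm (\<psi> h - \<psi> 0) \<le> (e * h) * norm (h - 0)"
      by (rule vector_derivative_increment_bound[OF der pb]) (use h in auto)
    moreover have "\<psi> h - \<psi> 0 = f (z + h *\<^sub>R u + h *\<^sub>R v) - f (z + h *\<^sub>R u) - f (z + h *\<^sub>R v) + f z - (h * h) *\<^sub>R E v"
      by (simp add: \<psi>_def)
    ultimately show "norm (f (z + h *\<^sub>R u + h *\<^sub>R v) - f (z + h *\<^sub>R u) - f (z + h *\<^sub>R v) + f z - (h * h) *\<^sub>R E v)
      \<le> e * (h * h)" using h by (simp add: mult.assoc)
  qed
qed

text \<open>The second difference is symmetric in the two directions, so both mixed derivatives are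
  limits of the same quotient. Differentiability of the first partial derivatives at the single
  point \<open>z\<close> suffices (Young's form of the theorem).\<close>

lemma partials_commute:
  assumes "open S" "z \<in> S" "\<And>w. w \<in> S \<Longrightarrow> f differentiable (at w)"
    and "partial_x f differentiable (at z)" "partial_y f differentiable (at z)"
  shows "partial_x (partial_y f) z = partial_y (partial_x f) z"
proof (rule ccontr)
  define D where "D w = (\<lambda>h. Re h *\<^sub>R partial_x f w + Im h *\<^sub>R partial_y f w)" for w
  let ?A = "partial_x (partial_y f) z" and ?B = "partial_y (partial_x f) z"
  assume ne: "?A \<noteq> ?B"
  define e where "e = norm (?A - ?B) / 3"
  have e: "e > 0" using ne by (simp add: e_def)
  have D: "(f has_derivative D w) (at w)" if "w \<in> S" for w
    unfolding D_def using has_derivative_partials assms(3) that by blast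
  have Dx: "(\<lambda>w. D w 1) = partial_x f" and Dy: "(\<lambda>w. D w \<i>) = partial_y f"
    by (auto simp: D_def)
  note X = second_difference_quotient[OF assms(1,2) D, of 1 _ \<i>, unfolded Dx,
      OF _ has_derivative_partials[OF assms(4)] norm_one norm_ii e]
  note Y = second_difference_quotient[OF assms(1,2) D, of \<i> _ 1, unfolded Dy,
      OF _ has_derivative_partials[OF assms(5)] norm_ii norm_one e]
  obtain d1 where d1: "d1 > 0" "\<And>h. 0 < h \<Longrightarrow> h < d1 \<Longrightarrow>
    norm (f (z + h *\<^sub>R 1 + h *\<^sub>R \<i>) - f (z + h *\<^sub>R 1) - f (z + h *\<^sub>R \<i>) + f z - (h * h) *\<^sub>R ?B) \<le> e * (h * h)"
    using X by auto
  obtain d2 where d2: "d2 > 0" "\<And>h. 0 < h \<Longrightarrow> h < d2 \<Longrightarrow>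
    norm (f (z + h *\<^sub>R \<i> + h *\<^sub>R 1) - f (z + h *\<^sub>R \<i>) - f (z + h *\<^sub>R 1) + f z - (h * h) *\<^sub>R ?A) \<le> e * (h * h)"
    using Y by auto
  define h where "h = min d1 d2 / 2"
  have h: "0 < h" "h < d1" "h < d2" using d1(1) d2(1) by (auto simp: h_def)
  let ?T = "f (z + h *\<^sub>R 1 + h *\<^sub>R \<i>) - f (z + h *\<^sub>R 1) - f (z + h *\<^sub>R \<i>) + f z"
  have "norm (?T - (h * h) *\<^sub>R ?B) \<le> e * (h * h)" using d1(2) h by auto
  moreover have "norm (?T - (h * h) *\<^sub>R ?A) \<le> e * (h * h)"
    using d2(2)[OF h(1,3)] by (simp add: algebra_simps)
  ultimately have "norm ((?T - (h * h) *\<^sub>R ?B) - (?T - (h * h) *\<^sub>R ?A)) \<le> 2 * e * (h * h)"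
    using norm_triangle_ineq4[of "?T - (h * h) *\<^sub>R ?B" "?T - (h * h) *\<^sub>R ?A"] by linarith
  also have "(?T - (h * h) *\<^sub>R ?B) - (?T - (h * h) *\<^sub>R ?A) = (h * h) *\<^sub>R (?A - ?B)"
    by (simp add: scaleR_diff_right)
  finally have "(h * h) * norm (?A - ?B) \<le> 2 * e * (h * h)" using h by simp
  then have "norm (?A - ?B) \<le> 2 * e" using h by (simp add: mult.commute)
  then show False using e by (simp add: e_def)
qed

text \<open>\<open>jet\<close> imposes \<open>Q\<close> on the iterated partial derivatives in every order of differentiation, so
  that product and convolution arguments need no multi-index bookkeeping.\<close>

definition local_on :: "complex set \<Rightarrow> ((complex \<Rightarrow> complex) \<Rightarrow> bool) \<Rightarrow> bool" where
  "local_on S Q \<longleftrightarrow> (\<forall>f g. Q f \<longrightarrow> (\<forall>z\<in>S. f z = g z) \<longrightarrow> Q g)"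

definition add_closed :: "((complex \<Rightarrow> complex) \<Rightarrow> bool) \<Rightarrow> bool" where
  "add_closed Q \<longleftrightarrow> (\<forall>f g. Q f \<longrightarrow> Q g \<longrightarrow> Q (\<lambda>w. f w + g w))"

lemma local_onD: "local_on S Q \<Longrightarrow> Q f \<Longrightarrow> (\<And>z. z \<in> S \<Longrightarrow> f z = g z) \<Longrightarrow> Q g"
  by (auto simp: local_on_def)

lemma add_closedD: "add_closed Q \<Longrightarrow> Q f \<Longrightarrow> Q g \<Longrightarrow> Q (\<lambda>w. f w + g w)"
  by (simp add: add_closed_def)

primrec jet :: "complex set \<Rightarrow> ((complex \<Rightarrow> complex) \<Rightarrow> bool) \<Rightarrow> nat \<Rightarrow> (complex \<Rightarrow> complex) \<Rightarrow> bool" where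
  "jet S Q 0 f \<longleftrightarrow> Q f"
| "jet S Q (Suc k) f \<longleftrightarrow> Q f \<and> (\<forall>z\<in>S. f differentiable (at z)) \<and>
     jet S Q k (partial_x f) \<and> jet S Q k (partial_y f)"

definition smooth_with :: "complex set \<Rightarrow> ((complex \<Rightarrow> complex) \<Rightarrow> bool) \<Rightarrow> (complex \<Rightarrow> complex) \<Rightarrow> bool" where
  "smooth_with S Q f \<longleftrightarrow> (\<forall>k. jet S Q k f)"

lemma smooth_withD:
  assumes "smooth_with S Q f"
  shows "Q f" "z \<in> S \<Longrightarrow> f differentiable (at z)"
    "smooth_with S Q (partial_x f)" "smooth_with S Q (partial_y f)"
proof -
  have "jet S Q (Suc k) f" for k using assms unfolding smooth_with_def by blast
  then show "Q f" "z \<in> S \<Longrightarrow> f differentiable (at z)"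
    "smooth_with S Q (partial_x f)" "smooth_with S Q (partial_y f)"
    unfolding smooth_with_def by simp_all
qed

text \<open>Replaces inductions on the order of differentiation: it suffices to exhibit a family
  that is closed under both partial derivatives, such as multiples of flat functions or convolutions
  with a fixed kernel.\<close>

lemma smooth_with_coinduct:
  assumes "R f" "\<And>f. R f \<Longrightarrow> Q f" "\<And>f z. R f \<Longrightarrow> z \<in> S \<Longrightarrow> f differentiable (at z)"
    "\<And>f. R f \<Longrightarrow> R (partial_x f)" "\<And>f. R f \<Longrightarrow> R (partial_y f)"
  shows "smooth_with S Q f"
proof -
  have "R f \<Longrightarrow> jet S Q k f" for k f
    by (induction k arbitrary: f) (auto intro: assms(2-))
  with assms(1) show ?thesis by (simp add: smooth_with_def)
qed

lemma jet_mono: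
  assumes "S' \<subseteq> S" "\<And>f. Q f \<Longrightarrow> Q' f"
  shows "jet S Q k f \<Longrightarrow> jet S' Q' k f"
proof (induction k arbitrary: f)
  case 0
  then show ?case using assms(2) by simp
next
  case (Suc k)
  then show ?case using assms(2)[of f] subsetD[OF assms(1)] by simp
qed

lemma smooth_with_mono:
  assumes "smooth_with S Q f" "S' \<subseteq> S" "\<And>f. Q f \<Longrightarrow> Q' f"
  shows "smooth_with S' Q' f"
  using assms(1) jet_mono[of S' S Q Q', OF assms(2,3)] by (simp add: smooth_with_def)

lemma jet_pred:
  assumes "jet S Q (Suc k) f"
  shows "jet S Q k f"
  using assms
proof (induction k arbitrary: f)
  case (Suc k)
  have "jet S Q (Suc k) (partial_x f)" "jet S Q (Suc k) (partial_y f)"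
    "Q f" "\<forall>z\<in>S. f differentiable (at z)"
    using iffD1[OF jet.simps(2) Suc.prems] by blast+
  then show ?case using Suc.IH unfolding jet.simps(2)[of S Q k] by blast
qed (simp only: jet.simps)

lemma jet_cong:
  assumes "open S" "local_on S Q" "jet S Q k f" "\<And>z. z \<in> S \<Longrightarrow> f z = g z"
  shows "jet S Q k g"
  using assms(3,4)
proof (induction k arbitrary: f g)
  case 0
  then show ?case unfolding jet.simps by (rule local_onD[OF assms(2)])
next
  case (Suc k)
  have d: "f differentiable (at z)" if "z \<in> S" for z using Suc that by simp
  have "jet S Q k (partial_x g)"
    by (rule Suc.IH[of "partial_x f"])
      (use Suc.prems partials_cong(1)[OF assms(1) _ _ d, of _ g] in auto)
  moreover have "jet S Q k (partial_y g)"
    by (rule Suc.IH[of "partial_y f"])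
      (use Suc.prems partials_cong(2)[OF assms(1) _ _ d, of _ g] in auto)
  moreover have "\<forall>z\<in>S. g differentiable (at z)"
    using partials_cong(3)[OF assms(1) _ _ d, of _ g] Suc.prems by auto
  moreover have "Q g" using local_onD[OF assms(2), where ?f=f and ?g = g] Suc.prems by simp
  ultimately show ?case by simp
qed

lemma smooth_with_cong:
  assumes "smooth_with S Q f" "open S" "local_on S Q" "\<And>z. z \<in> S \<Longrightarrow> f z = g z"
  shows "smooth_with S Q g"
  using jet_cong[OF assms(2,3) _ assms(4)] assms(1) by (simp add: smooth_with_def)

lemma jet_add:
  assumes "open S" "local_on S Q" "add_closed Q" "jet S Q k f" "jet S Q k g"
  shows "jet S Q k (\<lambda>w. f w + g w)"
  using assms(4,5)
proof (induction k arbitrary: f g)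
  case 0
  then show ?case using add_closedD[OF assms(3)] by simp
next
  case (Suc k)
  have d: "f differentiable (at z)" "g differentiable (at z)" if "z \<in> S" for z
    using Suc.prems that by auto
  have j: "jet S Q k (partial_x f)" "jet S Q k (partial_x g)"
    "jet S Q k (partial_y f)" "jet S Q k (partial_y g)" "Q f" "Q g" using Suc.prems by auto
  have "jet S Q k (partial_x (\<lambda>w. f w + g w))"
    by (rule jet_cong[OF assms(1,2) Suc.IH[OF j(1,2)]]) (simp add: partials_add d)
  moreover have "jet S Q k (partial_y (\<lambda>w. f w + g w))"
    by (rule jet_cong[OF assms(1,2) Suc.IH[OF j(3,4)]]) (simp add: partials_add d)
  ultimately show ?case using d add_closedD[OF assms(3)] j by (simp add: differentiable_add)
qed

lemma smooth_with_add:
  assumes "smooth_with S Q f" "smooth_with S Q g" "open S" "local_on S Q" "add_closed Q"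
  shows "smooth_with S Q (\<lambda>w. f w + g w)"
  using jet_add[OF assms(3,4,5)] assms(1,2) by (simp add: smooth_with_def)

text \<open>Leibniz rule. The factors may satisfy different conditions because the typical product
  is a function with weighted bounds times a bounded cut-off.\<close>

lemma jet_mult:
  assumes S: "open S" and Q: "local_on S Q" "add_closed Q"
    and m: "\<And>f g. Q1 f \<Longrightarrow> Q2 g \<Longrightarrow> Q (\<lambda>w. f w * g w)"
    and "jet S Q1 k f" "jet S Q2 k g"
  shows "jet S Q k (\<lambda>w. f w * g w)"
  using assms(5,6)
proof (induction k arbitrary: f g)
  case 0
  then show ?case unfolding jet.simps by (rule m)
next
  case (Suc k)
  have d: "f differentiable (at z)" "g differentiable (at z)" if "z \<in> S" for z
    using Suc.prems that by auto
  have j: "jet S Q1 k (partial_x f)" "jet S Q2 k (partial_x g)"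
    "jet S Q1 k (partial_y f)" "jet S Q2 k (partial_y g)" "Q1 f" "Q2 g" using Suc.prems by auto
  have fg: "jet S Q1 k f" "jet S Q2 k g" using Suc.prems jet_pred by blast+
  have "jet S Q k (partial_x (\<lambda>w. f w * g w))"
    by (rule jet_cong[OF S Q(1) jet_add[OF S Q Suc.IH[OF j(1) fg(2)] Suc.IH[OF fg(1) j(2)]]])
      (simp add: partials_mult d)
  moreover have "jet S Q k (partial_y (\<lambda>w. f w * g w))"
    by (rule jet_cong[OF S Q(1) jet_add[OF S Q Suc.IH[OF j(3) fg(2)] Suc.IH[OF fg(1) j(4)]]])
      (simp add: partials_mult d)
  moreover have "\<forall>z\<in>S. (\<lambda>w. f w * g w) differentiable (at z)"
    using d by (intro ballI differentiable_mult)
  moreover have "Q (\<lambda>w. f w * g w)" by (rule m[OF j(5,6)])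
  ultimately show ?case unfolding jet.simps by (intro conjI)
qed

lemma smooth_with_mult:
  assumes "smooth_with S Q1 f" "smooth_with S Q2 g" "open S" "local_on S Q" "add_closed Q"
    "\<And>f g. Q1 f \<Longrightarrow> Q2 g \<Longrightarrow> Q (\<lambda>w. f w * g w)"
  shows "smooth_with S Q (\<lambda>w. f w * g w)"
  unfolding smooth_with_def
proof
  fix k
  have j: "jet S Q1 k f" "jet S Q2 k g" using assms(1,2) by (simp_all add: smooth_with_def)
  show "jet S Q k (\<lambda>w. f w * g w)"
    by (rule jet_mult[where ?Q1.0 = Q1 and ?Q2.0 = Q2, OF assms(3,4,5) _ j]) (rule assms(6))
qed

lemma smooth_with_cmult:
  assumes "smooth_with S Q f" "open S" "local_on S Q" "\<And>f. Q f \<Longrightarrow> Q (\<lambda>w. c * f w)"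
  shows "smooth_with S Q (\<lambda>w. c * f w)"
proof -
  have "jet S Q k f \<Longrightarrow> jet S Q k (\<lambda>w. c * f w)" for k f
  proof (induction k arbitrary: f)
    case (Suc k)
    have d: "f differentiable (at z)" if "z \<in> S" for z using Suc that by auto
    have j: "jet S Q k (partial_x f)" "jet S Q k (partial_y f)" "Q f" using Suc.prems by auto
    have "jet S Q k (partial_x (\<lambda>w. c * f w))"
      by (rule jet_cong[OF assms(2,3) Suc.IH[OF j(1)]]) (simp add: partials_cmult d)
    moreover have "jet S Q k (partial_y (\<lambda>w. c * f w))"
      by (rule jet_cong[OF assms(2,3) Suc.IH[OF j(2)]]) (simp add: partials_cmult d)
    ultimately show ?case using d assms(4) j by (simp add: differentiable_mult)
  qed (use assms in auto)
  with assms(1) show ?thesis by (simp add: smooth_with_def)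
qed

lemma smooth_with_cnj:
  assumes "smooth_with S Q f" "open S" "local_on S Q" "\<And>f. Q f \<Longrightarrow> Q (\<lambda>w. cnj (f w))"
  shows "smooth_with S Q (\<lambda>w. cnj (f w))"
proof -
  have "jet S Q k f \<Longrightarrow> jet S Q k (\<lambda>w. cnj (f w))" for k f
  proof (induction k arbitrary: f)
    case (Suc k)
    have d: "f differentiable (at z)" if "z \<in> S" for z using Suc that by auto
    have j: "jet S Q k (partial_x f)" "jet S Q k (partial_y f)" "Q f" using Suc.prems by auto
    have "jet S Q k (partial_x (\<lambda>w. cnj (f w)))"
      by (rule jet_cong[OF assms(2,3) Suc.IH[OF j(1)]]) (simp add: partials_cnj d)
    moreover have "jet S Q k (partial_y (\<lambda>w. cnj (f w)))"
      by (rule jet_cong[OF assms(2,3) Suc.IH[OF j(2)]]) (simp add: partials_cnj d)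
    ultimately show ?case using d assms(4) j by (simp add: partials_cnj)
  qed (use assms in auto)
  with assms(1) show ?thesis by (simp add: smooth_with_def)
qed

lemma Cinf_on_iff_smooth_with: "Cinf_on f S \<longleftrightarrow> smooth_with S (\<lambda>_. True) f"
proof
  assume "Cinf_on f S"
  then show "smooth_with S (\<lambda>_. True) f"
  proof (rule smooth_with_coinduct[where R = "\<lambda>f. Cinf_on f S"])
    fix f assume "Cinf_on f S"
    then have s: "Ck_on (Suc k) f S" for k unfolding Cinf_on_def by blast
    show "Cinf_on (partial_x f) S" "Cinf_on (partial_y f) S"
      using s by (auto simp: Cinf_on_def)
    show "f differentiable (at z)" if "z \<in> S" for z using s that by auto
  qed auto
next
  assume sm: "smooth_with S (\<lambda>_. True) f"
  have "smooth_with S (\<lambda>_. True) f \<Longrightarrow> Ck_on k f S" for k f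
  proof (induction k arbitrary: f)
    case 0
    have "continuous (at z) f" if "z \<in> S" for z
      using smooth_withD(2)[OF 0 that] by (rule differentiable_imp_continuous_within)
    then show ?case
      by (simp add: continuous_at_imp_continuous_on)
  next
    case (Suc k)
    show ?case using smooth_withD(2)[OF Suc.prems] Suc.IH[OF smooth_withD(3)[OF Suc.prems]]
        Suc.IH[OF smooth_withD(4)[OF Suc.prems]] by simp
  qed
  with sm show "Cinf_on f S" by (simp add: Cinf_on_def)
qed

lemma smooth_with_partials_commute:
  assumes "smooth_with S Q f" "open S" "z \<in> S"
  shows "partial_x (partial_y f) z = partial_y (partial_x f) z"
  by (rule partials_commute[OF assms(2,3)])
    (use assms smooth_withD(2) smooth_withD(3,4)[OF assms(1)] in blast)+

lemma smooth_with_mixed_partial: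
  assumes "smooth_with S Q f"
  shows "smooth_with S Q (mixed_partial \<alpha> f)"
proof -
  have y: "smooth_with S Q ((partial_y ^^ j) f)" for j
    by (induction j) (use assms smooth_withD in auto)
  have "smooth_with S Q ((partial_x ^^ i) ((partial_y ^^ j) f))" for i j
    by (induction i) (use y smooth_withD in auto)
  then show ?thesis by (simp add: mixed_partial_def)
qed

text \<open>The seminorms only see derivatives taken first in \<open>y\<close> and then in
  \<open>x\<close>. As the partial derivatives commute, every iterated derivative agrees on
  \<open>S\<close> with one of these, and locality transfers \<open>Q\<close>.\<close>

lemma smooth_with_of_mixed_partials:
  assumes sm: "Cinf_on f S" and S: "open S" and cong: "local_on S Q"
    and Q: "\<And>\<alpha>. Q (mixed_partial \<alpha> f)"
  shows "smooth_with S Q f"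
proof (rule smooth_with_coinduct[where R = "\<lambda>h. \<exists>i j. \<forall>z\<in>S. h z = mixed_partial (i, j) f z"])
  have smm: "smooth_with S (\<lambda>_. True) (mixed_partial \<alpha> f)" for \<alpha>
    using smooth_with_mixed_partial sm by (simp add: Cinf_on_iff_smooth_with)
  \<comment> \<open>Induction on \<open>i\<close> moves the new \<open>y\<close>-derivative inwards
    past all \<open>x\<close>-derivatives.\<close>
  have comm: "partial_y (mixed_partial (i, j) f) z = mixed_partial (i, Suc j) f z" if "z \<in> S" for i j z
    using that
  proof (induction i arbitrary: z)
    case (Suc i)
    have "partial_y (mixed_partial (Suc i, j) f) z = partial_y (partial_x (mixed_partial (i, j) f)) z"
      by (simp add: mixed_partial_def)
    also have "\<dots> = partial_x (partial_y (mixed_partial (i, j) f)) z"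
      using smooth_with_partials_commute[OF smm S Suc.prems] by simp
    also have "\<dots> = partial_x (mixed_partial (i, Suc j) f) z"
      by (rule partials_cong(1)[OF S Suc.prems, symmetric])
        (use Suc.IH smooth_withD(2)[OF smooth_withD(4)[OF smm]] Suc.prems in auto)
    finally show ?case by (simp add: mixed_partial_def)
  qed (simp add: mixed_partial_def)
  fix h assume "\<exists>i j. \<forall>z\<in>S. h z = mixed_partial (i, j) f z"
  then obtain i j where h: "\<And>z. z \<in> S \<Longrightarrow> h z = mixed_partial (i, j) f z" by blast
  show "Q h" by (rule local_onD[OF cong, OF Q[of "(i, j)"]]) (simp add: h)
  have d: "mixed_partial (i, j) f differentiable (at z)" if "z \<in> S" for z
    using smooth_withD(2)[OF smm] that by blast
  then show "h differentiable (at z)" if "z \<in> S" for z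
    using partials_cong(3)[OF S that, of "mixed_partial (i, j) f" h] h that by auto
  have "partial_x h z = mixed_partial (Suc i, j) f z" if "z \<in> S" for z
    using partials_cong(1)[OF S that, of "mixed_partial (i, j) f" h] h that d
    by (auto simp: mixed_partial_def)
  then show "\<exists>i j. \<forall>z\<in>S. partial_x h z = mixed_partial (i, j) f z" by blast
  have "partial_y h z = mixed_partial (i, Suc j) f z" if "z \<in> S" for z
    using partials_cong(2)[OF S that, of "mixed_partial (i, j) f" h] h that d comm by auto
  then show "\<exists>i j. \<forall>z\<in>S. partial_y h z = mixed_partial (i, j) f z" by blast
next
  show "\<exists>i j. \<forall>z\<in>S. f z = mixed_partial (i, j) f z"
    by (rule exI[of _ 0], rule exI[of _ 0]) (simp add: mixed_partial_def)
qed

text \<open>The complement of \<open>D\<close> is open, so all derivatives vanish there as well. The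
  support condition may be used to pass from \<open>Q\<close> to a stronger \<open>Q'\<close>:
  bounds on smaller strips become bounds on the whole plane.\<close>

lemma smooth_with_zero_outside:
  assumes "smooth_with S Q f" "open S" "closed D" "D \<subseteq> S" "\<And>z. z \<notin> D \<Longrightarrow> f z = 0"
    and Q: "\<And>f. Q f \<Longrightarrow> (\<And>z. z \<notin> D \<Longrightarrow> f z = 0) \<Longrightarrow> Q' f"
  shows "smooth_with UNIV Q' f"
proof (rule smooth_with_coinduct[where R = "\<lambda>f. smooth_with S Q f \<and> (\<forall>z. z \<notin> D \<longrightarrow> f z = 0)"])
  fix f assume f: "smooth_with S Q f \<and> (\<forall>z. z \<notin> D \<longrightarrow> f z = 0)"
  have out: "partial_x f z = 0 \<and> partial_y f z = 0 \<and> f differentiable (at z)" if "z \<notin> D" for z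
    using partials_cong[of "- D" z "\<lambda>w. 0" f] that f \<open>closed D\<close> by (auto simp: closed_def)
  show "smooth_with S Q (partial_x f) \<and> (\<forall>z. z \<notin> D \<longrightarrow> partial_x f z = 0)"
    "smooth_with S Q (partial_y f) \<and> (\<forall>z. z \<notin> D \<longrightarrow> partial_y f z = 0)"
    using f smooth_withD(3,4) out by blast+
  show "f differentiable (at z)" for z
    using out smooth_withD(2) f assms(4) by blast
  show "Q' f" using Q smooth_withD(1) f by blast
qed (use assms in auto)

text \<open>Each iterated partial derivative is a power of the imaginary unit times a complex
  derivative, so stability under \<open>deriv\<close> is all that has to be known about
  \<open>P\<close>.\<close>

lemma smooth_with_holomorphic:
  assumes "f holomorphic_on S" "open S" "\<And>f. f holomorphic_on S \<Longrightarrow> P f \<Longrightarrow> P (deriv f)"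
    "P f" "\<And>c f g. P f \<Longrightarrow> (\<And>z. z \<in> S \<Longrightarrow> g z = c * f z) \<Longrightarrow> Q g"
  shows "smooth_with S Q f"
proof (rule smooth_with_coinduct[where R = "\<lambda>h. \<exists>f c. f holomorphic_on S \<and> P f \<and> (\<forall>z\<in>S. h z = c * f z)"])
  show "\<exists>fa c. fa holomorphic_on S \<and> P fa \<and> (\<forall>z\<in>S. f z = c * fa z)"
    using assms by (intro exI[of _ f] exI[of _ 1]) auto
  fix h assume "\<exists>f c. f holomorphic_on S \<and> P f \<and> (\<forall>z\<in>S. h z = c * f z)"
  then obtain f c where f: "f holomorphic_on S" "P f" "\<And>z. z \<in> S \<Longrightarrow> h z = c * f z" by blast
  show "Q h" using assms(5) f by blast
  have hh: "partial_x h z = c * deriv f z \<and> partial_y h z = (c * \<i>) * deriv f z \<and> h differentiable (at z)"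
    if "z \<in> S" for z
    using partials_cong[OF assms(2) that, of "\<lambda>w. c * f w" h] f that
      partials_holomorphic[OF f(1) assms(2) that] by (auto simp: partials_cmult)
  show "h differentiable (at z)" if "z \<in> S" for z using hh that by blast
  have "deriv f holomorphic_on S" using f(1) assms(2) holomorphic_deriv by blast
  moreover have "P (deriv f)" using assms(3) f by blast
  ultimately show "\<exists>f c. f holomorphic_on S \<and> P f \<and> (\<forall>z\<in>S. partial_x h z = c * f z)"
    "\<exists>f c. f holomorphic_on S \<and> P f \<and> (\<forall>z\<in>S. partial_y h z = c * f z)"
    using hh by blast+
qed

section \<open>Weight systems and decay on half strips\<close>

lemma weight_nonneg: "weight_system W \<Longrightarrow> 0 \<le> t \<Longrightarrow> 0 \<le> W N t"
  by (simp add: weight_system_def weight_function_def)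

lemma weight_mono: "weight_system W \<Longrightarrow> 0 \<le> s \<Longrightarrow> s \<le> t \<Longrightarrow> W N s \<le> W N t"
  by (auto simp: weight_system_def weight_function_def mono_on_def)

lemma weight_index_mono:
  assumes "weight_system W" "0 \<le> t" "N \<le> M"
  shows "W N t \<le> W M t"
  using assms(3)
proof (induction M rule: dec_induct)
  case (step M)
  have "W M t \<le> W (Suc M) t" using assms(1,2) by (simp add: weight_system_def)
  with step.IH show ?case by simp
qed simp

lemma weight_unbounded:
  assumes "weight_system W"
  obtains t where "0 \<le> t" "\<And>s. t \<le> s \<Longrightarrow> B < W N s"
proof -
  have "\<not> bdd_above (W N ` {0..})" using assms by (simp add: weight_system_def weight_function_def)
  then obtain t where t: "0 \<le> t" "B < W N t" unfolding bdd_above_def by (force simp: not_le)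
  then have "B < W N s" if "t \<le> s" for s using weight_mono[OF assms t(1) that, of N] by simp
  with t that show ?thesis by blast
qed

text \<open>Since \<open>s + t\<close> is at most twice the larger of the two, the doubling
  condition gives subadditivity up to a constant and a change of index. After exponentiation this is
  the submultiplicativity that convolution estimates require.\<close>

lemma weight_add:
  assumes "weight_system W" "cond_alpha W"
  obtains M C where "N \<le> M" "0 \<le> C" "\<And>s t. 0 \<le> s \<Longrightarrow> 0 \<le> t \<Longrightarrow> W N (s + t) \<le> W M s + W M t + C"
proof -
  obtain M A where M: "N < M" "A > 1" "\<And>t. 0 \<le> t \<Longrightarrow> W N (2 * t) \<le> W M t + ln A"
    using assms(2) unfolding cond_alpha_def by blast
  have "W N (s + t) \<le> W M s + W M t + ln A" if "0 \<le> s" "0 \<le> t" for s t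
  proof -
    have "W N (s + t) \<le> W N (2 * max s t)" by (rule weight_mono[OF assms(1)]) (use that in auto)
    also have "\<dots> \<le> W M (max s t) + ln A" by (rule M(3)) (use that in auto)
    also have "W M (max s t) \<le> W M s + W M t"
      using weight_nonneg[OF assms(1) that(1), of M] weight_nonneg[OF assms(1) that(2), of M]
      by (simp add: max_def)
    finally show ?thesis by simp
  qed
  with M that[of M "ln A"] show ?thesis by simp
qed

definition subexponential :: "(nat \<Rightarrow> real \<Rightarrow> real) \<Rightarrow> bool" where
  "subexponential W \<longleftrightarrow> (\<forall>N. \<forall>\<mu>>0. \<exists>C\<ge>0. \<forall>t\<ge>0. W N t \<le> C * exp (\<mu> * t))"

text \<open>Monotonicity makes the integral condition pointwise: the integral over
  \<open>{t..t+1}\<close> is at least \<open>W N t * exp (- \<mu> * (t + 1))\<close>. Conversely,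
  the pointwise bound with rate \<open>\<mu> / 2\<close> leaves an integrable factor
  \<open>exp (- (\<mu> / 2) * t)\<close>.\<close>

lemma cond_eps0_iff_subexponential:
  assumes W: "weight_system W"
  shows "cond_eps0 W \<longleftrightarrow> subexponential W"
proof
  assume eps: "cond_eps0 W"
  show "subexponential W"
    unfolding subexponential_def
  proof (intro allI impI)
    fix N and \<mu> :: real assume \<mu>: "\<mu> > 0"
    define I where "I = (\<integral>\<^sup>+ t\<in>{0..}. ennreal (W N t * exp (- \<mu> * t)) \<partial>lborel)"
    have I: "I < \<infinity>" using eps \<mu> by (simp add: cond_eps0_def I_def)
    show "\<exists>C\<ge>0. \<forall>t\<ge>0. W N t \<le> C * exp (\<mu> * t)"
    proof (intro exI conjI allI impI)
      show "0 \<le> enn2real I * exp \<mu>" by simp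
      fix t :: real assume t: "0 \<le> t"
      have nn: "0 \<le> W N t * exp (- \<mu> * (t + 1))" using weight_nonneg[OF W t] by simp
      have "ennreal (W N t * exp (- \<mu> * (t + 1)))
          = (\<integral>\<^sup>+ s. ennreal (W N t * exp (- \<mu> * (t + 1))) * indicator {t..t+1} s \<partial>lborel)"
        by (subst nn_integral_cmult_indicator) simp_all
      also have "\<dots> \<le> I" unfolding I_def
      proof (rule nn_integral_mono)
        fix s :: real
        show "ennreal (W N t * exp (- \<mu> * (t + 1))) * indicator {t..t+1} s
          \<le> ennreal (W N s * exp (- \<mu> * s)) * indicator {0..} s"
        proof (cases "s \<in> {t..t+1}")
          case True
          have "W N t * exp (- \<mu> * (t + 1)) \<le> W N s * exp (- \<mu> * s)"
            using True t \<mu> weight_mono[OF W t, of s N] weight_nonneg[OF W, of s N]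
            by (intro mult_mono) auto
          with True t show ?thesis by (simp add: ennreal_leI)
        qed simp
      qed
      finally have "W N t * exp (- \<mu> * (t + 1)) \<le> enn2real I"
        using I nn by (metis enn2real_ennreal enn2real_mono infinity_ennreal_def)
      then have "W N t * exp (- \<mu> * (t + 1)) * exp (\<mu> * (t + 1)) \<le> enn2real I * exp (\<mu> * (t + 1))"
        by (rule mult_right_mono) simp
      moreover have "exp (- \<mu> * (t + 1)) * exp (\<mu> * (t + 1)) = 1"
        by (simp flip: exp_add)
      ultimately show "W N t \<le> enn2real I * exp \<mu> * exp (\<mu> * t)"
        by (simp add: mult.assoc distrib_left flip: exp_add) (simp add: add.commute)
    qed
  qed
next
  assume sub: "subexponential W"
  show "cond_eps0 W"
    unfolding cond_eps0_def
  proof (intro allI impI)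
    fix N and \<mu> :: real assume \<mu>: "\<mu> > 0"
    then obtain C where C: "0 \<le> C" "\<And>t. 0 \<le> t \<Longrightarrow> W N t \<le> C * exp (\<mu> / 2 * t)"
      using sub unfolding subexponential_def by (metis half_gt_zero)
    have "(\<integral>\<^sup>+ t\<in>{0..}. ennreal (W N t * exp (- \<mu> * t)) \<partial>lborel)
        \<le> (\<integral>\<^sup>+ t. ennreal (C * exp (- (\<mu> / 2) * t)) * indicator {0..} t \<partial>lborel)"
    proof (rule nn_integral_mono)
      fix t :: real
      show "ennreal (W N t * exp (- \<mu> * t)) * indicator {0..} t
        \<le> ennreal (C * exp (- (\<mu> / 2) * t)) * indicator {0..} t"
      proof (cases "0 \<le> t")
        case True
        have "W N t * exp (- \<mu> * t) \<le> C * exp (\<mu> / 2 * t) * exp (- \<mu> * t)"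
          using C(2)[OF True] by (rule mult_right_mono) simp
        also have "\<dots> = C * exp (- (\<mu> / 2) * t)"
          by (simp add: mult.assoc flip: exp_add)
        finally show ?thesis using True by (simp add: ennreal_leI)
      qed simp
    qed
    also have "\<dots> = ennreal (0 - (- (C / (\<mu> / 2)) * exp (- (\<mu> / 2) * 0)))"
    proof (rule nn_integral_FTC_atLeast)
      fix x :: real
      show "((\<lambda>t. - (C / (\<mu> / 2)) * exp (- (\<mu> / 2) * t)) has_real_derivative C * exp (- (\<mu> / 2) * x)) (at x)"
        using \<mu> by (auto intro!: derivative_eq_intros)
      show "0 \<le> C * exp (- (\<mu> / 2) * x)" using C by simp
    next
      have "((\<lambda>t. exp (- (\<mu> / 2 * t))) \<longlongrightarrow> 0) at_top"
        using \<mu> by (intro filterlim_compose[OF exp_at_bot] filterlim_uminus_at_bot_at_top[THEN filterlim_compose]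
          filterlim_tendsto_pos_mult_at_top[OF tendsto_const]) (auto simp: filterlim_ident)
      then show "((\<lambda>t. - (C / (\<mu> / 2)) * exp (- (\<mu> / 2) * t)) \<longlongrightarrow> 0) at_top"
        by (intro tendsto_mult_right_zero) simp
    qed auto
    also have "\<dots> < \<infinity>" by simp
    finally show "(\<integral>\<^sup>+ t\<in>{0..}. ennreal (W N t * exp (- \<mu> * t)) \<partial>lborel) < \<infinity>" .
  qed
qed

lemma weight_dyadic:
  assumes "weight_system W" "cond_alpha W"
  shows "\<exists>M C. \<forall>t\<ge>0. W N t \<le> W M (t / 2 ^ k) + C"
proof (induction k)
  case 0
  show ?case by (intro exI[of _ N] exI[of _ 0]) simp
next
  case (Suc k)
  then obtain M C where M: "\<And>t. 0 \<le> t \<Longrightarrow> W N t \<le> W M (t / 2 ^ k) + C" by blast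
  obtain M' A where M': "\<And>t. 0 \<le> t \<Longrightarrow> W M (2 * t) \<le> W M' t + ln A"
    using assms(2) unfolding cond_alpha_def by blast
  have "W N t \<le> W M' (t / 2 ^ Suc k) + (ln A + C)" if "0 \<le> t" for t
    using M[OF that] M'[of "t / 2 ^ Suc k"] that by simp
  then show ?case by blast
qed

text \<open>Passing from \<open>W N t\<close> to \<open>W M (t / 2 ^ k)\<close> divides the rate by
  \<open>2 ^ k\<close>. One rate \<open>\<nu>\<close>, common to all indices, is therefore
  enough.\<close>

lemma subexponentialI:
  assumes W: "weight_system W" "cond_alpha W"
    and *: "\<And>N. \<exists>C. \<forall>t\<ge>0. W N t \<le> C * exp (\<nu> * t)"
  shows "subexponential W"
  unfolding subexponential_def
proof (intro allI impI)
  fix N and \<mu> :: real assume \<mu>: "\<mu> > 0"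
  obtain k where k: "\<nu> / \<mu> < 2 ^ k" using real_arch_pow[of 2 "\<nu> / \<mu>"] by auto
  obtain M C where M: "\<And>t. 0 \<le> t \<Longrightarrow> W N t \<le> W M (t / 2 ^ k) + C" using weight_dyadic[OF W] by blast
  obtain D where D: "\<And>t. 0 \<le> t \<Longrightarrow> W M t \<le> D * exp (\<nu> * t)" using * by blast
  show "\<exists>C\<ge>0. \<forall>t\<ge>0. W N t \<le> C * exp (\<mu> * t)"
  proof (intro exI[of _ "\<bar>D\<bar> + \<bar>C\<bar>"] conjI allI impI)
    fix t :: real assume t: "0 \<le> t"
    have "\<nu> * (t / 2 ^ k) \<le> \<mu> * t"
      using k \<mu> t mult_right_mono[of "\<nu> / 2 ^ k" \<mu> t] by (simp add: field_simps)
    then have "D * exp (\<nu> * (t / 2 ^ k)) \<le> \<bar>D\<bar> * exp (\<mu> * t)"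
      by (intro mult_mono) auto
    moreover have "C \<le> \<bar>C\<bar> * exp (\<mu> * t)"
      using \<mu> t mult_left_mono[of 1 "exp (\<mu> * t)" "\<bar>C\<bar>"] by simp
    ultimately show "W N t \<le> (\<bar>D\<bar> + \<bar>C\<bar>) * exp (\<mu> * t)"
      using M[OF t] D[of "t / 2 ^ k"] t by (simp add: distrib_right)
  qed simp
qed

section \<open>Growth of weights forced by holomorphic functions on half strips\<close>

lemma rotate_near_positive_axis:
  fixes z :: complex and n :: nat
  assumes "n > 0"
  shows "\<exists>k<n. \<exists>\<alpha>. 0 \<le> \<alpha> \<and> \<alpha> < 2 * pi / n \<and> z * cis (2 * pi * k / n) = of_real (cmod z) * cis \<alpha>"
proof -
  define \<theta> where "\<theta> = Arg z"
  \<comment> \<open>The least integer for which the argument, increased by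
    \<open>2 * pi * q / n\<close>, is nonnegative; its residue modulo \<open>n\<close> is the
    required rotation.\<close>
  define q where "q = \<lceil>- \<theta> * n / (2 * pi)\<rceil>"
  define k where "k = nat (q mod int n)"
  have kn: "k < n" and k: "int k = q mod int n" using assms by (auto simp: k_def nat_less_iff)
  define Q where "Q = q div int n"
  have "q = int k + int n * Q" by (simp add: k Q_def)
  then have q: "real_of_int q = real k + real n * real_of_int Q" by simp
  have q1: "- \<theta> * n / (2 * pi) \<le> q" "q < - \<theta> * n / (2 * pi) + 1" unfolding q_def by linarith+
  define \<alpha> where "\<alpha> = \<theta> + 2 * pi * q / n"
  have a0: "0 \<le> \<alpha>" using q1(1) assms by (simp add: \<alpha>_def field_simps)
  have "\<alpha> = (q + \<theta> * n / (2 * pi)) * (2 * pi / n)"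
    using assms by (simp add: \<alpha>_def field_simps)
  also have "\<dots> < 1 * (2 * pi / n)"
    using q1(2) assms by (intro mult_strict_right_mono) auto
  finally have a1: "\<alpha> < 2 * pi / n" by simp
  then have kk: "\<theta> + 2 * pi * k / n = \<alpha> + 2 * pi * of_int (- Q)"
    using assms unfolding \<alpha>_def q by (simp add: field_simps)
  have "z * cis (2 * pi * k / n) = of_real (cmod z) * (cis \<theta> * cis (2 * pi * k / n))"
    unfolding \<theta>_def by (metis mult.assoc rcis_cmod_Arg rcis_def)
  also have "cis \<theta> * cis (2 * pi * k / n) = cis (\<alpha> + 2 * pi * of_int (- Q))"
    by (simp only: cis_mult kk)
  also have "\<dots> = cis \<alpha> * cis (2 * pi * of_int (- Q))" by (simp only: cis_mult)
  also have "cis (2 * pi * of_int (- Q)) = 1"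
    by (rule cis_multiple_2pi) (rule Ints_of_int)
  finally show ?thesis using kn a0 a1 by (intro exI[of _ k] conjI exI[of _ \<alpha>]) simp_all
qed

lemma cis_dist_1_le: "cmod (cis t - 1) \<le> \<bar>t\<bar>"
proof -
  have "cmod (cis t - cis 0) \<le> 1 * norm (t - 0)"
    by (rule differentiable_bound[of UNIV _ "\<lambda>t h. of_real h * (\<i> * cis t)"])
      (auto intro!: derivative_eq_intros onorm_le simp: has_vector_derivative_def[symmetric] norm_mult scaleR_conv_of_real)
  then show ?thesis by simp
qed

text \<open>Jensen-type estimate: multiplying the \<open>n\<close> rotates of \<open>g\<close> produces a function that is
  small on the whole circle as soon as \<open>g\<close> is small on an arc of length \<open>2 pi / n\<close>.\<close>

lemma rotation_product_bound:
  fixes g :: "complex \<Rightarrow> complex"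
  assumes g: "g holomorphic_on ball 0 1" and n: "n \<ge> 2" and B: "B \<ge> 0"
    and 1: "\<And>z. cmod z < 1 \<Longrightarrow> cmod (g z) \<le> B"
    and 2: "\<And>z. cmod z < 1 \<Longrightarrow> cmod (1 - z) \<le> 8 / n \<Longrightarrow> cmod (g z) \<le> e"
  shows "cmod (g 0) ^ n \<le> B ^ (n - 1) * e"
proof -
  \<comment> \<open>On the circle of this radius the rotated point has distance at most
    \<open>1 / n + 2 * pi / n\<close> from \<open>1\<close>; the \<open>8\<close> of the hypothesis
    comes from \<open>1 + 2 * pi < 8\<close>.\<close>
  define r where "r = 1 - 1 / real n"
  have r: "0 < r" "r < 1" using n by (auto simp: r_def)
  define \<omega> where "\<omega> k = cis (2 * pi * real k / real n)" for k
  define P where "P z = (\<Prod>k<n. g (z * \<omega> k))" for z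
  have n\<omega>: "cmod (\<omega> k) = 1" for k by (simp add: \<omega>_def)
  have hol: "P holomorphic_on ball 0 1"
    unfolding P_def
  proof (rule holomorphic_on_prod)
    fix k
    have "(g \<circ> (\<lambda>z. z * \<omega> k)) holomorphic_on ball 0 1"
      by (rule holomorphic_on_compose_gen[OF _ g]) (auto intro!: holomorphic_intros simp: norm_mult n\<omega>)
    then show "(\<lambda>z. g (z * \<omega> k)) holomorphic_on ball 0 1" by (simp add: o_def)
  qed
  have "cmod (P 0) \<le> B ^ (n - 1) * e"
  proof (rule maximum_modulus_frontier[of P "cball 0 r"])
    show "P holomorphic_on interior (cball 0 r)"
      by (rule holomorphic_on_subset[OF hol]) (use r in auto)
    show "continuous_on (closure (cball 0 r)) P"
      by (rule continuous_on_subset[OF holomorphic_on_imp_continuous_on[OF hol]]) (use r in auto)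
    fix z :: complex assume "z \<in> frontier (cball 0 r)"
    then have z: "cmod z = r" using r by (simp add: frontier_cball)
    obtain k \<alpha> where k: "k < n" "0 \<le> \<alpha>" "\<alpha> < 2 * pi / n" "z * \<omega> k = of_real r * cis \<alpha>"
      using rotate_near_positive_axis[of n z] n z unfolding \<omega>_def by auto
    have "1 - z * \<omega> k = of_real (1 - r) - of_real r * (cis \<alpha> - 1)"
      unfolding k(4) by (simp add: algebra_simps)
    then have "cmod (1 - z * \<omega> k) \<le> (1 - r) + r * cmod (cis \<alpha> - 1)"
      using norm_triangle_ineq4[of "of_real (1 - r)" "of_real r * (cis \<alpha> - 1)"] r
      by (simp add: norm_mult del: of_real_diff)
    also have "\<dots> \<le> 1 / n + 1 * (2 * pi / n)"
      using cis_dist_1_le[of \<alpha>] k r by (intro add_mono mult_mono) (auto simp: r_def)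
    also have "\<dots> \<le> 8 / n" using pi_less_4 pi_approx n by (simp add: field_simps)
    finally have "cmod (g (z * \<omega> k)) \<le> e"
      using 2[of "z * \<omega> k"] z r by (simp add: norm_mult n\<omega>)
    then have e0: "0 \<le> e" by (rule order_trans[OF norm_ge_zero])
    have "(\<Prod>j\<in>{..<n} - {k}. cmod (g (z * \<omega> j))) \<le> (\<Prod>j\<in>{..<n} - {k}. B)"
      by (rule prod_mono) (use 1 z r in \<open>auto simp: norm_mult n\<omega>\<close>)
    moreover have "(\<Prod>j\<in>{..<n} - {k}. B) = B ^ (n - 1)" using k by simp
    moreover have "cmod (P z) = cmod (g (z * \<omega> k)) * (\<Prod>j\<in>{..<n} - {k}. cmod (g (z * \<omega> j)))"
      unfolding P_def prod_norm[symmetric] using k by (subst prod.remove[of _ k]) auto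
    ultimately have "cmod (P z) \<le> e * B ^ (n - 1)"
      using \<open>cmod (g (z * \<omega> k)) \<le> e\<close> e0
      by (simp add: mult_mono prod_nonneg)
    then show "cmod (P z) \<le> B ^ (n - 1) * e" by (simp only: mult.commute)
  qed (use r in auto)
  moreover have "P 0 = g 0 ^ n" by (simp add: P_def)
  ultimately show ?thesis by (simp add: norm_power)
qed

text \<open>The map \<open>z \<mapsto> x - c Ln (1 - z)\<close> sends the unit disc into a half strip and \<open>1\<close> to the end at
  infinity.\<close>

lemma half_strip_decay_bound:
  fixes f :: "complex \<Rightarrow> complex" and w :: "real \<Rightarrow> real"
  assumes f: "f holomorphic_on {z. R < Re z \<and> \<bar>Im z\<bar> < h}" and h: "h > 0" and R: "R \<ge> 0"
    and w: "\<And>t. 0 \<le> t \<Longrightarrow> 0 \<le> w t" "\<And>s t. 0 \<le> s \<Longrightarrow> s \<le> t \<Longrightarrow> w s \<le> w t"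
    and b: "\<And>z. R < Re z \<Longrightarrow> \<bar>Im z\<bar> < h \<Longrightarrow> cmod (f z) \<le> B * exp (- w (Re z))"
    and x: "x > R + (2 * h / pi) * ln 2" "f (of_real x) \<noteq> 0"
  shows "\<exists>K. \<forall>t\<ge>0. w t \<le> K * exp (pi / (2 * h) * t)"
proof -
  \<comment> \<open>The imaginary part of \<open>Ln (1 - z)\<close> is less than
    \<open>pi / 2\<close> in modulus, so this factor gives the image half-width
    \<open>h\<close>.\<close>
  define c where "c = 2 * h / pi"
  have c: "c > 0" using h by (simp add: c_def)
  define \<phi> where "\<phi> z = of_real x - of_real c * Ln (1 - z)" for z :: complex
  define g where "g z = f (\<phi> z)" for z
  have Re1: "0 < Re (1 - z)" "1 - z \<noteq> 0" if "cmod z < 1" for z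
  proof -
    show "0 < Re (1 - z)" using complex_Re_le_cmod[of z] that by simp
    then show "1 - z \<noteq> 0" by auto
  qed
  have Re\<phi>: "Re (\<phi> z) = x - c * ln (cmod (1 - z))" if "cmod z < 1" for z
    using Re1[OF that] by (simp add: \<phi>_def)
  have Im\<phi>: "\<bar>Im (\<phi> z)\<bar> < h" if "cmod z < 1" for z
  proof -
    have "\<bar>Im (Ln (1 - z))\<bar> < pi / 2" using Re1[OF that] Re_Ln_pos_lt by blast
    then have "c * \<bar>Im (Ln (1 - z))\<bar> < c * (pi / 2)" using c by simp
    then show ?thesis using c h by (simp add: \<phi>_def abs_mult c_def)
  qed
  \<comment> \<open>The distance of \<open>x\<close> from \<open>R\<close> compensates the largest
    loss \<open>c * ln 2\<close> in the real part, which comes from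
    \<open>cmod (1 - z) \<le> 2\<close>.\<close>
  have in_strip: "R < Re (\<phi> z) \<and> \<bar>Im (\<phi> z)\<bar> < h" if "cmod z < 1" for z
  proof -
    have "cmod (1 - z) \<le> 2" using norm_triangle_ineq4[of 1 z] that by simp
    then have "ln (cmod (1 - z)) \<le> ln 2" using Re1[OF that] by (subst ln_le_cancel_iff) auto
    then have "c * ln (cmod (1 - z)) \<le> c * ln 2" using c by simp
    then show ?thesis using x(1) Re\<phi>[OF that] Im\<phi>[OF that] by (simp add: c_def)
  qed
  have g: "g holomorphic_on ball 0 1"
  proof -
    have "(f \<circ> \<phi>) holomorphic_on ball 0 1"
    proof (rule holomorphic_on_compose_gen[OF _ f])
      show "\<phi> holomorphic_on ball 0 1"
        unfolding \<phi>_def using Re1 by (auto intro!: holomorphic_intros simp: complex_nonpos_Reals_iff) (fastforce)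
      show "\<phi> ` ball 0 1 \<subseteq> {z. R < Re z \<and> \<bar>Im z\<bar> < h}" using in_strip by auto
    qed
    then show ?thesis by (simp add: o_def g_def[abs_def])
  qed
  define a where "a = cmod (f (of_real x))"
  have a: "a > 0" "g 0 = f (of_real x)" using x by (auto simp: a_def g_def \<phi>_def)
  \<comment> \<open>Taking the maximum with \<open>a\<close> makes \<open>L = ln (D / a)\<close>
    nonnegative.\<close>
  define D where "D = max B a"
  have D: "D > 0" using a by (simp add: D_def)
  have bD: "cmod (g z) \<le> D * exp (- w (Re (\<phi> z)))" if "cmod z < 1" for z
  proof -
    have "cmod (g z) \<le> B * exp (- w (Re (\<phi> z)))" using b in_strip[OF that] by (simp add: g_def)
    also have "\<dots> \<le> D * exp (- w (Re (\<phi> z)))" by (simp add: D_def)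
    finally show ?thesis .
  qed
  define L where "L = ln (D / a)"
  have L: "L \<ge> 0" using a D by (simp add: L_def D_def)
  \<comment> \<open>Points within \<open>8 / n\<close> of \<open>1\<close> are mapped to real part
    at least \<open>c * ln (n / 8)\<close>. There \<open>g\<close> is as small as
    \<open>exp (- w)\<close> of that number, and taking logarithms in the product estimate bounds
    \<open>w\<close>.\<close>
  have main: "w (c * ln (n / 8)) \<le> n * L" if n: "n \<ge> 8" for n :: nat
  proof -
    define s where "s = c * ln (n / 8)"
    have s: "0 \<le> s" using n c by (simp add: s_def)
    have "cmod (g 0) ^ n \<le> D ^ (n - 1) * (D * exp (- w s))"
    proof (rule rotation_product_bound[OF g])
      fix z :: complex assume z: "cmod z < 1"
      have r0: "0 \<le> Re (\<phi> z)" using in_strip[OF z] R by simp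
      show "cmod (g z) \<le> D" using bD[OF z] w(1)[OF r0] D
        by (meson exp_le_one_iff less_imp_le mult_left_le neg_le_0_iff_le order_trans)
      assume "cmod (1 - z) \<le> 8 / n"
      then have "ln (cmod (1 - z)) \<le> ln (8 / n)" using Re1[OF z] n by (subst ln_le_cancel_iff) auto
      then have "ln (n / 8) \<le> - ln (cmod (1 - z))" using n by (simp add: ln_div)
      then have "c * ln (n / 8) \<le> c * - ln (cmod (1 - z))" using c by (intro mult_left_mono) auto
      moreover have "0 \<le> c * ln 2" using c by simp
      then have "0 \<le> x" using x(1) R unfolding c_def by linarith
      ultimately have "s \<le> Re (\<phi> z)" using Re\<phi>[OF z] by (simp add: s_def)
      then have "w s \<le> w (Re (\<phi> z))" using w(2) s by blast
      then have "D * exp (- w (Re (\<phi> z))) \<le> D * exp (- w s)" using D by simp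
      with bD[OF z] show "cmod (g z) \<le> D * exp (- w s)" by linarith
    qed (use n D in auto)
    also have "\<dots> = D ^ n * exp (- w s)" using n power_minus_mult[of n D] by (simp add: mult.assoc[symmetric])
    finally have "a ^ n \<le> D ^ n * exp (- w s)" by (simp add: a a_def)
    then have "ln (a ^ n) \<le> ln (D ^ n * exp (- w s))" using a D by (subst ln_le_cancel_iff) auto
    then have "n * ln a \<le> n * ln D - w s" using a D by (simp add: ln_mult ln_realpow)
    then show ?thesis using a D by (simp add: s_def L_def ln_div algebra_simps)
  qed
  have "w t \<le> (9 * L) * exp (pi / (2 * h) * t)" if t: "0 \<le> t" for t
  proof -
    \<comment> \<open>Smallest choice for which \<open>c * ln (n / 8)\<close> reaches
      \<open>t\<close>. Since \<open>exp (t / c) \<ge> 1\<close>, rounding up costs at most the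
      change from \<open>8\<close> to \<open>9\<close>.\<close>
    define n where "n = nat \<lceil>8 * exp (t / c)\<rceil>"
    have e1: "exp (t / c) \<ge> 1" using t c by simp
    have n1: "8 * exp (t / c) \<le> real n" "real n \<le> 9 * exp (t / c)"
      using e1 unfolding n_def by linarith+
    have n8: "n \<ge> 8" using n1 e1 by linarith
    have "t / c \<le> ln (n / 8)" using n1 n8 by (subst ln_ge_iff) auto
    then have "t \<le> c * ln (n / 8)" using c by (simp add: field_simps)
    then have "w t \<le> w (c * ln (n / 8))" using w(2) t by blast
    also have "\<dots> \<le> n * L" by (rule main[OF n8])
    also have "\<dots> \<le> 9 * exp (t / c) * L" using n1 L by (intro mult_right_mono) auto
    also have "\<dots> = (9 * L) * exp (pi / (2 * h) * t)" by (simp add: c_def)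
    finally show ?thesis .
  qed
  then show ?thesis by blast
qed

section \<open>Weighted spaces on generalized strips\<close>

text \<open>The quantitative form of uniform continuity and positive infimum: the gap persists when
  the two boundary functions are read at slightly different abscissae. Half of
  \<open>(b - a) * m\<close> pays for the oscillation of \<open>F\<close>, the other half for
  \<open>\<delta>\<close>; the denominator \<open>a + 1\<close> in the choice of \<open>e\<close>
  covers \<open>a = 0\<close>.\<close>

lemma strip_boundary_gap:
  assumes "strip_boundary_fun F" "0 \<le> a" "a < b"
  obtains \<delta> where "0 < \<delta>" "\<And>s t. \<bar>s - t\<bar> < \<delta> \<Longrightarrow> a * F s + \<delta> \<le> b * F t"
proof -
  define m where "m = (INF t. F t)"
  have m: "0 < m" using assms(1) by (simp add: strip_boundary_fun_def m_def)
  have "bdd_below (range F)"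
    using assms(1) by (auto simp: strip_boundary_fun_def bdd_below_def intro!: exI[of _ 0] less_imp_le)
  then have mF: "m \<le> F t" for t unfolding m_def by (intro cINF_lower) auto
  define e where "e = (b - a) * m / (2 * (a + 1))"
  have e: "e > 0" using m assms by (simp add: e_def)
  obtain d where d: "d > 0" "\<And>s t. \<bar>s - t\<bar> < d \<Longrightarrow> \<bar>F s - F t\<bar> < e"
    using assms(1) e unfolding strip_boundary_fun_def uniformly_continuous_on_def dist_real_def
    by (metis UNIV_I abs_minus_commute)
  define \<delta> where "\<delta> = min d ((b - a) * m / 2)"
  show ?thesis
  proof (rule that[of \<delta>])
    show "0 < \<delta>" using d m assms by (simp add: \<delta>_def)
    fix s t :: real assume "\<bar>s - t\<bar> < \<delta>"
    then have "F s \<le> F t + e" using d(2)[of s t] by (simp add: \<delta>_def)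
    then have "a * F s \<le> a * F t + a * e" using assms(2) mult_left_mono[of "F s" "F t + e" a] by (simp add: distrib_left)
    moreover have "a * e \<le> (a + 1) * e" using e by simp
    moreover have "(a + 1) * e = (b - a) * m / 2" using assms(2) by (simp add: e_def field_simps)
    moreover have "\<delta> \<le> (b - a) * m / 2" by (simp add: \<delta>_def)
    moreover have "(b - a) * m \<le> (b - a) * F t" using assms mF by (intro mult_left_mono) auto
    ultimately show "a * F s + \<delta> \<le> b * F t" by (simp add: left_diff_distrib)
  qed
qed

section \<open>The strips \<open>T a\<close> and the weighted spaces on them\<close>

locale weighted_strip =
  fixes F G :: "real \<Rightarrow> real" and W :: "nat \<Rightarrow> real \<Rightarrow> real"
  assumes F: "strip_boundary_fun F" and G: "strip_boundary_fun G"
    and W: "weight_system W" and alpha: "cond_alpha W"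
begin

abbreviation T :: "real \<Rightarrow> complex set" where
  "T a \<equiv> strip (\<lambda>t. a * F t) (\<lambda>t. a * G t)"

lemma T_1: "strip F G = T 1"
  by simp

lemma mem_T: "z \<in> T a \<longleftrightarrow> - (a * G (Re z)) < Im z \<and> Im z < a * F (Re z)"
  by (simp add: strip_def)

lemma boundary_bounds:
  obtains m H where "0 < m" "m \<le> H" "\<And>t. m \<le> F t" "\<And>t. m \<le> G t" "\<And>t. F t \<le> H" "\<And>t. G t \<le> H"
proof -
  have *: "\<exists>m H. 0 < m \<and> (\<forall>t. m \<le> f t \<and> f t \<le> H)" if "strip_boundary_fun f" for f
  proof -
    have "bdd_below (range f)"
      using that by (auto simp: strip_boundary_fun_def bdd_below_def intro!: exI[of _ 0] less_imp_le)
    then have "(INF t. f t) \<le> f t" for t by (intro cINF_lower) auto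
    moreover have "f t \<le> (SUP t. f t)" for t
      using that by (intro cSUP_upper) (auto simp: strip_boundary_fun_def)
    ultimately show ?thesis using that unfolding strip_boundary_fun_def by blast
  qed
  obtain m1 H1 where 1: "0 < m1" "\<And>t. m1 \<le> F t" "\<And>t. F t \<le> H1" using *[OF F] by blast
  obtain m2 H2 where 2: "0 < m2" "\<And>t. m2 \<le> G t" "\<And>t. G t \<le> H2" using *[OF G] by blast
  show ?thesis
  proof (rule that[of "min m1 m2" "max H1 H2"])
    show "min m1 m2 \<le> max H1 H2" using 1(2,3)[of 0] by simp
  qed (use 1 2 in \<open>auto simp: min_le_iff_disj le_max_iff_disj\<close>)
qed

lemma F_pos: "0 < F t" and G_pos: "0 < G t"
  using F G by (auto simp: strip_boundary_fun_def)

lemma T_mono: "a \<le> b \<Longrightarrow> T a \<subseteq> T b"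
proof
  fix z assume "a \<le> b" "z \<in> T a"
  then show "z \<in> T b"
    using mult_right_mono[of a b "F (Re z)"] mult_right_mono[of a b "G (Re z)"] F_pos[of "Re z"] G_pos[of "Re z"]
    unfolding mem_T by linarith
qed

lemma continuous_boundary: "continuous_on UNIV F" "continuous_on UNIV G"
  using F G by (auto simp: strip_boundary_fun_def uniformly_continuous_imp_continuous)

lemma open_T: "open (T a)"
proof -
  have F': "continuous_on UNIV (\<lambda>z. F (Re z))" and G': "continuous_on UNIV (\<lambda>z. G (Re z))"
    by (auto intro!: continuous_on_compose2[OF continuous_boundary(1)]
        continuous_on_compose2[OF continuous_boundary(2)] continuous_intros)
  have "T a = {z. - (a * G (Re z)) < Im z} \<inter> {z. Im z < a * F (Re z)}"
    by (auto simp: mem_T)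
  also have "open \<dots>"
    by (intro open_Int open_Collect_less continuous_intros F' G')
  finally show ?thesis .
qed

lemma closure_T:
  assumes "0 < a" "a < b"
  shows "closure (T a) \<subseteq> T b"
proof -
  have F': "continuous_on UNIV (\<lambda>z. F (Re z))" and G': "continuous_on UNIV (\<lambda>z. G (Re z))"
    by (auto intro!: continuous_on_compose2[OF continuous_boundary(1)]
        continuous_on_compose2[OF continuous_boundary(2)] continuous_intros)
  have "closed ({z. - (a * G (Re z)) \<le> Im z} \<inter> {z. Im z \<le> a * F (Re z)})"
    by (intro closed_Int closed_Collect_le continuous_intros F' G')
  then have "closure (T a) \<subseteq> {z. - (a * G (Re z)) \<le> Im z} \<inter> {z. Im z \<le> a * F (Re z)}"
    by (intro closure_minimal) (auto simp: mem_T)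
  note cl = this
  have lt: "a * F t < b * F t" "a * G t < b * G t" for t using F_pos G_pos assms by auto
  show ?thesis
  proof
    fix z assume "z \<in> closure (T a)"
    then have "- (a * G (Re z)) \<le> Im z" "Im z \<le> a * F (Re z)" using cl by auto
    then show "z \<in> T b" using lt[of "Re z"] unfolding mem_T by linarith
  qed
qed

lemma T_1_exhaust:
  assumes "z \<in> T 1" "a0 < 1"
  obtains a where "a0 < a" "a < 1" "0 < a" "z \<in> T a"
proof -
  define q where "q = max (max 0 a0) (max (Im z / F (Re z)) (- Im z / G (Re z)))"
  have q: "q < 1" using assms(1)[unfolded mem_T] assms(2) F_pos[of "Re z"] G_pos[of "Re z"]
    by (simp add: q_def field_simps)
  define a where "a = (q + 1) / 2"
  have a: "q < a" "a < 1" using q by (auto simp: a_def)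
  have "Im z / F (Re z) < a" "- Im z / G (Re z) < a" "0 < a" "a0 < a"
    using a(1) unfolding q_def by linarith+
  then have "z \<in> T a" using F_pos[of "Re z"] G_pos[of "Re z"] by (auto simp: mem_T field_simps)
  with a \<open>0 < a\<close> \<open>a0 < a\<close> that show ?thesis by blast
qed

lemma T_margin:
  assumes "0 \<le> a" "a < b"
  obtains \<delta> where "0 < \<delta>" "\<And>z w. z \<in> T a \<Longrightarrow> cmod (w - z) < \<delta> \<Longrightarrow> w \<in> T b"
proof -
  obtain d1 where d1: "0 < d1" "\<And>s t. \<bar>s - t\<bar> < d1 \<Longrightarrow> a * F s + d1 \<le> b * F t"
    using strip_boundary_gap[OF F assms] by blast
  obtain d2 where d2: "0 < d2" "\<And>s t. \<bar>s - t\<bar> < d2 \<Longrightarrow> a * G s + d2 \<le> b * G t"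
    using strip_boundary_gap[OF G assms] by blast
  show ?thesis
  proof (rule that[of "min d1 d2"])
    show "0 < min d1 d2" using d1 d2 by simp
    fix z w assume z: "z \<in> T a" and wz: "cmod (w - z) < min d1 d2"
    have "\<bar>Re z - Re w\<bar> \<le> cmod (w - z)" "\<bar>Im z - Im w\<bar> \<le> cmod (w - z)"
      using abs_Re_le_cmod[of "w - z"] abs_Im_le_cmod[of "w - z"] by auto
    then show "w \<in> T b" using d1(2)[of "Re z" "Re w"] d2(2)[of "Re z" "Re w"] z wz
      unfolding mem_T by linarith
  qed
qed

text \<open>The strip is the union of the real axis with vertical segments meeting it. Connectedness
  is what the identity theorem asks for.\<close>

lemma connected_T: "connected (T 1)"
proof -
  define A where "A x = {z. Im z = 0} \<union> {z. Re z = x \<and> - G x < Im z \<and> Im z < F x}" for x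
  have c1: "connected {z. Im z = 0}" "connected {z. Re z = x \<and> - G x < Im z \<and> Im z < F x}" for x
  proof -
    have "convex {z. Im z = 0}" by (auto simp: convex_alt)
    then show "connected {z. Im z = 0}" by (rule convex_connected)
    have "{z. Re z = x \<and> - G x < Im z \<and> Im z < F x}
        = {z. Re z = x} \<inter> {z. Im z > - G x} \<inter> {z. Im z < F x}" by auto
    moreover have "convex {z. Re z = x}" by (auto simp: convex_alt algebra_simps)
    ultimately have "convex {z. Re z = x \<and> - G x < Im z \<and> Im z < F x}"
      by (auto intro!: convex_Int convex_halfspace_Im_gt convex_halfspace_Im_lt)
    then show "connected {z. Re z = x \<and> - G x < Im z \<and> Im z < F x}" by (rule convex_connected)
  qed
  have "connected (A x)" for x
    unfolding A_def
  proof (rule connected_Un[OF c1])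
    have "of_real x \<in> {z. Im z = 0} \<inter> {z. Re z = x \<and> - G x < Im z \<and> Im z < F x}"
      using F_pos[of x] G_pos[of x] by simp
    then show "{z. Im z = 0} \<inter> {z. Re z = x \<and> - G x < Im z \<and> Im z < F x} \<noteq> {}" by blast
  qed
  moreover have "0 \<in> A x" for x by (simp add: A_def)
  then have "\<Inter> (range A) \<noteq> {}" by blast
  ultimately have "connected (\<Union>x. A x)" by (intro connected_Union) auto
  moreover have "(\<Union>x. A x) = T 1" using F_pos G_pos by (auto simp: A_def strip_def)
  ultimately show ?thesis by simp
qed

text \<open>Open strips replace the closures in the seminorms, which changes nothing since
  \<open>closure (T a)\<close> lies in every larger strip. The end \<open>b\<close> is a parameter
  because solutions are assembled from pieces that are controlled only on some \<open>T b\<close>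
  with \<open>b < 1\<close>.\<close>

definition wbdd :: "real \<Rightarrow> (complex \<Rightarrow> complex) \<Rightarrow> bool" where
  "wbdd b f \<longleftrightarrow> (\<forall>N a. 0 < a \<and> a < b \<longrightarrow> (\<exists>C. \<forall>z\<in>T a. exp (W N \<bar>Re z\<bar>) * cmod (f z) \<le> C))"

lemma wbddD:
  assumes "wbdd b f" "0 < a" "a < b"
  obtains C where "0 \<le> C" "\<And>z. z \<in> T a \<Longrightarrow> exp (W N \<bar>Re z\<bar>) * cmod (f z) \<le> C"
proof -
  obtain C where "\<And>z. z \<in> T a \<Longrightarrow> exp (W N \<bar>Re z\<bar>) * cmod (f z) \<le> C"
    using assms unfolding wbdd_def by blast
  then show ?thesis using that[of "max 0 C"] by (simp add: le_max_iff_disj)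
qed

lemma local_on_wbdd: "local_on (T b) (wbdd b)"
  unfolding local_on_def wbdd_def
proof (intro allI impI)
  fix f g N a
  assume fg: "\<forall>N a. 0 < a \<and> a < b \<longrightarrow> (\<exists>C. \<forall>z\<in>T a. exp (W N \<bar>Re z\<bar>) * cmod (f z) \<le> C)"
    "\<forall>z\<in>T b. f z = g z" and a: "0 < a \<and> a < b"
  then obtain C where "\<forall>z\<in>T a. exp (W N \<bar>Re z\<bar>) * cmod (f z) \<le> C" by blast
  moreover have "T a \<subseteq> T b" using T_mono a by simp
  ultimately show "\<exists>C. \<forall>z\<in>T a. exp (W N \<bar>Re z\<bar>) * cmod (g z) \<le> C"
    using fg(2) by (metis subsetD)
qed

lemma add_closed_wbdd: "add_closed (wbdd b)"
  unfolding add_closed_def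
proof (intro allI impI)
  fix f g assume f: "wbdd b f" and g: "wbdd b g"
  show "wbdd b (\<lambda>w. f w + g w)"
    unfolding wbdd_def
  proof (intro allI impI)
    fix N a assume a: "0 < a \<and> a < b"
    obtain C where C: "\<And>z. z \<in> T a \<Longrightarrow> exp (W N \<bar>Re z\<bar>) * cmod (f z) \<le> C" using wbddD[OF f] a by metis
    obtain D where D: "\<And>z. z \<in> T a \<Longrightarrow> exp (W N \<bar>Re z\<bar>) * cmod (g z) \<le> D" using wbddD[OF g] a by metis
    have "exp (W N \<bar>Re z\<bar>) * cmod (f z + g z) \<le> C + D" if "z \<in> T a" for z
    proof -
      have "exp (W N \<bar>Re z\<bar>) * cmod (f z + g z) \<le> exp (W N \<bar>Re z\<bar>) * (cmod (f z) + cmod (g z))"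
        by (intro mult_left_mono norm_triangle_ineq) simp
      with C[OF that] D[OF that] show ?thesis by (simp add: distrib_left)
    qed
    then show "\<exists>C. \<forall>z\<in>T a. exp (W N \<bar>Re z\<bar>) * cmod (f z + g z) \<le> C" by blast
  qed
qed

lemma wbdd_le_mult:
  assumes f: "wbdd b f" and g: "\<And>a. 0 < a \<Longrightarrow> a < b \<Longrightarrow> \<exists>c. \<forall>z\<in>T a. cmod (g z) \<le> c * cmod (f z)"
  shows "wbdd b g"
  unfolding wbdd_def
proof (intro allI impI)
  fix N a assume a: "0 < a \<and> a < b"
  obtain C where C: "0 \<le> C" "\<And>z. z \<in> T a \<Longrightarrow> exp (W N \<bar>Re z\<bar>) * cmod (f z) \<le> C"
    using wbddD[OF f] a by metis
  obtain c where c: "\<And>z. z \<in> T a \<Longrightarrow> cmod (g z) \<le> c * cmod (f z)" using g a by blast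
  have "exp (W N \<bar>Re z\<bar>) * cmod (g z) \<le> \<bar>c\<bar> * C" if "z \<in> T a" for z
  proof -
    have "cmod (g z) \<le> \<bar>c\<bar> * cmod (f z)"
      using c[OF that] abs_ge_self[of c] mult_right_mono[of c "\<bar>c\<bar>" "cmod (f z)"] by simp
    then have "exp (W N \<bar>Re z\<bar>) * cmod (g z) \<le> exp (W N \<bar>Re z\<bar>) * (\<bar>c\<bar> * cmod (f z))" by simp
    also have "\<dots> = \<bar>c\<bar> * (exp (W N \<bar>Re z\<bar>) * cmod (f z))" by (simp add: mult.left_commute)
    also have "\<dots> \<le> \<bar>c\<bar> * C" by (intro mult_left_mono C(2)[OF that]) simp
    finally show ?thesis .
  qed
  then show "\<exists>C. \<forall>z\<in>T a. exp (W N \<bar>Re z\<bar>) * cmod (g z) \<le> C" by blast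
qed

lemma wbdd_cmult: "wbdd b f \<Longrightarrow> wbdd b (\<lambda>w. c * f w)"
  by (rule wbdd_le_mult) (auto simp: norm_mult)

lemma wbdd_cnj: "wbdd b f \<Longrightarrow> wbdd b (\<lambda>w. cnj (f w))"
  by (rule wbdd_le_mult) (auto intro: exI[of _ 1])

text \<open>Two differences are bridged: the order of differentiation, by commuting partial
  derivatives, and the closure in the seminorm, by passing to the midpoint of \<open>a\<close> and
  \<open>1\<close>.\<close>

lemma K_space_iff: "f \<in> K_space W F G \<longleftrightarrow> smooth_with (T 1) (wbdd 1) f"
proof
  assume f: "f \<in> K_space W F G"
  have "wbdd 1 (mixed_partial \<alpha> f)" for \<alpha>
    unfolding wbdd_def
  proof (intro allI impI)
    fix N a assume a: "0 < a \<and> a < (1::real)"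
    have "\<forall>N \<alpha> a. 0 < a \<and> a < 1 \<longrightarrow> bdd_above ((\<lambda>\<xi>. exp (W N \<bar>Re \<xi>\<bar>) * cmod (mixed_partial \<alpha> f \<xi>)) ` closure (T a))"
      using f unfolding K_space_def mem_Collect_eq by (rule conjunct2)
    then have "bdd_above ((\<lambda>\<xi>. exp (W N \<bar>Re \<xi>\<bar>) * cmod (mixed_partial \<alpha> f \<xi>)) ` closure (T a))"
      using a by metis
    then show "\<exists>C. \<forall>z\<in>T a. exp (W N \<bar>Re z\<bar>) * cmod (mixed_partial \<alpha> f z) \<le> C"
      unfolding bdd_above_def using closure_subset by fast
  qed
  moreover have "Cinf_on f (T 1)" using f unfolding K_space_def by simp
  ultimately show "smooth_with (T 1) (wbdd 1) f"
    using smooth_with_of_mixed_partials[OF _ open_T local_on_wbdd] by blast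
next
  assume f: "smooth_with (T 1) (wbdd 1) f"
  have "smooth_with (T 1) (\<lambda>_. True) f" using f by (rule smooth_with_mono) auto
  then have "Cinf_on f (strip F G)" by (simp add: Cinf_on_iff_smooth_with)
  moreover have "bdd_above ((\<lambda>\<xi>. exp (W N \<bar>Re \<xi>\<bar>) * cmod (mixed_partial \<alpha> f \<xi>)) ` closure (T a))"
    if a: "0 < a" "a < 1" for N \<alpha> a
  proof -
    have "wbdd 1 (mixed_partial \<alpha> f)" using smooth_with_mixed_partial[OF f] smooth_withD(1) by blast
    then obtain C where "\<And>z. z \<in> T ((a + 1) / 2) \<Longrightarrow> exp (W N \<bar>Re z\<bar>) * cmod (mixed_partial \<alpha> f z) \<le> C"
      by (rule wbddD[of 1 _ "(a + 1) / 2" N]) (use a in auto)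
    moreover have "closure (T a) \<subseteq> T ((a + 1) / 2)" by (rule closure_T) (use a in auto)
    ultimately show ?thesis unfolding bdd_above_def by blast
  qed
  ultimately show "f \<in> K_space W F G"
    unfolding K_space_def by (intro CollectI conjI allI impI) (auto simp del: bdd_above_image_antimono)
qed

lemma K_space_partials: "f \<in> K_space W F G \<Longrightarrow> partial_x f \<in> K_space W F G"
  "f \<in> K_space W F G \<Longrightarrow> partial_y f \<in> K_space W F G"
  by (auto simp: K_space_iff dest: smooth_withD)

lemma K_space_add: "f \<in> K_space W F G \<Longrightarrow> g \<in> K_space W F G \<Longrightarrow> (\<lambda>w. f w + g w) \<in> K_space W F G"
  unfolding K_space_iff by (rule smooth_with_add[OF _ _ open_T local_on_wbdd add_closed_wbdd])

lemma K_space_cmult: "f \<in> K_space W F G \<Longrightarrow> (\<lambda>w. c * f w) \<in> K_space W F G"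
  unfolding K_space_iff by (rule smooth_with_cmult[OF _ open_T local_on_wbdd wbdd_cmult])

lemma K_space_cnj: "f \<in> K_space W F G \<Longrightarrow> (\<lambda>w. cnj (f w)) \<in> K_space W F G"
  unfolding K_space_iff by (rule smooth_with_cnj[OF _ open_T local_on_wbdd wbdd_cnj])

lemma K_space_differentiable: "f \<in> K_space W F G \<Longrightarrow> z \<in> T 1 \<Longrightarrow> f differentiable (at z)"
  unfolding K_space_iff by (rule smooth_withD(2))

lemma cauchy_riemann_onto_iff_laplace_onto:
  "surjective_on (strip F G) (K_space W F G) cauchy_riemann
     \<longleftrightarrow> surjective_on (strip F G) (K_space W F G) laplace"
proof
  assume cr: "surjective_on (strip F G) (K_space W F G) cauchy_riemann"
  show "surjective_on (strip F G) (K_space W F G) laplace"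
    unfolding surjective_on_def
  proof
    fix g assume "g \<in> K_space W F G"
    then obtain f where f: "f \<in> K_space W F G" "\<And>z. z \<in> T 1 \<Longrightarrow> cauchy_riemann f z = g z"
      using cr unfolding surjective_on_def T_1 by blast
    \<comment> \<open>The conjugate operator is \<open>cauchy_riemann\<close> between two complex
      conjugations. Solving for the conjugate of \<open>f / 4\<close> and conjugating back gives
      \<open>u\<close> whose image under the conjugate operator is \<open>f / 4\<close>, so that
      \<open>laplace u\<close> is \<open>cauchy_riemann f\<close>.\<close>
    have "(\<lambda>w. cnj (1/4 * f w)) \<in> K_space W F G" using f by (intro K_space_cnj K_space_cmult)
    then obtain v where v: "v \<in> K_space W F G" "\<And>z. z \<in> T 1 \<Longrightarrow> cauchy_riemann v z = cnj (1/4 * f z)"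
      using bspec[OF cr[unfolded surjective_on_def T_1]] by metis
    define u where "u w = cnj (v w)" for w
    have u: "u \<in> K_space W F G" unfolding u_def using v K_space_cnj by blast
    note d = K_space_differentiable
    have u1: "partial_x u w - \<i> * partial_y u w = 1/2 * f w" if "w \<in> T 1" for w
    proof -
      have "cnj (cauchy_riemann v w) = 1/4 * f w" unfolding v(2)[OF that] by (rule complex_cnj_cnj)
      moreover have "cnj (cauchy_riemann v w) = 1/2 * (partial_x u w - \<i> * partial_y u w)"
        unfolding u_def cauchy_riemann_def using partials_cnj[OF d[OF v(1) that]] by simp
      ultimately have "1/2 * (partial_x u w - \<i> * partial_y u w) = 1/4 * f w" by metis
      moreover have "x = 1/2 * y" if "1/2 * x = 1/4 * y" for x y :: complex
        using that by (simp add: complex_eq_iff)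
      ultimately show ?thesis by blast
    qed
    have "laplace u z = g z" if z: "z \<in> T 1" for z
    proof -
      note ux = K_space_partials(1)[OF u] and uy = K_space_partials(2)[OF u]
      define q where "q w = partial_x u w + (- \<i>) * partial_y u w" for w
      have dmy: "(\<lambda>w. (- \<i>) * partial_y u w) differentiable (at z)"
        using d[OF K_space_cmult[OF uy] z] .
      have qx: "partial_x q z = partial_x (partial_x u) z - \<i> * partial_x (partial_y u) z"
        unfolding q_def using partials_add(1)[OF d[OF ux z] dmy] partials_cmult(1)[OF d[OF uy z], of "- \<i>"] by simp
      have qy: "partial_y q z = partial_y (partial_x u) z - \<i> * partial_y (partial_y u) z"
        unfolding q_def using partials_add(2)[OF d[OF ux z] dmy] partials_cmult(2)[OF d[OF uy z], of "- \<i>"] by simp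
      have comm: "partial_x (partial_y u) z = partial_y (partial_x u) z"
        using smooth_with_partials_commute[OF _ open_T z] u by (simp add: K_space_iff)
      have "laplace u z = partial_x q z + \<i> * partial_y q z"
        unfolding qx qy laplace_def comm by (simp add: algebra_simps)
      also have "\<dots> = 2 * cauchy_riemann q z" by (simp add: cauchy_riemann_def)
      also have "cauchy_riemann q z = cauchy_riemann (\<lambda>w. 1/2 * f w) z"
        by (rule cauchy_riemann_cong[OF open_T z _ d[OF K_space_cmult[OF f(1)] z]])
          (unfold q_def, subst u1[symmetric], assumption, simp)
      also have "\<dots> = 1/2 * g z" unfolding f(2)[OF z, symmetric] by (rule cauchy_riemann_cmult[OF d[OF f(1) z]])
      finally show ?thesis by simp
    qed
    with u show "\<exists>f\<in>K_space W F G. \<forall>z\<in>strip F G. laplace f z = g z" unfolding T_1 by blast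
  qed
next
  assume la: "surjective_on (strip F G) (K_space W F G) laplace"
  show "surjective_on (strip F G) (K_space W F G) cauchy_riemann"
    unfolding surjective_on_def
  proof
    fix g assume "g \<in> K_space W F G"
    then obtain u where u: "u \<in> K_space W F G" "\<And>z. z \<in> T 1 \<Longrightarrow> laplace u z = g z"
      using la unfolding surjective_on_def T_1 by blast
    note ux = K_space_partials(1)[OF u(1)] and uy = K_space_partials(2)[OF u(1)]
    note d = K_space_differentiable
    \<comment> \<open>Four times the conjugate Cauchy--Riemann operator applied to
      \<open>u\<close>.\<close>
    define f where "f w = 2 * partial_x u w + (- 2 * \<i>) * partial_y u w" for w
    have f: "f \<in> K_space W F G" unfolding f_def by (intro K_space_add K_space_cmult ux uy)
    have "cauchy_riemann f z = g z" if z: "z \<in> T 1" for z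
    proof -
      have "cauchy_riemann f z = 2 * cauchy_riemann (partial_x u) z + (- 2 * \<i>) * cauchy_riemann (partial_y u) z"
        unfolding f_def
        by (subst cauchy_riemann_add[OF d[OF K_space_cmult[OF ux] z] d[OF K_space_cmult[OF uy] z]])
          (simp only: cauchy_riemann_cmult[OF d[OF ux z]] cauchy_riemann_cmult[OF d[OF uy z]])
      moreover have "partial_x (partial_y u) z = partial_y (partial_x u) z"
        using smooth_with_partials_commute[OF _ open_T z] u by (simp add: K_space_iff)
      ultimately have "cauchy_riemann f z = laplace u z"
        by (simp add: cauchy_riemann_def laplace_def algebra_simps)
      with u(2)[OF z] show ?thesis by simp
    qed
    with f show "\<exists>f\<in>K_space W F G. \<forall>z\<in>strip F G. cauchy_riemann f z = g z" unfolding T_1 by blast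
  qed
qed

end

text \<open>On the strip the real part of \<open>cosh (\<mu> z)\<close> is at least
  \<open>E\<^sup>2 / 4\<close> with \<open>E = exp (\<mu> / 2 * \<bar>Re z\<bar>)\<close>, whereas
  \<open>W N\<close> plus \<open>\<bar>Re z\<bar>\<close> is only of order \<open>E\<close>; a
  quadratic beats a linear term. The additional factor \<open>exp \<bar>Re z\<bar>\<close> later
  makes the kernels integrable.\<close>

lemma exp_cosh_decay:
  assumes "subexponential W" "0 < Y"
  obtains P :: "complex \<Rightarrow> complex" where "P holomorphic_on UNIV" "P 0 = 1"
    "\<And>N. \<exists>C\<ge>0. \<forall>z. \<bar>Im z\<bar> \<le> Y \<longrightarrow> exp (W N \<bar>Re z\<bar>) * exp \<bar>Re z\<bar> * cmod (P z) \<le> C"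
proof -
  \<comment> \<open>Keeps \<open>\<mu> * Im z\<close> within \<open>pi / 3\<close>, where the cosine
    is at least \<open>1 / 2\<close>.\<close>
  define \<mu> where "\<mu> = pi / (3 * Y)"
  have \<mu>: "0 < \<mu>" using assms(2) by (simp add: \<mu>_def)
  define P where "P z = exp (1 - (exp (of_real \<mu> * z) + exp (- of_real \<mu> * z)) / 2)" for z :: complex
  have bound: "\<exists>C\<ge>0. \<forall>z. \<bar>Im z\<bar> \<le> Y \<longrightarrow> exp (W N \<bar>Re z\<bar>) * exp \<bar>Re z\<bar> * cmod (P z) \<le> C" for N
  proof -
    obtain C where C: "0 \<le> C" "\<And>t. 0 \<le> t \<Longrightarrow> W N t \<le> C * exp (\<mu> / 2 * t)"
      using assms(1) \<mu> unfolding subexponential_def by (metis half_gt_zero)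
    \<comment> \<open>\<open>C\<close> accounts for the weight and \<open>2 / \<mu>\<close> for the
      term \<open>\<bar>Re z\<bar>\<close>, each measured in units of \<open>E\<close>.\<close>
    define A where "A = C + 2 / \<mu>"
    have "exp (W N \<bar>Re z\<bar>) * exp \<bar>Re z\<bar> * cmod (P z) \<le> exp (1 + A\<^sup>2)" if z: "\<bar>Im z\<bar> \<le> Y" for z
    proof -
      define x where "x = \<bar>Re z\<bar>"
      define E where "E = exp (\<mu> / 2 * x)"
      have x: "0 \<le> x" by (simp add: x_def)
      have "\<mu> / 2 * x \<le> E" unfolding E_def using exp_ge_add_one_self[of "\<mu> / 2 * x"] by linarith
      then have "x \<le> 2 / \<mu> * E" using \<mu> by (simp add: field_simps)
      with C(2)[OF x] have 1: "W N x + x \<le> A * E" by (simp add: A_def E_def distrib_right)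
      have "0 \<le> (E / 2 - A)\<^sup>2" by simp
      then have 2: "A * E \<le> E\<^sup>2 / 4 + A\<^sup>2" by (simp add: power2_eq_square algebra_simps)
      have "\<mu> * \<bar>Im z\<bar> \<le> \<mu> * Y" using z \<mu> by simp
      also have "\<mu> * Y = pi / 3" using assms(2) by (simp add: \<mu>_def)
      finally have "cos (pi / 3) \<le> cos (\<mu> * \<bar>Im z\<bar>)"
        using \<mu> by (intro cos_monotone_0_pi_le) auto
      then have cs: "1 / 2 \<le> cos (\<mu> * Im z)"
        using \<mu> by (simp add: cos_60) (metis abs_mult abs_of_pos cos_abs_real)
      have "E\<^sup>2 = exp (\<mu> * x)" by (simp add: E_def power2_eq_square flip: exp_add)
      also have "\<dots> \<le> exp (\<mu> * Re z) + exp (- \<mu> * Re z)" by (auto simp: x_def abs_if)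
      finally have "E\<^sup>2 / 4 \<le> (exp (\<mu> * Re z) + exp (- \<mu> * Re z)) * (1 / 2) / 2" by simp
      also have "\<dots> \<le> (exp (\<mu> * Re z) + exp (- \<mu> * Re z)) * cos (\<mu> * Im z) / 2"
        using cs by (intro divide_right_mono mult_left_mono) auto
      also have "\<dots> = Re ((exp (of_real \<mu> * z) + exp (- of_real \<mu> * z)) / 2)"
        by (simp add: Re_exp distrib_right)
      finally have "cmod (P z) \<le> exp (1 - E\<^sup>2 / 4)" by (simp add: P_def)
      then have "exp (W N x) * exp x * cmod (P z) \<le> exp (W N x) * exp x * exp (1 - E\<^sup>2 / 4)"
        by (intro mult_left_mono) auto
      also have "\<dots> = exp (W N x + x + (1 - E\<^sup>2 / 4))" by (simp add: exp_add)
      also have "\<dots> \<le> exp (1 + A\<^sup>2)" using 1 2 by simp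
      finally show ?thesis by (simp add: x_def)
    qed
    then show ?thesis by (intro exI[of _ "exp (1 + A\<^sup>2)"]) simp
  qed
  have "P holomorphic_on UNIV" unfolding P_def[abs_def] by (intro holomorphic_intros) auto
  moreover have "P 0 = 1" by (simp add: P_def)
  ultimately show ?thesis using bound by (rule that)
qed

section \<open>Holomorphic members of \<open>K_space\<close> and the exponential bounds they
  imply\<close>

context weighted_strip
begin

lemma weight_nearby:
  obtains M C where "N \<le> M" "\<And>z w. cmod (w - z) \<le> 1 \<Longrightarrow> exp (W N \<bar>Re z\<bar>) \<le> C * exp (W M \<bar>Re w\<bar>)" "0 < C"
proof -
  obtain M C where M: "N \<le> M" "\<And>s t. 0 \<le> s \<Longrightarrow> 0 \<le> t \<Longrightarrow> W N (s + t) \<le> W M s + W M t + C"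
    using weight_add[OF W alpha] by metis
  have "exp (W N \<bar>Re z\<bar>) \<le> exp (W M 1 + C) * exp (W M \<bar>Re w\<bar>)" if "cmod (w - z) \<le> 1" for z w
  proof -
    have "\<bar>Re z\<bar> \<le> \<bar>Re w\<bar> + 1" using abs_Re_le_cmod[of "w - z"] that by simp
    then have "W N \<bar>Re z\<bar> \<le> W N (\<bar>Re w\<bar> + 1)" by (intro weight_mono[OF W]) auto
    also have "\<dots> \<le> W M \<bar>Re w\<bar> + W M 1 + C" by (rule M(2)) auto
    finally show ?thesis by (simp flip: exp_add add: algebra_simps)
  qed
  with M(1) that[of M "exp (W M 1 + C)"] show ?thesis by simp
qed

text \<open>Cauchy's estimate on discs of one fixed radius, which stay in a slightly larger strip.
  Moving the weight from the centre to the circle costs a constant and a larger index.\<close>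

lemma wbdd_deriv:
  assumes f: "f holomorphic_on T b" "wbdd b f"
  shows "wbdd b (deriv f)"
  unfolding wbdd_def
proof (intro allI impI)
  fix N a assume a: "0 < a \<and> a < b"
  define a' where "a' = (a + b) / 2"
  have a': "a < a'" "a' < b" "0 < a'" using a by (auto simp: a'_def)
  obtain \<delta> where \<delta>: "0 < \<delta>" "\<And>z w. z \<in> T a \<Longrightarrow> cmod (w - z) < \<delta> \<Longrightarrow> w \<in> T a'"
    using T_margin[of a a'] a a' by (metis less_imp_le)
  obtain M C where M: "\<And>z w. cmod (w - z) \<le> 1 \<Longrightarrow> exp (W N \<bar>Re z\<bar>) \<le> C * exp (W M \<bar>Re w\<bar>)" "0 < C"
    using weight_nearby by metis
  obtain D where D: "\<And>z. z \<in> T a' \<Longrightarrow> exp (W M \<bar>Re z\<bar>) * cmod (f z) \<le> D"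
    using wbddD[OF f(2) a'(3,2)] by metis
  define r where "r = min 1 (\<delta> / 2)"
  have r: "0 < r" "r \<le> 1" "r < \<delta>" using \<delta>(1) by (auto simp: r_def)
  have "exp (W N \<bar>Re z\<bar>) * cmod (deriv f z) \<le> C * D / r" if z: "z \<in> T a" for z
  proof -
    have sub: "cball z r \<subseteq> T a'"
      using \<delta>(2)[OF z] r by (auto simp: dist_norm norm_minus_commute)
    have hol: "f holomorphic_on cball z r"
      by (rule holomorphic_on_subset[OF f(1)]) (use sub T_mono[of a' b] a' in auto)
    have "cmod ((deriv ^^ 1) f z) \<le> fact 1 * (C * D / exp (W N \<bar>Re z\<bar>)) / r ^ 1"
    proof (rule Cauchy_inequality)
      show "f holomorphic_on ball z r" by (rule holomorphic_on_subset[OF hol]) auto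
      show "continuous_on (cball z r) f" by (rule holomorphic_on_imp_continuous_on[OF hol])
      fix w assume w: "cmod (z - w) = r"
      then have wT: "w \<in> T a'" using sub by (auto simp: dist_norm)
      have "exp (W N \<bar>Re z\<bar>) * cmod (f w) \<le> C * exp (W M \<bar>Re w\<bar>) * cmod (f w)"
        using M(1)[of w z] w r by (intro mult_right_mono) (auto simp: norm_minus_commute)
      also have "\<dots> = C * (exp (W M \<bar>Re w\<bar>) * cmod (f w))" by simp
      also have "\<dots> \<le> C * D" using M(2) D[OF wT] by (intro mult_left_mono) auto
      finally show "cmod (f w) \<le> C * D / exp (W N \<bar>Re z\<bar>)"
        by (simp add: field_simps)
    qed (use r in auto)
    then show ?thesis using r by (simp add: field_simps)
  qed
  then show "\<exists>C. \<forall>z\<in>T a. exp (W N \<bar>Re z\<bar>) * cmod (deriv f z) \<le> C" by blast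
qed

lemma holomorphic_smooth_with_wbdd:
  assumes "f holomorphic_on T b" "wbdd b f"
  shows "smooth_with (T b) (wbdd b) f"
proof (rule smooth_with_holomorphic[where P = "wbdd b", OF assms(1) open_T _ assms(2)])
  show "wbdd b g" if "wbdd b f" "\<And>z. z \<in> T b \<Longrightarrow> g z = c * f z" for c f g
    by (rule local_onD[OF local_on_wbdd, OF wbdd_cmult[OF that(1)]]) (rule that(2)[symmetric])
qed (rule wbdd_deriv)

lemma wbdd_mono: "wbdd b f \<Longrightarrow> a \<le> b \<Longrightarrow> wbdd a f"
  unfolding wbdd_def by force

text \<open>Allows a different decomposition of \<open>f\<close> on each smaller strip: a partial
  sum of solutions plus a tail that is holomorphic only there.\<close>

lemma K_space_localI:
  assumes "\<And>a. 0 < a \<Longrightarrow> a < 1 \<Longrightarrow> \<exists>b>a. smooth_with (T b) (wbdd b) f"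
  shows "f \<in> K_space W F G"
  unfolding K_space_iff
proof (rule smooth_with_coinduct[where R = "\<lambda>f. \<forall>a. 0 < a \<and> a < 1 \<longrightarrow> (\<exists>b>a. smooth_with (T b) (wbdd b) f)"])
  fix f assume f: "\<forall>a. 0 < a \<and> a < 1 \<longrightarrow> (\<exists>b>a. smooth_with (T b) (wbdd b) f)"
  show "wbdd 1 f"
    unfolding wbdd_def
  proof (intro allI impI)
    fix N a assume a: "0 < a \<and> a < (1::real)"
    then obtain b where "b > a" "wbdd b f" using f smooth_withD(1) by blast
    with a show "\<exists>C. \<forall>z\<in>T a. exp (W N \<bar>Re z\<bar>) * cmod (f z) \<le> C" unfolding wbdd_def by blast
  qed
  show "f differentiable (at z)" if z: "z \<in> T 1" for z
  proof -
    obtain a where a: "0 < a" "a < 1" "z \<in> T a" using T_1_exhaust[OF z, of 0] by auto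
    then obtain b where b: "b > a" "smooth_with (T b) (wbdd b) f" using f by blast
    then have "z \<in> T b" using a T_mono[of a b] by auto
    with b show ?thesis using smooth_withD(2) by blast
  qed
  show "\<forall>a. 0 < a \<and> a < 1 \<longrightarrow> (\<exists>b>a. smooth_with (T b) (wbdd b) (partial_x f))"
    "\<forall>a. 0 < a \<and> a < 1 \<longrightarrow> (\<exists>b>a. smooth_with (T b) (wbdd b) (partial_y f))"
    using f smooth_withD(3,4) by blast+
qed (use assms in blast)

lemma holomorphic_K_space:
  assumes "f holomorphic_on strip F G" "wbdd 1 f"
  shows "f \<in> K_space W F G"
  unfolding K_space_iff by (rule holomorphic_smooth_with_wbdd) (use assms in auto)

lemma U_space_nontrivial:
  assumes "subexponential W"
  shows "\<exists>f\<in>U_space W F G. \<exists>z\<in>strip F G. f z \<noteq> 0"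
proof -
  obtain m H where mH: "0 < m" "m \<le> H" "\<And>t. F t \<le> H" "\<And>t. G t \<le> H"
    using boundary_bounds by metis
  obtain P where P: "P holomorphic_on UNIV" "P 0 = 1"
    "\<And>N. \<exists>C\<ge>0. \<forall>z. \<bar>Im z\<bar> \<le> H \<longrightarrow> exp (W N \<bar>Re z\<bar>) * exp \<bar>Re z\<bar> * cmod (P z) \<le> C"
    using exp_cosh_decay[OF assms, of H] mH by (metis less_le_trans)
  have hol: "P holomorphic_on strip F G" using P(1) by (rule holomorphic_on_subset) auto
  have "wbdd 1 P"
    unfolding wbdd_def
  proof (intro allI impI)
    fix N a assume a: "0 < a \<and> a < (1::real)"
    obtain C where C: "\<And>z. \<bar>Im z\<bar> \<le> H \<Longrightarrow> exp (W N \<bar>Re z\<bar>) * exp \<bar>Re z\<bar> * cmod (P z) \<le> C"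
      using P(3) by metis
    have "exp (W N \<bar>Re z\<bar>) * cmod (P z) \<le> C" if "z \<in> T a" for z
    proof -
      have "z \<in> T 1" using T_mono[of a 1] a that by auto
      then have "\<bar>Im z\<bar> \<le> H" using mH(3,4)[of "Re z"] unfolding mem_T by linarith
      from C[OF this] have 1: "exp (W N \<bar>Re z\<bar>) * cmod (P z) * exp \<bar>Re z\<bar> \<le> C" by (simp add: mult_ac)
      have "exp (W N \<bar>Re z\<bar>) * cmod (P z) * 1 \<le> exp (W N \<bar>Re z\<bar>) * cmod (P z) * exp \<bar>Re z\<bar>"
        by (intro mult_left_mono) auto
      with 1 show ?thesis unfolding mult_1_right by linarith
    qed
    then show "\<exists>C. \<forall>z\<in>T a. exp (W N \<bar>Re z\<bar>) * cmod (P z) \<le> C" by blast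
  qed
  with hol have "P \<in> U_space W F G" by (simp add: U_space_def holomorphic_K_space)
  moreover have "0 \<in> strip F G" using F_pos[of 0] G_pos[of 0] by (simp add: strip_def)
  ultimately show ?thesis using P(2) by (metis zero_neq_one)
qed

lemma subexponential_from_half_strip:
  assumes f: "f holomorphic_on {z. R < Re z \<and> \<bar>Im z\<bar> < h}" and h: "0 < h" and R: "0 \<le> R"
    and b: "\<And>N. \<exists>B. \<forall>z. R < Re z \<and> \<bar>Im z\<bar> < h \<longrightarrow> exp (W N \<bar>Re z\<bar>) * cmod (f z) \<le> B"
    and x: "\<exists>x > R + (2 * h / pi) * ln 2. f (of_real x) \<noteq> 0"
  shows "subexponential W"
proof (rule subexponentialI[OF W alpha])
  fix N
  obtain B where B: "\<And>z. R < Re z \<Longrightarrow> \<bar>Im z\<bar> < h \<Longrightarrow> exp (W N \<bar>Re z\<bar>) * cmod (f z) \<le> B"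
    using b by metis
  have B': "cmod (f z) \<le> B * exp (- W N (Re z))" if "R < Re z" "\<bar>Im z\<bar> < h" for z
    using B[OF that] that R by (simp add: exp_minus field_simps)
  show "\<exists>C. \<forall>t\<ge>0. W N t \<le> C * exp (pi / (2 * h) * t)"
    using x half_strip_decay_bound[OF f h R weight_nonneg[OF W] weight_mono[OF W] B'] by blast
qed

text \<open>The straight strip of half-width \<open>m / 2\<close> lies inside
  \<open>T (1/2)\<close>, where the defining bounds apply. This is where generalized strips are
  traded for the straight ones of the decay estimate.\<close>

lemma strip_bound_of_wbdd:
  assumes "wbdd 1 f" "\<And>t. m \<le> F t" "\<And>t. m \<le> G t" "0 < m"
  shows "\<exists>B\<ge>0. \<forall>z. \<bar>Im z\<bar> < m / 2 \<longrightarrow> exp (W N \<bar>Re z\<bar>) * cmod (f z) \<le> B"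
proof -
  obtain B where B: "0 \<le> B" "\<And>z. z \<in> T (1/2) \<Longrightarrow> exp (W N \<bar>Re z\<bar>) * cmod (f z) \<le> B"
    using wbddD[OF assms(1), of "1/2"] by auto
  have "z \<in> T (1/2)" if "\<bar>Im z\<bar> < m / 2" for z
    using that assms(2,3)[of "Re z"] unfolding mem_T by linarith
  with B show ?thesis by blast
qed

lemma vanishing_on_real_ray:
  assumes f: "f holomorphic_on S" and S: "open S" "connected S" and R: "\<And>x. X < x \<Longrightarrow> of_real x \<in> S"
    and z: "\<And>x. X < x \<Longrightarrow> f (of_real x) = 0" and w: "w \<in> S"
  shows "f w = 0"
proof (rule analytic_continuation[OF f S _ _ _ _ w])
  show "of_real ` {X<..} \<subseteq> S" using R by auto
  show "of_real (X + 1) \<in> S" by (rule R) simp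
  show "of_real (X + 1) islimpt (of_real ` {X<..} :: complex set)"
    unfolding islimpt_approachable
  proof (intro allI impI)
    fix e :: real assume "e > 0"
    then show "\<exists>x'\<in>of_real ` {X<..}. x' \<noteq> (of_real (X + 1) :: complex) \<and> dist x' (of_real (X + 1)) < e"
      by (intro bexI[of _ "of_real (X + 1 + e / 2)"])
        (auto simp: dist_norm simp del: of_real_add simp flip: of_real_diff)
  qed
  show "\<And>v. v \<in> of_real ` {X<..} \<Longrightarrow> f v = 0" using z by auto
qed

lemma subexponential_of_U_space:
  assumes f: "f \<in> U_space W F G" and z: "z \<in> strip F G" "f z \<noteq> 0"
  shows "subexponential W"
proof -
  obtain m H where m: "0 < m" "\<And>t. m \<le> F t" "\<And>t. m \<le> G t" using boundary_bounds by metis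
  have hol: "f holomorphic_on strip F G" and "f \<in> K_space W F G" using f by (auto simp: U_space_def)
  then have w: "wbdd 1 f" by (auto simp: K_space_iff dest: smooth_withD(1))
  show ?thesis
  proof (rule subexponential_from_half_strip[of f 0 "m / 2"])
    show "f holomorphic_on {z. 0 < Re z \<and> \<bar>Im z\<bar> < m / 2}"
    proof (rule holomorphic_on_subset[OF hol], safe)
      fix z assume "\<bar>Im z\<bar> < m / 2"
      then show "z \<in> strip F G" using m(1) m(2,3)[of "Re z"] unfolding strip_def by auto
    qed
    show "\<exists>B. \<forall>z. 0 < Re z \<and> \<bar>Im z\<bar> < m / 2 \<longrightarrow> exp (W N \<bar>Re z\<bar>) * cmod (f z) \<le> B" for N
      using strip_bound_of_wbdd[OF w m(2,3,1)] by blast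
    show "\<exists>x>0 + 2 * (m / 2) / pi * ln 2. f (of_real x) \<noteq> 0"
    proof (rule ccontr)
      assume "\<not> ?thesis"
      then have "f (of_real x) = 0" if "0 + 2 * (m / 2) / pi * ln 2 < x" for x using that by blast
      note 0 = this
      have "f z = 0"
      proof (rule vanishing_on_real_ray[OF hol[unfolded T_1] open_T connected_T])
        show "of_real x \<in> T 1" for x using F_pos[of x] G_pos[of x] by (simp add: strip_def)
      qed (use 0 z in auto)
      with z show False by simp
    qed
  qed (use m in auto)
qed

end

section \<open>Smooth cut-off functions\<close>

lemma poly_le_exp:
  fixes p :: "real poly"
  assumes "0 < d"
  shows "\<exists>C. \<forall>s\<ge>0. \<bar>poly p s\<bar> \<le> C * exp (d * s)"
  using assms
proof (induction p arbitrary: d)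
  case 0
  show ?case by (intro exI[of _ 0]) simp
next
  case (pCons a p)
  then obtain C where C: "\<And>s. 0 \<le> s \<Longrightarrow> \<bar>poly p s\<bar> \<le> C * exp (d / 2 * s)" by (meson half_gt_zero)
  have "\<bar>poly (pCons a p) s\<bar> \<le> (\<bar>a\<bar> + 2 / d * C) * exp (d * s)" if s: "0 \<le> s" for s
  proof -
    have e: "exp (d * s) = exp (d / 2 * s) * exp (d / 2 * s)" by (simp flip: exp_add)
    have "d / 2 * s \<le> exp (d / 2 * s)" using exp_ge_add_one_self[of "d / 2 * s"] by linarith
    then have "s \<le> 2 / d * exp (d / 2 * s)" using pCons.prems by (simp add: field_simps)
    then have "s * \<bar>poly p s\<bar> \<le> (2 / d * exp (d / 2 * s)) * (C * exp (d / 2 * s))"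
      using C[OF s] s pCons.prems by (intro mult_mono) auto
    also have "\<dots> = 2 / d * C * exp (d * s)" unfolding e by simp
    finally have 1: "s * \<bar>poly p s\<bar> \<le> 2 / d * C * exp (d * s)" .
    have "\<bar>a\<bar> * 1 \<le> \<bar>a\<bar> * exp (d * s)" using s pCons.prems by (intro mult_left_mono) auto
    moreover have "\<bar>poly (pCons a p) s\<bar> \<le> \<bar>a\<bar> + s * \<bar>poly p s\<bar>"
      using abs_triangle_ineq[of a "s * poly p s"] s by (simp add: abs_mult)
    ultimately show ?thesis using 1 unfolding distrib_right by linarith
  qed
  then show ?case by blast
qed

definition flat :: "real poly \<Rightarrow> real \<Rightarrow> real" where
  "flat p t = (if 0 < t then poly p (1 / t) * exp (- (1 / t)) else 0)"

lemma flat_bounded: "\<exists>C. \<forall>t. \<bar>flat p t\<bar> \<le> C"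
proof -
  obtain C where C: "\<And>s. 0 \<le> s \<Longrightarrow> \<bar>poly p s\<bar> \<le> C * exp s"
    using poly_le_exp[of 1 p] by auto
  have "\<bar>flat p t\<bar> \<le> \<bar>C\<bar>" for t
  proof (cases "0 < t")
    case True
    have "\<bar>poly p (1 / t)\<bar> * exp (- (1 / t)) \<le> C * exp (1 / t) * exp (- (1 / t))"
      using C[of "1 / t"] True by (intro mult_right_mono) auto
    also have "\<dots> = C" by (simp add: exp_minus)
    finally show ?thesis using True by (simp add: flat_def abs_mult)
  qed (simp add: flat_def)
  then show ?thesis by blast
qed

text \<open>In terms of \<open>s = 1 / t\<close>, differentiation acts on the polynomial factor as
  \<open>p\<close> to \<open>s\<^sup>2 * (p - p')\<close>. Only the point \<open>0\<close> needs an
  argument.\<close>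

lemma DERIV_flat: "(flat p has_real_derivative flat ([:0, 0, 1:] * (p - pderiv p)) t) (at t)"
proof (cases t "0 :: real" rule: linorder_cases)
  case less
  have "((\<lambda>_. 0) has_real_derivative 0) (at t)" by simp
  then have "(flat p has_real_derivative 0) (at t)"
    by (rule has_field_derivative_transform_within_open[of _ _ _ "{..<0}"])
      (use less in \<open>auto simp: flat_def\<close>)
  then show ?thesis using less by (simp add: flat_def)
next
  case greater
  have "((\<lambda>t. poly p (1 / t) * exp (- (1 / t))) has_real_derivative
      flat ([:0, 0, 1:] * (p - pderiv p)) t) (at t)"
    using greater
    by (auto intro!: derivative_eq_intros DERIV_chain'[OF _ poly_DERIV, of "\<lambda>t. 1 / t"]
        simp: flat_def field_simps power2_eq_square)
  then show ?thesis
    by (rule has_field_derivative_transform_within_open[of _ _ _ "{0<..}"])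
      (use greater in \<open>auto simp: flat_def\<close>)
next
  case equal
  \<comment> \<open>Multiplying the polynomial by \<open>s\<^sup>2\<close> divides the function by
    \<open>t\<^sup>2\<close>; boundedness of the result is a quadratic bound for
    \<open>flat p\<close>.\<close>
  obtain C where C: "\<And>t. \<bar>flat ([:0, 0, 1:] * p) t\<bar> \<le> C" using flat_bounded by blast
  have sq: "\<bar>flat p s\<bar> \<le> C * s\<^sup>2" for s
  proof (cases "0 < s")
    case True
    have "flat p s = flat ([:0, 0, 1:] * p) s * s\<^sup>2"
      using True by (simp add: flat_def power2_eq_square)
    then have "\<bar>flat p s\<bar> = \<bar>flat ([:0, 0, 1:] * p) s\<bar> * s\<^sup>2" by (simp add: abs_mult)
    also have "\<dots> \<le> C * s\<^sup>2" using C by (intro mult_right_mono) auto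
    finally show ?thesis .
  next
    case False
    then show ?thesis using C[of 0] by (simp add: flat_def)
  qed
  have "((\<lambda>s. flat p s / s) \<longlongrightarrow> 0) (at 0)"
  proof (rule Lim_null_comparison)
    show "\<forall>\<^sub>F s in at 0. norm (flat p s / s) \<le> C * \<bar>s\<bar>"
    proof (rule always_eventually, rule allI)
      fix s :: real
      show "norm (flat p s / s) \<le> C * \<bar>s\<bar>"
        using sq[of s] by (cases "s = 0") (simp_all add: field_simps power2_eq_square abs_mult)
    qed
    show "((\<lambda>s. C * \<bar>s\<bar>) \<longlongrightarrow> 0) (at 0)" by (auto intro!: tendsto_eq_intros)
  qed
  then show ?thesis using equal by (simp add: has_field_derivative_iff flat_def)
qed

definition sup_bounded :: "(complex \<Rightarrow> complex) \<Rightarrow> bool" where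
  "sup_bounded f \<longleftrightarrow> (\<exists>C. \<forall>z. cmod (f z) \<le> C)"

lemma sup_boundedD:
  assumes "sup_bounded f"
  obtains C where "0 \<le> C" "\<And>z. cmod (f z) \<le> C"
  using assms unfolding sup_bounded_def by (metis norm_ge_zero order_trans)

lemma local_on_sup_bounded: "local_on UNIV sup_bounded"
  by (simp add: local_on_def flip: fun_eq_iff)

lemma add_closed_sup_bounded: "add_closed sup_bounded"
  unfolding add_closed_def sup_bounded_def
proof (intro allI impI)
  fix f g :: "complex \<Rightarrow> complex"
  assume "\<exists>C. \<forall>z. cmod (f z) \<le> C" "\<exists>C. \<forall>z. cmod (g z) \<le> C"
  then obtain C D where "\<And>z. cmod (f z) \<le> C" "\<And>z. cmod (g z) \<le> D" by blast
  then have "cmod (f z + g z) \<le> C + D" for z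
    using norm_triangle_ineq[of "f z" "g z"] add_mono order_trans by metis
  then show "\<exists>C. \<forall>z. cmod (f z + g z) \<le> C" by blast
qed

lemma sup_bounded_mult:
  assumes "sup_bounded f" "sup_bounded g"
  shows "sup_bounded (\<lambda>w. f w * g w)"
proof -
  obtain C where C: "0 \<le> C" "\<And>z. cmod (f z) \<le> C" using assms(1) sup_boundedD by blast
  obtain D where D: "0 \<le> D" "\<And>z. cmod (g z) \<le> D" using assms(2) sup_boundedD by blast
  have "cmod (f z * g z) \<le> C * D" for z unfolding norm_mult by (intro mult_mono C D norm_ge_zero)
  then show ?thesis by (auto simp: sup_bounded_def)
qed

lemma smooth_with_flat:
  "smooth_with UNIV sup_bounded (\<lambda>z. of_real (flat p (\<alpha> * Re z + \<beta> * Im z + \<gamma>)))"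
proof (rule smooth_with_coinduct[where
      R = "\<lambda>f. \<exists>p c. f = (\<lambda>z. c * of_real (flat p (\<alpha> * Re z + \<beta> * Im z + \<gamma>)))"])
  fix f :: "complex \<Rightarrow> complex"
  assume "\<exists>p c. f = (\<lambda>z. c * of_real (flat p (\<alpha> * Re z + \<beta> * Im z + \<gamma>)))"
  then obtain p c where f: "f = (\<lambda>z. c * of_real (flat p (\<alpha> * Re z + \<beta> * Im z + \<gamma>)))" by blast
  obtain C where C: "\<And>t. \<bar>flat p t\<bar> \<le> C" using flat_bounded by blast
  have "cmod (f z) \<le> cmod c * C" for z
    unfolding f by (simp add: norm_mult mult_left_mono C)
  then show "sup_bounded f" by (auto simp: sup_bounded_def)
  define q where "q = [:0, 0, 1:] * (p - pderiv p)"
  have "(f has_derivative (\<lambda>h. Re h *\<^sub>R (c * \<alpha> * of_real (flat q (\<alpha> * Re z + \<beta> * Im z + \<gamma>)))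
      + Im h *\<^sub>R (c * \<beta> * of_real (flat q (\<alpha> * Re z + \<beta> * Im z + \<gamma>))))) (at z)" for z
  proof -
    have l: "((\<lambda>z. \<alpha> * Re z + \<beta> * Im z + \<gamma>) has_derivative (\<lambda>h. \<alpha> * Re h + \<beta> * Im h)) (at z)"
      by (auto intro!: derivative_eq_intros)
    have "((\<lambda>z. flat p (\<alpha> * Re z + \<beta> * Im z + \<gamma>)) has_derivative
        (\<lambda>h. flat q (\<alpha> * Re z + \<beta> * Im z + \<gamma>) * (\<alpha> * Re h + \<beta> * Im h))) (at z)"
      by (rule has_derivative_compose[OF l DERIV_flat[of p, folded q_def, unfolded has_field_derivative_def]])
    then have "((\<lambda>z. c * of_real (flat p (\<alpha> * Re z + \<beta> * Im z + \<gamma>))) has_derivative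
        (\<lambda>h. c * of_real (flat q (\<alpha> * Re z + \<beta> * Im z + \<gamma>) * (\<alpha> * Re h + \<beta> * Im h)))) (at z)"
      by (intro has_derivative_mult_right has_derivative_of_real)
    then show ?thesis
      unfolding f by (rule has_derivative_eq_rhs) (simp add: scaleR_conv_of_real algebra_simps)
  qed
  note * = partials_eqI[OF this]
  show "f differentiable (at z)" for z by (rule *(3))
  show "\<exists>p c. partial_x f = (\<lambda>z. c * of_real (flat p (\<alpha> * Re z + \<beta> * Im z + \<gamma>)))"
    using *(1) by (intro exI[of _ q] exI[of _ "c * \<alpha>"] ext) simp
  show "\<exists>p c. partial_y f = (\<lambda>z. c * of_real (flat p (\<alpha> * Re z + \<beta> * Im z + \<gamma>)))"
    using *(2) by (intro exI[of _ q] exI[of _ "c * \<beta>"] ext) simp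
next
  show "\<exists>pa c. (\<lambda>z. complex_of_real (flat p (\<alpha> * Re z + \<beta> * Im z + \<gamma>))) =
      (\<lambda>z. c * of_real (flat pa (\<alpha> * Re z + \<beta> * Im z + \<gamma>)))"
    by (intro exI[of _ p] exI[of _ 1]) simp
qed

text \<open>A product of four flat functions supported in the square of half-side
  \<open>e / 2\<close>. A point of modulus at least \<open>e\<close> has a coordinate of modulus at
  least \<open>e / 2\<close>, because the modulus is at most the sum of the two.\<close>

lemma smooth_bump:
  assumes "0 < e"
  obtains \<rho> :: "complex \<Rightarrow> real" where "smooth_with UNIV sup_bounded (\<lambda>z. of_real (\<rho> z))"
    "\<And>z. 0 \<le> \<rho> z" "\<And>z. e \<le> cmod z \<Longrightarrow> \<rho> z = 0" "0 < \<rho> 0"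
proof -
  define d where "d = e / 2"
  have d: "0 < d" using assms by (simp add: d_def)
  define \<rho> where "\<rho> z = flat 1 (Re z + d) * flat 1 (d - Re z) * flat 1 (Im z + d) * flat 1 (d - Im z)" for z
  have "smooth_with UNIV sup_bounded (\<lambda>z. of_real (flat 1 (1 * Re z + 0 * Im z + d)) * of_real (flat 1 ((- 1) * Re z + 0 * Im z + d))
      * of_real (flat 1 (0 * Re z + 1 * Im z + d)) * of_real (flat 1 (0 * Re z + (- 1) * Im z + d)))"
    by (rule smooth_with_mult[OF _ _ open_UNIV local_on_sup_bounded add_closed_sup_bounded sup_bounded_mult], 
       rule smooth_with_mult[OF _ _ open_UNIV local_on_sup_bounded add_closed_sup_bounded sup_bounded_mult],
       rule smooth_with_mult[OF _ _ open_UNIV local_on_sup_bounded add_closed_sup_bounded sup_bounded_mult])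
      (rule smooth_with_flat | assumption)+
  then have "smooth_with UNIV sup_bounded (\<lambda>z. of_real (\<rho> z))"
    by (simp add: \<rho>_def algebra_simps)
  moreover have f: "0 \<le> flat 1 t" "t \<le> 0 \<Longrightarrow> flat 1 t = 0" for t by (auto simp: flat_def)
  moreover have "0 \<le> \<rho> z" for z using f by (simp add: \<rho>_def)
  moreover have "\<rho> z = 0" if "e \<le> cmod z" for z
  proof -
    have "e \<le> \<bar>Re z\<bar> + \<bar>Im z\<bar>" using that cmod_le[of z] by simp
    then have "d \<le> \<bar>Re z\<bar> \<or> d \<le> \<bar>Im z\<bar>" unfolding d_def by linarith
    then have "Re z + d \<le> 0 \<or> d - Re z \<le> 0 \<or> Im z + d \<le> 0 \<or> d - Im z \<le> 0" by linarith
    then show ?thesis using f(2) by (auto simp: \<rho>_def)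
  qed
  moreover have "0 < \<rho> 0" using d by (simp add: \<rho>_def flat_def)
  ultimately show ?thesis using that by blast
qed

text \<open>Kernels live on \<open>real \<times> real\<close>, where Lebesgue measure is a product measure and Fubini applies.\<close>

definition cx :: "real \<times> real \<Rightarrow> complex" where
  "cx p = Complex (fst p) (snd p)"

lemma cx_simps [simp]: "Re (cx p) = fst p" "Im (cx p) = snd p"
  by (simp_all add: cx_def)

lemma continuous_cx: "continuous_on A cx"
  unfolding cx_def Complex_eq by (intro continuous_intros)

lemma cx_measurable [measurable]: "cx \<in> borel_measurable borel"
  by (rule borel_measurable_continuous_onI[OF continuous_cx])

text \<open>The integral of a non-integrable function is \<open>0\<close> by convention, and the
  majorant is nonnegative, so the estimate covers that case too.\<close>

lemma norm_integral_le:
  fixes f :: "'a \<Rightarrow> complex"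
  assumes "integrable M g" "\<And>x. cmod (f x) \<le> g x"
  shows "cmod (integral\<^sup>L M f) \<le> integral\<^sup>L M g"
proof (cases "integrable M f")
  case True
  have "cmod (integral\<^sup>L M f) \<le> (\<integral>x. cmod (f x) \<partial>M)" by (rule integral_norm_bound)
  also have "\<dots> \<le> integral\<^sup>L M g" by (rule integral_mono) (use True assms in auto)
  finally show ?thesis .
next
  case False
  have "0 \<le> g x" for x using assms(2)[of x] norm_ge_zero order_trans by blast
  then show ?thesis using False by (simp add: not_integrable_integral_eq)
qed

text \<open>Written with the shift in \<open>g\<close>, so that all derivatives fall on
  \<open>g\<close>. The kernel, singular at the origin, only has to be integrable.\<close>

definition conv :: "(real \<times> real \<Rightarrow> complex) \<Rightarrow> (complex \<Rightarrow> complex) \<Rightarrow> complex \<Rightarrow> complex" where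
  "conv K g z = (\<integral>p. g (z - cx p) * K p \<partial>lborel)"

lemma integrable_conv:
  fixes K :: "real \<times> real \<Rightarrow> complex"
  assumes "integrable lborel K" "continuous_on UNIV g" "\<And>z. cmod (g z) \<le> C"
  shows "integrable lborel (\<lambda>p. g (z - cx p) * K p)"
proof (rule Bochner_Integration.integrable_bound[of lborel "\<lambda>p. C *\<^sub>R K p"])
  show "integrable lborel (\<lambda>p. C *\<^sub>R K p)" using assms(1) by simp
  have [measurable]: "g \<in> borel_measurable borel"
    using assms(2) by (rule borel_measurable_continuous_onI)
  have [measurable]: "K \<in> borel_measurable lborel" using assms(1) by (rule borel_measurable_integrable)
  show "(\<lambda>p. g (z - cx p) * K p) \<in> borel_measurable lborel" by measurable
  have "cmod (g (z - cx p) * K p) \<le> \<bar>C\<bar> * cmod (K p)" for p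
    unfolding norm_mult using assms(3)[of "z - cx p"] by (intro mult_right_mono) auto
  then show "AE p in lborel. cmod (g (z - cx p) * K p) \<le> cmod (C *\<^sub>R K p)"
    by (intro AE_I2) simp
qed

lemma conv_bound:
  assumes "integrable lborel K" "\<And>z. cmod (g z) \<le> C"
  shows "cmod (conv K g z) \<le> C * (\<integral>p. cmod (K p) \<partial>lborel)"
proof -
  have C: "0 \<le> C" using assms(2)[of 0] norm_ge_zero order_trans by blast
  have "cmod (conv K g z) \<le> (\<integral>p. C * cmod (K p) \<partial>lborel)"
    unfolding conv_def
  proof (rule norm_integral_le)
    show "integrable lborel (\<lambda>p. C * cmod (K p))" using assms(1) by simp
    show "cmod (g (z - cx p) * K p) \<le> C * cmod (K p)" for p
      unfolding norm_mult by (intro mult_right_mono assms(2)) simp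
  qed
  then show ?thesis by simp
qed


section \<open>Differentiation of convolutions\<close>

lemma increment_bound:
  assumes "smooth_with UNIV sup_bounded g"
  shows "\<exists>L\<ge>0. \<forall>z h. cmod (g (z + h) - g z) \<le> L * cmod h"
proof -
  obtain A where A: "0 \<le> A" "\<And>z. cmod (partial_x g z) \<le> A"
    using sup_boundedD smooth_withD(1)[OF smooth_withD(3)[OF assms]] by blast
  obtain B where B: "0 \<le> B" "\<And>z. cmod (partial_y g z) \<le> B"
    using sup_boundedD smooth_withD(1)[OF smooth_withD(4)[OF assms]] by blast
  have "cmod (g (z + h) - g z) \<le> (A + B) * cmod (z + h - z)" for z h
  proof (rule differentiable_bound[OF convex_UNIV])
    fix w :: complex
    show "(g has_derivative (\<lambda>h. Re h *\<^sub>R partial_x g w + Im h *\<^sub>R partial_y g w)) (at w within UNIV)"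
      using has_derivative_partials[OF smooth_withD(2)[OF assms UNIV_I]] by simp
    show "onorm (\<lambda>h. Re h *\<^sub>R partial_x g w + Im h *\<^sub>R partial_y g w) \<le> A + B"
    proof (rule onorm_le)
      fix h
      have "cmod (Re h *\<^sub>R partial_x g w + Im h *\<^sub>R partial_y g w)
          \<le> \<bar>Re h\<bar> * cmod (partial_x g w) + \<bar>Im h\<bar> * cmod (partial_y g w)"
        by (rule order_trans[OF norm_triangle_ineq]) simp
      also have "\<dots> \<le> cmod h * A + cmod h * B"
        by (intro add_mono mult_mono abs_Re_le_cmod abs_Im_le_cmod A B) auto
      finally show "cmod (Re h *\<^sub>R partial_x g w + Im h *\<^sub>R partial_y g w) \<le> (A + B) * cmod h"
        by (simp add: algebra_simps)
    qed
  qed auto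
  with A(1) B(1) show ?thesis by (intro exI[of _ "A + B"]) simp
qed

text \<open>Bounded second derivatives make the first ones Lipschitz, and the mean value inequality
  then bounds the Taylor remainder uniformly in \<open>z\<close>. The uniformity lets it be
  integrated against a kernel.\<close>

lemma quadratic_increment_bound:
  assumes g: "smooth_with UNIV sup_bounded g"
  shows "\<exists>L\<ge>0. \<forall>z h. cmod (g (z + h) - g z - (Re h *\<^sub>R partial_x g z + Im h *\<^sub>R partial_y g z)) \<le> L * (cmod h * cmod h)"
proof -
  obtain A where A: "0 \<le> A" "\<And>z h. cmod (partial_x g (z + h) - partial_x g z) \<le> A * cmod h"
    using increment_bound[OF smooth_withD(3)[OF g]] by blast
  obtain B where B: "0 \<le> B" "\<And>z h. cmod (partial_y g (z + h) - partial_y g z) \<le> B * cmod h"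
    using increment_bound[OF smooth_withD(4)[OF g]] by blast
  have "cmod (g (z + h) - g z - (Re h *\<^sub>R partial_x g z + Im h *\<^sub>R partial_y g z)) \<le> (A + B) * (cmod h * cmod h)" for z h
  proof -
    define \<phi> where "\<phi> w = g (z + w) - (Re w *\<^sub>R partial_x g z + Im w *\<^sub>R partial_y g z)" for w
    have "cmod (\<phi> h - \<phi> 0) \<le> ((A + B) * cmod h) * cmod (h - 0)"
    proof (rule differentiable_bound[OF convex_cball[of 0 "cmod h"]])
      fix w :: complex assume w: "w \<in> cball 0 (cmod h)"
      let ?a = "partial_x g (z + w) - partial_x g z" and ?b = "partial_y g (z + w) - partial_y g z"
      have l: "((\<lambda>w. z + w) has_derivative (\<lambda>k. k)) (at w)" by (auto intro!: derivative_eq_intros)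
      have "((\<lambda>w. g (z + w)) has_derivative (\<lambda>k. Re k *\<^sub>R partial_x g (z + w) + Im k *\<^sub>R partial_y g (z + w))) (at w)"
        by (rule has_derivative_compose[OF l has_derivative_partials[OF smooth_withD(2)[OF g UNIV_I]]])
      moreover have "((\<lambda>w. Re w *\<^sub>R partial_x g z + Im w *\<^sub>R partial_y g z) has_derivative
          (\<lambda>k. Re k *\<^sub>R partial_x g z + Im k *\<^sub>R partial_y g z)) (at w)"
        by (auto intro!: derivative_eq_intros)
      ultimately have "(\<phi> has_derivative (\<lambda>k. Re k *\<^sub>R ?a + Im k *\<^sub>R ?b)) (at w)"
        unfolding \<phi>_def[abs_def]
        by (rule has_derivative_eq_rhs[OF has_derivative_diff]) (simp add: algebra_simps)
      then show "(\<phi> has_derivative (\<lambda>k. Re k *\<^sub>R ?a + Im k *\<^sub>R ?b)) (at w within cball 0 (cmod h))"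
        by (rule has_derivative_at_withinI)
      show "onorm (\<lambda>k. Re k *\<^sub>R ?a + Im k *\<^sub>R ?b) \<le> (A + B) * cmod h"
      proof (rule onorm_le)
        fix k
        have "cmod (Re k *\<^sub>R ?a + Im k *\<^sub>R ?b) \<le> \<bar>Re k\<bar> * cmod ?a + \<bar>Im k\<bar> * cmod ?b"
          by (rule order_trans[OF norm_triangle_ineq]) simp
        also have "\<dots> \<le> cmod k * (A * cmod w) + cmod k * (B * cmod w)"
          by (intro add_mono mult_mono abs_Re_le_cmod abs_Im_le_cmod A B) auto
        also have "\<dots> = ((A + B) * cmod w) * cmod k" by (simp add: algebra_simps)
        also have "\<dots> \<le> ((A + B) * cmod h) * cmod k"
          using w A B by (intro mult_right_mono mult_left_mono) auto
        finally show "cmod (Re k *\<^sub>R ?a + Im k *\<^sub>R ?b) \<le> ((A + B) * cmod h) * cmod k" .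
      qed
    qed auto
    moreover have "\<phi> h - \<phi> 0 = g (z + h) - g z - (Re h *\<^sub>R partial_x g z + Im h *\<^sub>R partial_y g z)"
      by (simp add: \<phi>_def)
    ultimately show ?thesis by (simp add: mult.assoc)
  qed
  with A(1) B(1) show ?thesis by (intro exI[of _ "A + B"]) simp
qed

lemma has_derivative_of_quadratic_bound:
  fixes f :: "'a::real_normed_vector \<Rightarrow> 'b::real_normed_vector"
  assumes "bounded_linear D" "\<And>h. norm (f (z + h) - f z - D h) \<le> L * (norm h * norm h)" "0 \<le> L"
  shows "(f has_derivative D) (at z)"
  unfolding has_derivative_at_alt
proof (intro conjI allI impI)
  fix e :: real assume e: "0 < e"
  show "\<exists>d>0. \<forall>y. norm (y - z) < d \<longrightarrow> norm (f y - f z - D (y - z)) \<le> e * norm (y - z)"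
  proof (intro exI[of _ "e / (L + 1)"] conjI allI impI)
    fix y assume y: "norm (y - z) < e / (L + 1)"
    have "norm (f y - f z - D (y - z)) \<le> L * (norm (y - z) * norm (y - z))"
      using assms(2)[of "y - z"] by simp
    also have "\<dots> \<le> (L + 1) * (norm (y - z) * norm (y - z))" by (intro mult_right_mono) auto
    also have "\<dots> \<le> (L + 1) * (e / (L + 1) * norm (y - z))"
      using y assms(3) by (intro mult_left_mono mult_right_mono) auto
    also have "\<dots> = e * norm (y - z)" using assms(3) by simp
    finally show "norm (f y - f z - D (y - z)) \<le> e * norm (y - z)" .
  qed (use e assms(3) in auto)
qed (use assms in auto)

lemma smooth_with_continuous:
  assumes "smooth_with S Q g"
  shows "continuous_on S g"
proof -
  have "continuous (at z) g" if "z \<in> S" for z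
    using smooth_withD(2)[OF assms that] by (rule differentiable_imp_continuous_within)
  then show ?thesis by (simp add: continuous_at_imp_continuous_on)
qed

text \<open>By linearity the convolution of the first-order Taylor remainder of \<open>g\<close> is
  the remainder of \<open>conv K g\<close>. It is at most \<open>L\<close> times the squared
  increment times the integral of \<open>cmod (K p)\<close>.\<close>

lemma conv_partials:
  assumes K: "integrable lborel K" and g: "smooth_with UNIV sup_bounded g"
  shows "partial_x (conv K g) z = conv K (partial_x g) z"
    "partial_y (conv K g) z = conv K (partial_y g) z"
    "conv K g differentiable (at z)"
proof -
  have int: "integrable lborel (\<lambda>p. u (z - cx p) * K p)" if u: "smooth_with UNIV sup_bounded u" for u z
  proof -
    obtain C where "\<And>z. cmod (u z) \<le> C" using smooth_withD(1)[OF u] sup_boundedD by blast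
    then show ?thesis using integrable_conv[OF K smooth_with_continuous[OF u]] by blast
  qed
  note gx = smooth_withD(3)[OF g] and gy = smooth_withD(4)[OF g]
  obtain L where L: "0 \<le> L" "\<And>z h. cmod (g (z + h) - g z - (Re h *\<^sub>R partial_x g z + Im h *\<^sub>R partial_y g z)) \<le> L * (cmod h * cmod h)"
    using quadratic_increment_bound[OF g] by blast
  let ?D = "\<lambda>h. Re h *\<^sub>R conv K (partial_x g) z + Im h *\<^sub>R conv K (partial_y g) z"
  have "(conv K g has_derivative ?D) (at z)"
  proof (rule has_derivative_of_quadratic_bound)
    show "bounded_linear ?D" by (intro bounded_linear_intros bounded_linear_Re bounded_linear_Im)
    show "0 \<le> L * (\<integral>p. cmod (K p) \<partial>lborel)" using L(1) by simp
    fix h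
    let ?q = "\<lambda>w. g (w + h) - g w - (Re h *\<^sub>R partial_x g w + Im h *\<^sub>R partial_y g w)"
    have "conv K g (z + h) - conv K g z - ?D h = conv K ?q z"
    proof -
      have "conv K ?q z = (\<integral>p. (g ((z + h) - cx p) * K p - g (z - cx p) * K p)
          - (Re h *\<^sub>R (partial_x g (z - cx p) * K p) + Im h *\<^sub>R (partial_y g (z - cx p) * K p)) \<partial>lborel)"
        unfolding conv_def by (rule Bochner_Integration.integral_cong) (simp_all add: algebra_simps)
      also have "\<dots> = conv K g (z + h) - conv K g z - ?D h"
        unfolding conv_def using int[OF g] int[OF gx] int[OF gy]
        by (simp add: Bochner_Integration.integral_diff Bochner_Integration.integral_add del: scaleR_complex.sel)
      finally show ?thesis by simp
    qed
    also have "cmod (conv K ?q z) \<le> (L * (cmod h * cmod h)) * (\<integral>p. cmod (K p) \<partial>lborel)"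
      by (rule conv_bound[OF K L(2)])
    finally show "cmod (conv K g (z + h) - conv K g z - ?D h) \<le> L * (\<integral>p. cmod (K p) \<partial>lborel) * (cmod h * cmod h)"
      by (simp add: mult_ac)
  qed
  from partials_eqI[OF this]
  show "partial_x (conv K g) z = conv K (partial_x g) z"
    "partial_y (conv K g) z = conv K (partial_y g) z"
    "conv K g differentiable (at z)" by auto
qed

lemma cx_bounded_measurable:
  assumes "A \<in> sets borel"
  shows "cx -` A \<in> sets borel"
  using measurable_sets[OF cx_measurable assms] by simp

lemma measure_ball_cx:
  obtains L where "\<And>z. emeasure lborel (cx -` ball z r) \<le> ennreal L"
proof -
  define R where "R = \<bar>r\<bar>"
  have "emeasure lborel (cx -` ball z r) \<le> ennreal (\<Prod>b\<in>(Basis :: (real \<times> real) set). (2 * R, 2 * R) \<bullet> b)" for z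
  proof -
    have "cx -` ball z r \<subseteq> cbox (Re z - R, Im z - R) (Re z + R, Im z + R)"
    proof
      fix p assume "p \<in> cx -` ball z r"
      then have "cmod (z - cx p) < r" by (simp add: dist_norm)
      then have "\<bar>Re z - fst p\<bar> \<le> R" "\<bar>Im z - snd p\<bar> \<le> R"
        using abs_Re_le_cmod[of "z - cx p"] abs_Im_le_cmod[of "z - cx p"] by (auto simp: R_def)
      then show "p \<in> cbox (Re z - R, Im z - R) (Re z + R, Im z + R)"
        by (cases p) (auto simp: cbox_Pair_eq)
    qed
    then have "emeasure lborel (cx -` ball z r) \<le> emeasure lborel (cbox (Re z - R, Im z - R) (Re z + R, Im z + R))"
      by (intro emeasure_mono) auto
    also have "\<dots> = ennreal (\<Prod>b\<in>(Basis :: (real \<times> real) set). ((Re z + R, Im z + R) - (Re z - R, Im z - R)) \<bullet> b)"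
      by (rule emeasure_lborel_cbox) (auto simp: Basis_prod_def R_def)
    finally show ?thesis by simp
  qed
  then show ?thesis by (rule that)
qed

lemma lborel_integral_affine:
  fixes f :: "'a::euclidean_space \<Rightarrow> 'b::{banach, second_countable_topology}"
  assumes "c \<noteq> 0" and [measurable]: "f \<in> borel_measurable borel"
  shows "integral\<^sup>L lborel f = \<bar>c\<bar> ^ DIM('a) *\<^sub>R (\<integral>x. f (t + c *\<^sub>R x) \<partial>lborel)"
proof -
  have "integral\<^sup>L lborel f = integral\<^sup>L (density (distr lborel borel (\<lambda>x. t + c *\<^sub>R x)) (\<lambda>_. ennreal (\<bar>c\<bar> ^ DIM('a)))) f"
    by (subst lborel_affine[OF assms(1), of t]) (simp add: ennreal_power)
  also have "\<dots> = (\<integral>x. \<bar>c\<bar> ^ DIM('a) *\<^sub>R f x \<partial>distr lborel borel (\<lambda>x. t + c *\<^sub>R x))"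
    by (subst integral_density) auto
  also have "\<dots> = \<bar>c\<bar> ^ DIM('a) *\<^sub>R (\<integral>x. f (t + c *\<^sub>R x) \<partial>lborel)"
    by (subst integral_distr) auto
  finally show ?thesis .
qed

lemma integral_continuous_pos:
  fixes f :: "real \<times> real \<Rightarrow> real"
  assumes "integrable lborel f" "continuous_on UNIV f" "\<And>p. 0 \<le> f p" "0 < f p0"
  shows "0 < integral\<^sup>L lborel f"
proof -
  have "isCont f p0" using assms(2) continuous_on_eq_continuous_at[OF open_UNIV] by blast
  then obtain d where d: "0 < d" "\<And>p. dist p p0 < d \<Longrightarrow> dist (f p) (f p0) < f p0 / 2"
    using assms(4) unfolding continuous_at_eps_delta by (metis half_gt_zero)
  have "0 < f p0 / 2 * measure lborel (ball p0 d)" using d(1) assms(4) content_ball_pos by simp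
  also have "\<dots> = (\<integral>p. f p0 / 2 * indicator (ball p0 d) p \<partial>lborel)" by simp
  also have "\<dots> \<le> integral\<^sup>L lborel f"
  proof (rule integral_mono)
    show "integrable lborel (\<lambda>p. f p0 / 2 * indicator (ball p0 d) p)"
      using emeasure_bounded_finite[of "ball p0 d"] by (intro integrable_mult_right integrable_real_indicator) auto
    show "f p0 / 2 * indicator (ball p0 d) p \<le> f p" for p
      using d(2)[of p] assms(3)[of p]
      by (cases "p \<in> ball p0 d") (auto simp: dist_commute dist_real_def abs_if split: if_splits)
  qed (rule assms(1))
  finally show ?thesis .
qed

text \<open>The cut-off is a bump function convolved with the indicator of \<open>A\<close>; near a given point only
  the part of \<open>A\<close> inside a fixed ball matters, which makes the kernel integrable.\<close>

lemma smooth_cutoff: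
  assumes A: "A \<in> sets borel" and e: "0 < e"
  obtains \<eta> where "smooth_with UNIV sup_bounded \<eta>"
    "\<And>z. ball z e \<subseteq> A \<Longrightarrow> \<eta> z = 1" "\<And>z. ball z e \<inter> A = {} \<Longrightarrow> \<eta> z = 0"
proof -
  \<comment> \<open>With \<open>d \<le> 1\<close>, points of a unit ball only feel the part of
    \<open>A\<close> within distance \<open>2\<close> of its centre; the radius \<open>3\<close> of
    the balls in \<open>K\<close> leaves room.\<close>
  define d where "d = min e 1"
  have d: "0 < d" "d \<le> e" "d \<le> 1" using e by (auto simp: d_def)
  obtain \<rho> :: "complex \<Rightarrow> real" where \<rho>: "smooth_with UNIV sup_bounded (\<lambda>z. of_real (\<rho> z))"
    "\<And>z. 0 \<le> \<rho> z" "\<And>z. d \<le> cmod z \<Longrightarrow> \<rho> z = 0" "0 < \<rho> 0"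
    using smooth_bump[OF d(1)] by blast
  define g where "g z = complex_of_real (\<rho> z)" for z
  have g: "smooth_with UNIV sup_bounded g" using \<rho>(1) by (simp add: g_def[abs_def])
  define K where "K z0 p = complex_of_real (indicator (cx -` (A \<inter> ball z0 3)) p)" for z0 p
  obtain L where L: "\<And>z. emeasure lborel (cx -` ball z 3) \<le> ennreal L" using measure_ball_cx[of 3] by blast
  have meas: "cx -` (A \<inter> ball z0 3) \<in> sets lborel" for z0
    using cx_bounded_measurable[of "A \<inter> ball z0 3"] A by simp
  have em: "emeasure lborel (cx -` (A \<inter> ball z0 3)) \<le> ennreal L" for z0
  proof -
    have "emeasure lborel (cx -` (A \<inter> ball z0 3)) \<le> emeasure lborel (cx -` ball z0 3)"
      using cx_bounded_measurable[of "ball z0 3"] by (intro emeasure_mono) auto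
    with L[of z0] show ?thesis by (rule order_trans[rotated])
  qed
  have K: "integrable lborel (K z0)" for z0
    unfolding K_def[abs_def]
  proof (rule integrable_of_real, rule integrable_real_indicator)
    show "cx -` (A \<inter> ball z0 3) \<in> sets lborel" by (rule meas)
    show "emeasure lborel (cx -` (A \<inter> ball z0 3)) < \<infinity>"
      using em[of z0] by (rule le_less_trans) simp
  qed
  have K1: "(\<integral>p. cmod (K z0 p) \<partial>lborel) \<le> max L 0" for z0
  proof -
    have "(\<integral>p. cmod (K z0 p) \<partial>lborel) = measure lborel (cx -` (A \<inter> ball z0 3))"
      using meas by (simp add: K_def)
    also have "\<dots> \<le> max L 0" using em[of z0]
      unfolding measure_def by (intro enn2real_leI) (auto intro: order_trans ennreal_leI)
    finally show ?thesis .
  qed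
  \<comment> \<open>The truncated kernel depends on a base point. The family therefore requires a
    representation on every unit ball with the kernel of that ball and one common \<open>g\<close>;
    \<open>loc\<close> shows that the kernels of neighbouring base points give the same
    value.\<close>
  define R where "R f \<longleftrightarrow> (\<exists>g. smooth_with UNIV sup_bounded g \<and> (\<forall>w. w \<notin> cball 0 d \<longrightarrow> g w = 0)
      \<and> (\<forall>z0. \<forall>z\<in>ball z0 1. f z = conv (K z0) g z))" for f
  have loc: "conv (K z) u z = conv (K z0) u z"
    if "\<And>w. w \<notin> cball 0 d \<Longrightarrow> u w = 0" "z \<in> ball z0 1" for u z z0
    unfolding conv_def
  proof (rule Bochner_Integration.integral_cong)
    fix p
    show "u (z - cx p) * K z p = u (z - cx p) * K z0 p"
    proof (cases "z - cx p \<in> cball 0 d")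
      case True
      then have "dist z (cx p) < 3" "dist z0 (cx p) < 3"
        using d that(2) dist_triangle[of z0 "cx p" z]
        by (auto simp: dist_norm norm_minus_commute[of "cx p" z])
      then show ?thesis by (simp add: K_def indicator_def)
    qed (use that(1) in simp)
  qed simp
  have Rsmooth: "smooth_with UNIV sup_bounded f" if "R f" for f
  proof (rule smooth_with_coinduct[where R = R])
    fix f assume "R f"
    then obtain g where g: "smooth_with UNIV sup_bounded g" "\<And>w. w \<notin> cball 0 d \<Longrightarrow> g w = 0"
      "\<And>z0 z. z \<in> ball z0 1 \<Longrightarrow> f z = conv (K z0) g z" unfolding R_def by blast
    obtain C where C: "0 \<le> C" "\<And>z. cmod (g z) \<le> C" using smooth_withD(1)[OF g(1)] sup_boundedD by blast
    have "cmod (f z) \<le> C * max L 0" for z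
    proof -
      have "cmod (f z) \<le> C * (\<integral>p. cmod (K z p) \<partial>lborel)"
        using conv_bound[where g = g, OF K C(2)] g(3)[of z z] by simp
      also have "\<dots> \<le> C * max L 0" using K1 C(1) by (intro mult_left_mono) auto
      finally show ?thesis .
    qed
    then show "sup_bounded f" by (auto simp: sup_bounded_def)
    have pc: "partial_x f z = conv (K z0) (partial_x g) z" "partial_y f z = conv (K z0) (partial_y g) z"
      "f differentiable (at z)" if "z \<in> ball z0 1" for z z0
      using partials_cong[OF open_ball that _ conv_partials(3)[OF K g(1)], of z0 f] g(3)
        conv_partials(1,2)[OF K g(1)] by auto
    show "f differentiable (at z)" for z by (rule pc(3)[of z z]) simp
    have z: "partial_x g w = 0" "partial_y g w = 0" if "w \<notin> cball 0 d" for w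
      using partials_cong[of "- cball 0 d" w "\<lambda>_. 0" g] g(2) that by auto
    show "R (partial_x f)" "R (partial_y f)"
      unfolding R_def using smooth_withD(3,4)[OF g(1)] z pc(1,2) by blast+
  qed (rule that)
  \<comment> \<open>Total mass of the bump, used to normalize the cut-off to \<open>1\<close> inside
    \<open>A\<close>.\<close>
  define q where "q = (\<integral>p. \<rho> (cx p) \<partial>lborel)"
  have g0: "g w = 0" if "w \<notin> cball 0 d" for w using \<rho>(3) that by (simp add: g_def)
  have cg: "continuous_on UNIV g" using smooth_with_continuous[OF g] .
  have c\<rho>: "continuous_on UNIV \<rho>"
  proof -
    have "continuous_on UNIV (\<lambda>z. Re (g z))" by (intro continuous_intros cg)
    then show ?thesis by (simp add: g_def)
  qed
  have [measurable]: "g \<in> borel_measurable borel" by (rule borel_measurable_continuous_onI[OF cg])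
  obtain C where C: "0 \<le> C" "\<And>z. cmod (g z) \<le> C" using smooth_withD(1)[OF g(1)] sup_boundedD by blast
  have ig: "integrable lborel (\<lambda>p. g (cx p))"
  proof (rule Bochner_Integration.integrable_bound[of lborel "\<lambda>p. C * indicator (cx -` ball 0 3) p :: real"])
    show "integrable lborel (\<lambda>p. C * indicator (cx -` ball 0 3) p :: real)"
      using L[of 0] cx_bounded_measurable[of "ball 0 3"] le_less_trans
      by (intro integrable_mult_right integrable_real_indicator) fastforce+
    have "cmod (g (cx p)) \<le> C * indicator (cx -` ball 0 3) p" for p
      using C g0[of "cx p"] d by (cases "cx p \<in> ball 0 3") auto
    then show "AE p in lborel. cmod (g (cx p)) \<le> norm (C * indicator (cx -` ball 0 3) p :: real)"
      using C(1) by (intro AE_I2) simp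
  qed measurable
  have q: "0 < q"
    unfolding q_def
  proof (rule integral_continuous_pos[of _ "(0, 0)"])
    have "integrable lborel (\<lambda>p. Re (g (cx p)))" using ig by simp
    then show "integrable lborel (\<lambda>p. \<rho> (cx p))" by (simp add: g_def)
    show "continuous_on UNIV (\<lambda>p. \<rho> (cx p))"
      by (rule continuous_on_compose2[OF c\<rho> continuous_cx]) auto
    have "cx (0, 0) = 0" by (simp add: complex_eq_iff)
    then show "0 < \<rho> (cx (0, 0))" using \<rho>(4) by simp
  qed (rule \<rho>(2))
  define \<eta> where "\<eta> z = inverse (of_real q) * conv (K z) g z" for z
  have const: "sup_bounded (\<lambda>w. c)" for c by (auto simp: sup_bounded_def)
  have "R (\<lambda>z. conv (K z) g z)" unfolding R_def using g g0 loc by blast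
  then have "smooth_with UNIV sup_bounded \<eta>"
    unfolding \<eta>_def[abs_def]
    by (rule smooth_with_cmult[OF Rsmooth open_UNIV local_on_sup_bounded sup_bounded_mult[OF const]])
  moreover have "\<eta> z = 1" if "ball z e \<subseteq> A" for z
  proof -
    have "conv (K z) g z = (\<integral>p. g (z - cx p) \<partial>lborel)"
      unfolding conv_def
    proof (rule Bochner_Integration.integral_cong)
      fix p
      show "g (z - cx p) * K z p = g (z - cx p)"
      proof (cases "d \<le> cmod (z - cx p)")
        case False
        then have "cx p \<in> A \<inter> ball z 3" using that d by (auto simp: dist_norm)
        then show ?thesis by (simp add: K_def)
      qed (use \<rho>(3) in \<open>simp add: g_def\<close>)
    qed simp
    also have "\<dots> = (\<integral>p. g (z - cx ((Re z, Im z) + (- 1) *\<^sub>R p)) \<partial>lborel)"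
      by (subst lborel_integral_affine[of "- 1" _ "(Re z, Im z)"]) auto
    also have "\<dots> = (\<integral>p. g (cx p) \<partial>lborel)"
    proof -
      have "z - cx ((Re z, Im z) + (- 1) *\<^sub>R p) = cx p" for p by (simp add: complex_eq_iff)
      then show ?thesis by simp
    qed
    also have "\<dots> = of_real q" by (simp add: q_def g_def)
    finally show ?thesis using q by (simp add: \<eta>_def)
  qed
  moreover have "\<eta> z = 0" if "ball z e \<inter> A = {}" for z
  proof -
    have "g (z - cx p) * K z p = 0" for p
    proof (cases "d \<le> cmod (z - cx p)")
      case False
      then have "cx p \<in> ball z e" using d by (simp add: dist_norm)
      then have "cx p \<notin> A" using that by blast
      then show ?thesis by (simp add: K_def)
    qed (use \<rho>(3) in \<open>simp add: g_def\<close>)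
    then have "conv (K z) g z = 0" unfolding conv_def by (simp only: Bochner_Integration.integral_zero)
    then show ?thesis by (simp add: \<eta>_def)
  qed
  ultimately show ?thesis by (rule that)
qed

section \<open>The Cauchy--Pompeiu formula\<close>

lemma integrable_lborel_prod:
  fixes u v :: "real \<Rightarrow> real"
  assumes u: "integrable lborel u" and v: "integrable lborel v"
  shows "integrable lborel (\<lambda>p. u (fst p) * v (snd p))"
proof -
  have [measurable]: "u \<in> borel_measurable borel" "v \<in> borel_measurable borel"
    using u v borel_measurable_integrable by fastforce+
  have "integrable (lborel \<Otimes>\<^sub>M lborel) (\<lambda>p. u (fst p) * v (snd p))"
  proof (rule lborel_pair.Fubini_integrable)
    show "(\<lambda>p. u (fst p) * v (snd p)) \<in> borel_measurable (lborel \<Otimes>\<^sub>M lborel)" by measurable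
    have "integrable lborel (\<lambda>x. \<bar>u x\<bar> * (\<integral>y. \<bar>v y\<bar> \<partial>lborel))" using u by (intro integrable_mult_left integrable_abs)
    then show "integrable lborel (\<lambda>x. \<integral>y. norm (u (fst (x, y)) * v (snd (x, y))) \<partial>lborel)"
      by (simp add: abs_mult)
    show "AE x in lborel. integrable lborel (\<lambda>y. u (fst (x, y)) * v (snd (x, y)))"
      using v by simp
  qed
  then show ?thesis by (simp add: lborel_prod)
qed

lemma integral_derivative_eq_0:
  fixes f f' :: "real \<Rightarrow> complex"
  assumes "\<And>x. (f has_vector_derivative f' x) (at x)" "continuous_on UNIV f'" "integrable lborel f'"
    "(f \<longlongrightarrow> 0) at_top" "(f \<longlongrightarrow> 0) at_bot"
  shows "integral\<^sup>L lborel f' = 0"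
proof -
  have e: "einterval (- \<infinity>) \<infinity> = UNIV" by (auto simp: einterval_def)
  have "(LBINT x=-\<infinity>..\<infinity>. f' x) = 0 - 0"
  proof (rule interval_integral_FTC_integrable)
    show "isCont f' x" for x using assms(2) continuous_on_eq_continuous_at[OF open_UNIV] by blast
    show "set_integrable lborel (einterval (- \<infinity>) \<infinity>) f'"
      using assms(3) by (simp add: e set_integrable_def)
    show "((f \<circ> real_of_ereal) \<longlongrightarrow> 0) (at_right (- \<infinity>))" "((f \<circ> real_of_ereal) \<longlongrightarrow> 0) (at_left \<infinity>)"
      using assms(4,5) by (simp_all add: ereal_tendsto_simps)
  qed (use assms(1) in auto)
  then show ?thesis by (simp add: interval_lebesgue_integral_def e set_lebesgue_integral_def)
qed

text \<open>The envelope \<open>1 / (1 + x\<^sup>2)\<close> on \<open>\<bar>y\<bar> \<le> R\<close> and the majorant \<open>sing x * sing y\<close> of \<open>1 / \<bar>z\<bar>\<close>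
  near the origin: both are products of integrable functions of one variable.\<close>

definition envelope :: "real \<Rightarrow> complex \<Rightarrow> real" where
  "envelope R z = inverse (1 + (Re z)\<^sup>2) * indicator {-R..R} (Im z)"

definition sing :: "real \<Rightarrow> real" where
  "sing t = indicator {0<..<1} \<bar>t\<bar> * (1 / sqrt \<bar>t\<bar>)"

lemma integrable_inverse_square: "integrable lborel (\<lambda>x::real. inverse (1 + x\<^sup>2))"
proof -
  have e: "einterval (- \<infinity>) \<infinity> = UNIV" by (auto simp: einterval_def)
  show ?thesis using integrable_inverse_1_plus_square by (simp add: e set_integrable_def)
qed

lemma integrable_envelope: "integrable lborel (\<lambda>p. envelope R (cx p))"
  unfolding envelope_def cx_simps
  by (intro integrable_lborel_prod[of "\<lambda>x. inverse (1 + x\<^sup>2)" "indicator {-R..R}"]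
      integrable_inverse_square integrable_real_indicator) (auto simp: emeasure_lborel_Icc_eq)

lemma integrable_sing: "integrable lborel sing"
proof -
  define s where "s t = indicator {0<..<1} t * (1 / sqrt t)" for t :: real
  have e: "einterval 0 1 = {0<..<1::real}" by (auto simp: einterval_def)
  have "set_integrable lborel (einterval 0 1) (\<lambda>t. 1 / sqrt t)"
  proof (rule interval_integral_FTC_nonneg(1)[of 0 1 "\<lambda>t. 2 * sqrt t" _ 0 2])
    fix x :: real assume "0 < ereal x" "ereal x < 1"
    then have x: "0 < x" by simp
    then show "((\<lambda>t. 2 * sqrt t) has_real_derivative 1 / sqrt x) (at x)"
      by (auto intro!: derivative_eq_intros simp: field_simps)
    show "isCont (\<lambda>t. 1 / sqrt t) x" using x by (intro continuous_intros) auto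
  next
    have 1: "((\<lambda>t. 2 * sqrt t) \<longlongrightarrow> 0) (at_right 0)" "((\<lambda>t. 2 * sqrt t) \<longlongrightarrow> 2) (at_left 1)"
      by (auto intro!: tendsto_eq_intros)
    then show "(((\<lambda>t. 2 * sqrt t) \<circ> real_of_ereal) \<longlongrightarrow> 0) (at_right 0)"
      "(((\<lambda>t. 2 * sqrt t) \<circ> real_of_ereal) \<longlongrightarrow> 2) (at_left 1)"
      unfolding zero_ereal_def one_ereal_def ereal_tendsto_simps1 by simp_all
  qed auto
  then have s: "integrable lborel s" by (simp add: e set_integrable_def s_def[abs_def])
  then have "integrable lborel (\<lambda>t. s (0 + (- 1) * t))" by (rule lborel_integrable_real_affine) simp
  with s have "integrable lborel (\<lambda>t. s t + s (0 + (- 1) * t))" by (rule Bochner_Integration.integrable_add)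
  moreover have "(\<lambda>t. s t + s (0 + (- 1) * t)) = sing"
    by (rule ext) (auto simp: s_def sing_def indicator_def abs_if)
  ultimately show ?thesis by simp
qed

lemma AE_cx_off_axes: "AE p in lborel. Re (cx p) \<noteq> 0 \<and> Im (cx p) \<noteq> 0"
proof -
  have "AE p :: real \<times> real in lborel. p \<bullet> (1, 0) \<noteq> 0" "AE p :: real \<times> real in lborel. p \<bullet> (0, 1) \<noteq> 0"
    by (rule AE_lborel_inner_neq, simp add: Basis_prod_def Basis_real_def image_iff)+
  then show ?thesis by eventually_elim (auto simp: inner_prod_def)
qed

text \<open>Outside the unit disc \<open>1 / \<bar>z\<bar> \<le> 1\<close>; inside,
  \<open>\<bar>x y\<bar> \<le> x\<^sup>2 + y\<^sup>2\<close> bounds \<open>\<bar>z\<bar>\<close>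
  below by the product of the two square roots. The axes are excluded because
  \<open>sing 0 = 0\<close>; they form a null set.\<close>

lemma envelope_over_z:
  assumes "Re z \<noteq> 0" "Im z \<noteq> 0"
  shows "envelope R z * inverse (cmod z) \<le> envelope R z + sing (Re z) * sing (Im z)"
proof -
  have e: "0 \<le> envelope R z" "envelope R z \<le> 1"
  proof -
    show "0 \<le> envelope R z" by (simp add: envelope_def indicator_def)
    have "inverse (1 + (Re z)\<^sup>2) * indicator {-R..R} (Im z) \<le> 1 * (1::real)"
      by (intro mult_mono) (auto simp: indicator_def inverse_eq_divide field_simps add_pos_nonneg)
    then show "envelope R z \<le> 1" by (simp add: envelope_def)
  qed
  have s0: "0 \<le> sing t" for t by (simp add: sing_def indicator_def)
  show ?thesis
  proof (cases "cmod z < 1")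
    case False
    then have "envelope R z * inverse (cmod z) \<le> envelope R z * 1"
      using e by (intro mult_left_mono) (auto simp: inverse_le_1_iff)
    then show ?thesis using s0[of "Re z"] s0[of "Im z"] by (simp add: add_increasing2)
  next
    case True
    then have lt: "\<bar>Re z\<bar> < 1" "\<bar>Im z\<bar> < 1"
      using abs_Re_le_cmod[of z] abs_Im_le_cmod[of z] by auto
    have "0 \<le> (\<bar>Re z\<bar> - \<bar>Im z\<bar>)\<^sup>2" by simp
    then have "2 * (\<bar>Re z\<bar> * \<bar>Im z\<bar>) \<le> (Re z)\<^sup>2 + (Im z)\<^sup>2"
      by (simp add: power2_eq_square algebra_simps)
    moreover have "0 \<le> \<bar>Re z\<bar> * \<bar>Im z\<bar>" by simp
    ultimately have "\<bar>Re z\<bar> * \<bar>Im z\<bar> \<le> (Re z)\<^sup>2 + (Im z)\<^sup>2" by linarith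
    then have "sqrt \<bar>Re z\<bar> * sqrt \<bar>Im z\<bar> \<le> cmod z"
      unfolding cmod_def by (simp flip: real_sqrt_mult)
    moreover have "0 < sqrt \<bar>Re z\<bar> * sqrt \<bar>Im z\<bar>" using assms by simp
    ultimately have "inverse (cmod z) \<le> inverse (sqrt \<bar>Re z\<bar> * sqrt \<bar>Im z\<bar>)"
      by (intro le_imp_inverse_le) auto
    also have "\<dots> = sing (Re z) * sing (Im z)"
      using assms lt by (simp add: sing_def inverse_eq_divide)
    finally have i: "inverse (cmod z) \<le> sing (Re z) * sing (Im z)" .
    have "envelope R z * inverse (cmod z) \<le> 1 * inverse (cmod z)"
      using e by (intro mult_right_mono) auto
    with i e(1) show ?thesis by linarith
  qed
qed

lemma integrable_envelope_over_z:
  assumes [measurable]: "k \<in> borel_measurable borel"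
    and b: "\<And>z. cmod (k z) \<le> C * (envelope R z * inverse (cmod z))" and C: "0 \<le> C"
  shows "integrable lborel (\<lambda>p. k (cx p) :: complex)"
proof (rule Bochner_Integration.integrable_bound)
  show "integrable lborel (\<lambda>p. C * (envelope R (cx p) + sing (fst p) * sing (snd p)))"
    by (intro integrable_mult_right Bochner_Integration.integrable_add integrable_envelope
        integrable_lborel_prod integrable_sing)
  show "(\<lambda>p. k (cx p)) \<in> borel_measurable lborel" by measurable
  show "AE p in lborel. cmod (k (cx p)) \<le> norm (C * (envelope R (cx p) + sing (fst p) * sing (snd p)))"
    using AE_cx_off_axes
  proof eventually_elim
    case (elim p)
    have "cmod (k (cx p)) \<le> C * (envelope R (cx p) * inverse (cmod (cx p)))" by (rule b)
    also have "\<dots> \<le> C * (envelope R (cx p) + sing (fst p) * sing (snd p))"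
      using envelope_over_z[of "cx p" R] elim C by (intro mult_left_mono) auto
    finally show ?case by simp
  qed
qed

lemma envelope_tendsto:
  assumes "\<And>z. cmod (\<Psi> z) \<le> C * envelope R z"
  shows "((\<lambda>x. \<Psi> (Complex x y)) \<longlongrightarrow> 0) at_top" "((\<lambda>x. \<Psi> (Complex x y)) \<longlongrightarrow> 0) at_bot"
    "((\<lambda>y. \<Psi> (Complex x y)) \<longlongrightarrow> 0) at_top" "((\<lambda>y. \<Psi> (Complex x y)) \<longlongrightarrow> 0) at_bot"
proof -
  have C: "0 \<le> \<bar>C\<bar> * envelope R z" for z by (simp add: envelope_def indicator_def)
  have le: "cmod (\<Psi> (Complex x y)) \<le> \<bar>C\<bar> * inverse (1 + x\<^sup>2)" for x y
  proof -
    have "cmod (\<Psi> (Complex x y)) \<le> C * envelope R (Complex x y)" by (rule assms)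
    also have "\<dots> \<le> \<bar>C\<bar> * envelope R (Complex x y)"
      by (intro mult_right_mono) (auto simp: envelope_def indicator_def)
    also have "\<dots> \<le> \<bar>C\<bar> * inverse (1 + x\<^sup>2)"
      by (intro mult_left_mono) (auto simp: envelope_def indicator_def)
    finally show ?thesis .
  qed
  have t: "((\<lambda>x::real. \<bar>C\<bar> * inverse (1 + x\<^sup>2)) \<longlongrightarrow> 0) at_top"
  proof (intro tendsto_mult_right_zero tendsto_inverse_0_at_top)
    show "filterlim (\<lambda>x::real. 1 + x\<^sup>2) at_top at_top"
      by (intro filterlim_tendsto_add_at_top[OF tendsto_const] filterlim_pow_at_top filterlim_ident) auto
  qed
  then have b: "((\<lambda>x::real. \<bar>C\<bar> * inverse (1 + x\<^sup>2)) \<longlongrightarrow> 0) at_bot"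
    by (simp add: filterlim_at_bot_mirror)
  show "((\<lambda>x. \<Psi> (Complex x y)) \<longlongrightarrow> 0) at_top"
    by (rule Lim_null_comparison[OF always_eventually t]) (use le in blast)
  show "((\<lambda>x. \<Psi> (Complex x y)) \<longlongrightarrow> 0) at_bot"
    by (rule Lim_null_comparison[OF always_eventually b]) (use le in blast)
  have z: "\<Psi> (Complex x y) = 0" if "R < \<bar>y\<bar>" for y
  proof -
    have "envelope R (Complex x y) = 0" using that by (auto simp: envelope_def indicator_def)
    then show ?thesis using assms[of "Complex x y"] by simp
  qed
  have "\<forall>\<^sub>F y in at_top. \<Psi> (Complex x y) = 0"
    using eventually_gt_at_top[of "\<bar>R\<bar>"] by eventually_elim (rule z, linarith)
  then show "((\<lambda>y. \<Psi> (Complex x y)) \<longlongrightarrow> 0) at_top" by (rule tendsto_eventually)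
  have "\<forall>\<^sub>F y in at_bot. \<Psi> (Complex x y) = 0"
    unfolding eventually_at_bot_linorder
    by (rule exI[of _ "- \<bar>R\<bar> - 1"]) (intro allI impI z, linarith)
  then show "((\<lambda>y. \<Psi> (Complex x y)) \<longlongrightarrow> 0) at_bot" by (rule tendsto_eventually)
qed

lemma integrable_of_envelope:
  assumes "continuous_on UNIV f" "\<And>z. cmod (f z) \<le> C * envelope R z"
  shows "integrable lborel (\<lambda>p. f (cx p))"
proof (rule Bochner_Integration.integrable_bound)
  show "integrable lborel (\<lambda>p. C * envelope R (cx p))" by (intro integrable_mult_right integrable_envelope)
  have [measurable]: "f \<in> borel_measurable borel" by (rule borel_measurable_continuous_onI[OF assms(1)])
  show "(\<lambda>p. f (cx p)) \<in> borel_measurable lborel" by measurable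
  show "AE p in lborel. cmod (f (cx p)) \<le> norm (C * envelope R (cx p))"
    using assms(2) by (intro AE_I2) (metis abs_ge_self order_trans real_norm_def)
qed

text \<open>Fubini, integrating first in the direction of differentiation. Almost every slice is
  integrable, and on it the fundamental theorem of calculus gives \<open>0\<close> since \<Psi>
  tends to \<open>0\<close> at both ends.\<close>

lemma integral_partials_eq_0:
  assumes d: "\<And>z. (\<Psi> has_derivative (\<lambda>h. Re h *\<^sub>R \<Psi>x z + Im h *\<^sub>R \<Psi>y z)) (at z)"
    and c: "continuous_on UNIV \<Psi>x" "continuous_on UNIV \<Psi>y"
    and b: "\<And>z. cmod (\<Psi> z) \<le> C * envelope R z" "\<And>z. cmod (\<Psi>x z) \<le> C * envelope R z"
      "\<And>z. cmod (\<Psi>y z) \<le> C * envelope R z"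
  shows "(\<integral>p. \<Psi>x (cx p) \<partial>lborel) = 0" "(\<integral>p. \<Psi>y (cx p) \<partial>lborel) = 0"
proof -
  have dx: "((\<lambda>x. \<Psi> (Complex x y)) has_vector_derivative \<Psi>x (Complex x y)) (at x)" for x y
  proof -
    have "((\<lambda>x. Complex x y) has_derivative (\<lambda>h. of_real h)) (at x)"
      unfolding Complex_eq by (auto intro!: derivative_eq_intros)
    from has_derivative_compose[OF this d] show ?thesis by (simp add: has_vector_derivative_def)
  qed
  have dy: "((\<lambda>y. \<Psi> (Complex x y)) has_vector_derivative \<Psi>y (Complex x y)) (at y)" for x y
  proof -
    have "((\<lambda>y. Complex x y) has_derivative (\<lambda>h. \<i> * of_real h)) (at y)"
      unfolding Complex_eq by (auto intro!: derivative_eq_intros)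
    from has_derivative_compose[OF this d] show ?thesis by (simp add: has_vector_derivative_def)
  qed
  have cc: "continuous_on UNIV (\<lambda>x. f (Complex x y))" "continuous_on UNIV (\<lambda>y. f (Complex x y))"
    if "continuous_on UNIV f" for f :: "complex \<Rightarrow> complex" and x y
    by (rule continuous_on_compose2[OF that]; force simp: Complex_eq intro: continuous_intros)+
  have int: "integrable (lborel \<Otimes>\<^sub>M lborel) (\<lambda>p. f (cx p))"
    if "continuous_on UNIV f" "\<And>z. cmod (f z) \<le> C * envelope R z" for f
    using integrable_of_envelope[OF that] by (simp add: lborel_prod)
  have "(\<integral>p. \<Psi>x (cx p) \<partial>lborel) = (\<integral>y. (\<integral>x. \<Psi>x (Complex x y) \<partial>lborel) \<partial>lborel)"
    using lborel_pair.integral_snd[of "\<lambda>x y. \<Psi>x (cx (x, y))"] int[OF c(1) b(2)]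
    by (simp add: lborel_prod cx_def case_prod_beta')
  also have "\<dots> = (\<integral>y. 0 \<partial>(lborel :: real measure))"
  proof (rule Bochner_Integration.integral_cong_AE)
    have "AE y in lborel. integrable lborel (\<lambda>x. \<Psi>x (Complex x y))"
      using lborel_pair.AE_integrable_snd[of "\<lambda>x y. \<Psi>x (cx (x, y))"] int[OF c(1) b(2)]
      by (simp add: cx_def case_prod_beta')
    then show "AE y in lborel. (\<integral>x. \<Psi>x (Complex x y) \<partial>lborel) = 0"
    proof eventually_elim
      case (elim y)
      show ?case by (rule integral_derivative_eq_0[OF dx cc(1)[OF c(1)] elim envelope_tendsto(1,2)[OF b(1)]])
    qed
    show "(\<lambda>y. \<integral>x. \<Psi>x (Complex x y) \<partial>lborel) \<in> borel_measurable lborel"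
      using lborel_pair.integrable_snd[of "\<lambda>x y. \<Psi>x (cx (x, y))"] int[OF c(1) b(2)]
      by (simp add: cx_def case_prod_beta' borel_measurable_integrable)
  qed simp
  finally show "(\<integral>p. \<Psi>x (cx p) \<partial>lborel) = 0" by simp
  have "(\<integral>p. \<Psi>y (cx p) \<partial>lborel) = (\<integral>x. (\<integral>y. \<Psi>y (Complex x y) \<partial>lborel) \<partial>lborel)"
    using lborel_pair.integral_fst'[OF int[OF c(2) b(3)]] by (simp add: lborel_prod cx_def)
  also have "\<dots> = (\<integral>x. 0 \<partial>(lborel :: real measure))"
  proof (rule Bochner_Integration.integral_cong_AE)
    have "AE x in lborel. integrable lborel (\<lambda>y. \<Psi>y (Complex x y))"
      using lborel_pair.AE_integrable_fst'[OF int[OF c(2) b(3)]] by (simp add: cx_def)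
    then show "AE x in lborel. (\<integral>y. \<Psi>y (Complex x y) \<partial>lborel) = 0"
    proof eventually_elim
      case (elim x)
      show ?case by (rule integral_derivative_eq_0[OF dy cc(2)[OF c(2)] elim envelope_tendsto(3,4)[OF b(1)]])
    qed
    show "(\<lambda>x. \<integral>y. \<Psi>y (Complex x y) \<partial>lborel) \<in> borel_measurable lborel"
      using lborel_pair.integrable_fst'[OF int[OF c(2) b(3)]] by (simp add: cx_def borel_measurable_integrable)
  qed simp
  finally show "(\<integral>p. \<Psi>y (cx p) \<partial>lborel) = 0" by simp
qed

text \<open>The constant is \<open>pi\<close>; only its positivity matters.\<close>

definition \<kappa> :: real where
  "\<kappa> = (\<integral>p. inverse ((1 + (cmod (cx p))\<^sup>2)\<^sup>2) \<partial>lborel)"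

lemma integrable_\<kappa>: "integrable lborel (\<lambda>p. inverse ((1 + (cmod (cx p))\<^sup>2)\<^sup>2))"
proof (rule Bochner_Integration.integrable_bound)
  show "integrable lborel (\<lambda>p::real \<times> real. inverse (1 + (fst p)\<^sup>2) * inverse (1 + (snd p)\<^sup>2))"
    by (intro integrable_lborel_prod[of "\<lambda>x. inverse (1 + x\<^sup>2)" "\<lambda>x. inverse (1 + x\<^sup>2)"] integrable_inverse_square)
  show "(\<lambda>p. inverse ((1 + (cmod (cx p))\<^sup>2)\<^sup>2)) \<in> borel_measurable lborel" by measurable
  have "inverse ((1 + (cmod (cx p))\<^sup>2)\<^sup>2) \<le> inverse (1 + (fst p)\<^sup>2) * inverse (1 + (snd p)\<^sup>2)" for p
  proof -
    have "(1 + (fst p)\<^sup>2) * (1 + (snd p)\<^sup>2) \<le> (1 + (cmod (cx p))\<^sup>2) * (1 + (cmod (cx p))\<^sup>2)"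
      by (intro mult_mono) (auto simp: cmod_power2)
    moreover have "0 < (1 + (fst p)\<^sup>2) * (1 + (snd p)\<^sup>2)"
      by (intro mult_pos_pos add_pos_nonneg) auto
    ultimately have "inverse ((1 + (cmod (cx p))\<^sup>2) * (1 + (cmod (cx p))\<^sup>2)) \<le> inverse ((1 + (fst p)\<^sup>2) * (1 + (snd p)\<^sup>2))"
      by (intro le_imp_inverse_le)
    then show ?thesis by (simp add: power2_eq_square)
  qed
  then show "AE p in lborel. norm (inverse ((1 + (cmod (cx p))\<^sup>2)\<^sup>2))
      \<le> norm (inverse (1 + (fst p)\<^sup>2) * inverse (1 + (snd p)\<^sup>2))"
    by (intro AE_I2) (simp add: add_nonneg_nonneg)
qed

lemma \<kappa>_pos: "0 < \<kappa>"
  unfolding \<kappa>_def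
proof (rule integral_continuous_pos[OF integrable_\<kappa>, of "(0, 0)"])
  have ne: "1 + (cmod (cx p))\<^sup>2 \<noteq> 0" for p by (metis add_pos_nonneg less_irrefl zero_le_power2 zero_less_one)
  show "continuous_on UNIV (\<lambda>p. inverse ((1 + (cmod (cx p))\<^sup>2)\<^sup>2))"
    using ne by (intro continuous_intros continuous_cx) auto
  show "0 < inverse ((1 + (cmod (cx (0, 0)))\<^sup>2)\<^sup>2)" using ne[of "(0, 0)"] by simp
qed simp

text \<open>A smooth approximation of \<open>1 / z\<close> whose Cauchy-Riemann derivative is an approximate
  identity (up to the factor \<open>\<kappa>\<close>).\<close>

definition regker :: "real \<Rightarrow> complex \<Rightarrow> complex" where
  "regker e z = cnj z * of_real (inverse ((cmod z)\<^sup>2 + e\<^sup>2))"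

definition regker_x :: "real \<Rightarrow> complex \<Rightarrow> complex" where
  "regker_x e z = of_real (inverse ((cmod z)\<^sup>2 + e\<^sup>2))
     - cnj z * of_real (2 * Re z * (inverse ((cmod z)\<^sup>2 + e\<^sup>2))\<^sup>2)"

definition regker_y :: "real \<Rightarrow> complex \<Rightarrow> complex" where
  "regker_y e z = - \<i> * of_real (inverse ((cmod z)\<^sup>2 + e\<^sup>2))
     - cnj z * of_real (2 * Im z * (inverse ((cmod z)\<^sup>2 + e\<^sup>2))\<^sup>2)"

context
  fixes e :: real
  assumes e: "0 < e"
begin

lemma regker_den: "0 < (cmod z)\<^sup>2 + e\<^sup>2" "e\<^sup>2 \<le> (cmod z)\<^sup>2 + e\<^sup>2"
  using e by (auto simp: add_nonneg_pos)

lemma has_derivative_regker: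
  "(regker e has_derivative (\<lambda>h. Re h *\<^sub>R regker_x e z + Im h *\<^sub>R regker_y e z)) (at z)"
proof -
  define q where "q z = (Re z)\<^sup>2 + (Im z)\<^sup>2 + e\<^sup>2" for z
  have q: "(cmod z)\<^sup>2 + e\<^sup>2 = q z" for z by (simp add: q_def cmod_power2)
  have q0: "q z \<noteq> 0" using regker_den(1)[of z] unfolding q by simp
  have "(q has_derivative (\<lambda>h. 2 * Re z * Re h + 2 * Im z * Im h)) (at z)"
    unfolding q_def[abs_def] by (auto intro!: derivative_eq_intros)
  then have "((\<lambda>z. inverse (q z)) has_derivative
      (\<lambda>h. - (inverse (q z) * (2 * Re z * Re h + 2 * Im z * Im h) * inverse (q z)))) (at z)"
    by (rule Deriv.has_derivative_inverse[where f = q and x = z, OF q0])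
  then have "((\<lambda>z. cnj z * complex_of_real (inverse (q z))) has_derivative
      (\<lambda>h. cnj z * of_real (- (inverse (q z) * (2 * Re z * Re h + 2 * Im z * Im h) * inverse (q z)))
        + cnj h * of_real (inverse (q z)))) (at z)"
    by (intro has_derivative_mult has_derivative_of_real has_derivative_cnj has_derivative_ident)
  moreover define i where "i = inverse (q z)"
  moreover have "regker_x e z = of_real i - cnj z * of_real (2 * Re z * i\<^sup>2)"
    "regker_y e z = - \<i> * of_real i - cnj z * of_real (2 * Im z * i\<^sup>2)"
    by (simp_all add: regker_x_def regker_y_def q i_def)
  moreover have "regker e = (\<lambda>z. cnj z * complex_of_real (inverse (q z)))"
    by (rule ext) (simp add: regker_def q)
  moreover have "(\<lambda>h. cnj z * of_real (- (i * (2 * Re z * Re h + 2 * Im z * Im h) * i)) + cnj h * of_real i)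
    = (\<lambda>h. Re h *\<^sub>R (of_real i - cnj z * of_real (2 * Re z * i\<^sup>2))
      + Im h *\<^sub>R (- \<i> * of_real i - cnj z * of_real (2 * Im z * i\<^sup>2)))"
    by (rule ext) (simp add: complex_eq_iff power2_eq_square algebra_simps)
  ultimately show ?thesis by simp
qed

lemma continuous_regker: "continuous_on UNIV (regker e)" "continuous_on UNIV (regker_x e)"
  "continuous_on UNIV (regker_y e)"
proof -
  have "(cmod z)\<^sup>2 + e\<^sup>2 \<noteq> 0" for z using regker_den(1)[of z] by linarith
  then show "continuous_on UNIV (regker e)" "continuous_on UNIV (regker_x e)"
    "continuous_on UNIV (regker_y e)"
    unfolding regker_def[abs_def] regker_x_def[abs_def] regker_y_def[abs_def]
    by (intro continuous_intros; blast)+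
qed

text \<open>Under the substitution \<open>z = e w\<close>, with Jacobian \<open>e\<^sup>2\<close>,
  the right-hand side becomes \<open>1 / (1 + \<bar>w\<bar>\<^sup>2)\<^sup>2\<close>. Its integral
  is thus \<kappa> for every \<open>e\<close>.\<close>

lemma cauchy_riemann_regker:
  "1/2 * (regker_x e z + \<i> * regker_y e z) = of_real (e\<^sup>2 * (inverse ((cmod z)\<^sup>2 + e\<^sup>2))\<^sup>2)"
proof -
  define D where "D = (cmod z)\<^sup>2 + e\<^sup>2"
  have D: "D \<noteq> 0" using regker_den(1)[of z] unfolding D_def by linarith
  have "1/2 * (regker_x e z + \<i> * regker_y e z)
      = of_real (inverse D) - (cnj z * z) * of_real ((inverse D)\<^sup>2)"
    unfolding regker_x_def regker_y_def D_def[symmetric] by (simp add: complex_eq_iff algebra_simps)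
  also have "cnj z * z = of_real (D - e\<^sup>2)"
    by (simp only: D_def add_diff_cancel_right' complex_norm_square mult.commute[of "cnj z" z])
  also have "of_real (inverse D) - of_real (D - e\<^sup>2) * of_real ((inverse D)\<^sup>2)
      = complex_of_real (inverse D - (D - e\<^sup>2) * (inverse D)\<^sup>2)" by simp
  also have "inverse D - (D - e\<^sup>2) * (inverse D)\<^sup>2 = e\<^sup>2 * (inverse D)\<^sup>2"
    using D by (simp add: power2_eq_square field_simps)
  finally show ?thesis by (simp add: D_def)
qed

lemma regker_le_inverse: "cmod (regker e z) \<le> inverse (cmod z)"
proof (cases "z = 0")
  case False
  have "inverse ((cmod z)\<^sup>2 + e\<^sup>2) \<le> inverse ((cmod z)\<^sup>2)"
    using False by (intro le_imp_inverse_le) auto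
  then have "cmod z * inverse ((cmod z)\<^sup>2 + e\<^sup>2) \<le> cmod z * inverse ((cmod z)\<^sup>2)"
    by (rule mult_left_mono) simp
  also have "\<dots> = inverse (cmod z)" using False by (simp add: power2_eq_square)
  finally show ?thesis using regker_den(1)[of z] by (simp add: regker_def norm_mult norm_inverse del: of_real_inverse)
qed (simp add: regker_def)

text \<open>The bound depends on \<open>e\<close> and serves the integration by parts for fixed
  \<open>e\<close>; the limit uses \<open>regker_le_inverse\<close>, which is uniform in
  \<open>e\<close>.\<close>

lemma regker_bounded: "\<exists>M\<ge>0. \<forall>z. cmod (regker e z) \<le> M \<and> cmod (regker_x e z) \<le> M \<and> cmod (regker_y e z) \<le> M"
proof -
  define i where "i z = inverse ((cmod z)\<^sup>2 + e\<^sup>2)" for z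
  have i: "0 < i z" "i z \<le> inverse (e\<^sup>2)" for z
    using regker_den[of z] e by (auto simp: i_def intro: le_imp_inverse_le)
  have zi: "(cmod z)\<^sup>2 * i z \<le> 1" for z
    using regker_den(1)[of z] by (simp add: i_def field_simps)
  have 1: "cmod (regker e z) \<le> 1 + inverse (e\<^sup>2)" for z
  proof -
    have "0 \<le> (cmod z - 1)\<^sup>2" by simp
    then have "2 * cmod z \<le> (cmod z)\<^sup>2 + 1" by (simp add: power2_eq_square algebra_simps)
    then have "cmod z \<le> (cmod z)\<^sup>2 + 1" using norm_ge_zero[of z] by linarith
    then have "cmod z * i z \<le> ((cmod z)\<^sup>2 + 1) * i z" using i by (intro mult_right_mono) (auto intro: less_imp_le)
    also have "\<dots> \<le> 1 + inverse (e\<^sup>2)" using zi[of z] i(2)[of z] by (simp add: distrib_right)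
    finally show ?thesis using i(1)[of z] by (simp add: regker_def norm_mult i_def[symmetric] del: of_real_inverse)
  qed
  have 2: "i z + cmod z * (2 * cmod z * (i z)\<^sup>2) \<le> 3 * inverse (e\<^sup>2)" for z
  proof -
    have "cmod z * (2 * cmod z * (i z)\<^sup>2) = 2 * i z * ((cmod z)\<^sup>2 * i z)" by (simp add: power2_eq_square)
    also have "\<dots> \<le> 2 * i z * 1" using zi[of z] i(1)[of z] by (intro mult_left_mono) auto
    finally show ?thesis using i(2)[of z] by simp
  qed
  have r: "cmod (cnj z * of_real (2 * t * (i z)\<^sup>2)) \<le> cmod z * (2 * cmod z * (i z)\<^sup>2)"
    if "\<bar>t\<bar> \<le> cmod z" for z t
  proof -
    have "cmod (cnj z * of_real (2 * t * (i z)\<^sup>2)) = cmod z * (2 * \<bar>t\<bar> * (i z)\<^sup>2)"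
      unfolding norm_mult norm_of_real by (simp add: abs_mult)
    also have "\<dots> \<le> cmod z * (2 * cmod z * (i z)\<^sup>2)" using that by (intro mult_left_mono mult_right_mono) auto
    finally show ?thesis .
  qed
  have x: "cmod (regker_x e z) \<le> 3 * inverse (e\<^sup>2)" for z
  proof -
    have "cmod (regker_x e z) \<le> cmod (of_real (i z)) + cmod (cnj z * of_real (2 * Re z * (i z)\<^sup>2))"
      unfolding regker_x_def i_def by (rule norm_triangle_ineq4)
    also have "cmod (complex_of_real (i z)) = i z" using i(1)[of z] by simp
    finally show ?thesis using r[OF abs_Re_le_cmod[of z]] 2[of z] by linarith
  qed
  have y: "cmod (regker_y e z) \<le> 3 * inverse (e\<^sup>2)" for z
  proof -
    have "cmod (regker_y e z) \<le> cmod (- \<i> * of_real (i z)) + cmod (cnj z * of_real (2 * Im z * (i z)\<^sup>2))"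
      unfolding regker_y_def i_def by (rule norm_triangle_ineq4)
    also have "cmod (- \<i> * complex_of_real (i z)) = i z" using i(1)[of z] by (simp add: norm_mult)
    finally show ?thesis using r[OF abs_Im_le_cmod[of z]] 2[of z] by linarith
  qed
  show ?thesis
  proof (intro exI[of _ "1 + 3 * inverse (e\<^sup>2)"] conjI allI)
    have p: "0 < inverse (e\<^sup>2)" using e by simp
    then show "0 \<le> 1 + 3 * inverse (e\<^sup>2)" by simp
    fix z show "cmod (regker e z) \<le> 1 + 3 * inverse (e\<^sup>2)" "cmod (regker_x e z) \<le> 1 + 3 * inverse (e\<^sup>2)"
      "cmod (regker_y e z) \<le> 1 + 3 * inverse (e\<^sup>2)"
      using 1[of z] x[of z] y[of z] p by linarith+
  qed
qed

end

lemma envelope_nonneg: "0 \<le> envelope R z"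
  by (simp add: envelope_def indicator_def)

lemma mult_envelope_le:
  assumes "cmod a \<le> C * envelope R z" "cmod b \<le> M" "0 \<le> M"
  shows "cmod (a * b) \<le> (C * M) * envelope R z"
proof -
  have "cmod (a * b) \<le> (C * envelope R z) * M"
    unfolding norm_mult by (rule mult_mono[OF assms(1,2)]) (use assms(1) norm_ge_zero order_trans in \<open>blast+\<close>)
  then show ?thesis by (simp add: mult_ac)
qed

context
  fixes \<psi> \<psi>x \<psi>y :: "complex \<Rightarrow> complex" and C R :: real
  assumes d\<psi>: "\<And>z. (\<psi> has_derivative (\<lambda>h. Re h *\<^sub>R \<psi>x z + Im h *\<^sub>R \<psi>y z)) (at z)"
    and c\<psi>: "continuous_on UNIV \<psi>x" "continuous_on UNIV \<psi>y"
    and b\<psi>: "\<And>z. cmod (\<psi> z) \<le> C * envelope R z" "\<And>z. cmod (\<psi>x z) \<le> C * envelope R z"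
      "\<And>z. cmod (\<psi>y z) \<le> C * envelope R z"
begin

lemma continuous_\<psi>: "continuous_on UNIV \<psi>"
proof -
  have "continuous (at z) \<psi>" for z using has_derivative_continuous[OF d\<psi>] .
  then show ?thesis by (simp add: continuous_at_imp_continuous_on)
qed

text \<open>Integration by parts: the Cauchy--Riemann derivative of the product of \<psi> and
  \<open>regker e\<close> has integral \<open>0\<close>.\<close>

lemma integral_regker_eq:
  assumes e: "0 < e"
  shows "(\<integral>p. 1/2 * (\<psi>x (cx p) + \<i> * \<psi>y (cx p)) * regker e (cx p) \<partial>lborel)
    = - (\<integral>p. \<psi> (cx p) * of_real (e\<^sup>2 * (inverse ((cmod (cx p))\<^sup>2 + e\<^sup>2))\<^sup>2) \<partial>lborel)"
proof -
  obtain M where M0: "0 \<le> M" and M: "\<And>z. cmod (regker e z) \<le> M" "\<And>z. cmod (regker_x e z) \<le> M"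
    "\<And>z. cmod (regker_y e z) \<le> M" using regker_bounded[OF e] by blast
  define \<Psi>x where "\<Psi>x z = \<psi>x z * regker e z + \<psi> z * regker_x e z" for z
  define \<Psi>y where "\<Psi>y z = \<psi>y z * regker e z + \<psi> z * regker_y e z" for z
  note cont = continuous_regker[OF e] c\<psi> continuous_\<psi>
  have b1: "cmod (\<psi> z * regker e z) \<le> (C * M) * envelope R z"
    "cmod (\<psi>x z * regker e z) \<le> (C * M) * envelope R z" "cmod (\<psi>y z * regker e z) \<le> (C * M) * envelope R z"
    "cmod (\<psi> z * regker_x e z) \<le> (C * M) * envelope R z" "cmod (\<psi> z * regker_y e z) \<le> (C * M) * envelope R z" for z
    by (rule mult_envelope_le, rule b\<psi>, rule M, rule M0)+
  have 0: "0 \<le> (C * M) * envelope R z" for z using b1(1)[of z] norm_ge_zero order_trans by blast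
  have p1: "((\<lambda>z. \<psi> z * regker e z) has_derivative (\<lambda>h. Re h *\<^sub>R \<Psi>x z + Im h *\<^sub>R \<Psi>y z)) (at z)" for z
    by (rule has_derivative_eq_rhs[OF has_derivative_mult[OF d\<psi> has_derivative_regker[OF e]]])
      (auto simp: \<Psi>x_def \<Psi>y_def algebra_simps)
  have p2: "continuous_on UNIV \<Psi>x" "continuous_on UNIV \<Psi>y"
    unfolding \<Psi>x_def[abs_def] \<Psi>y_def[abs_def] by (intro continuous_intros cont)+
  have p3: "cmod (\<psi> z * regker e z) \<le> 2 * (C * M) * envelope R z" for z using b1(1)[of z] 0[of z] by linarith
  have p4: "cmod (\<Psi>x z) \<le> 2 * (C * M) * envelope R z" for z
    unfolding \<Psi>x_def using norm_triangle_ineq[of "\<psi>x z * regker e z" "\<psi> z * regker_x e z"] b1[of z] by linarith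
  have p5: "cmod (\<Psi>y z) \<le> 2 * (C * M) * envelope R z" for z
    unfolding \<Psi>y_def using norm_triangle_ineq[of "\<psi>y z * regker e z" "\<psi> z * regker_y e z"] b1[of z] by linarith
  note * = integral_partials_eq_0[OF p1 p2 p3 p4 p5]
  have I: "integrable lborel (\<lambda>p. \<psi>x (cx p) * regker e (cx p))" "integrable lborel (\<lambda>p. \<psi>y (cx p) * regker e (cx p))"
    "integrable lborel (\<lambda>p. \<psi> (cx p) * regker_x e (cx p))" "integrable lborel (\<lambda>p. \<psi> (cx p) * regker_y e (cx p))"
    by (rule integrable_of_envelope[OF _ b1(2)] integrable_of_envelope[OF _ b1(3)]
        integrable_of_envelope[OF _ b1(4)] integrable_of_envelope[OF _ b1(5)], intro continuous_intros cont)+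
  have "0 = 1/2 * ((\<integral>p. \<Psi>x (cx p) \<partial>lborel) + \<i> * (\<integral>p. \<Psi>y (cx p) \<partial>lborel))" by (simp add: *)
  also have "\<dots> = (\<integral>p. 1/2 * (\<Psi>x (cx p) + \<i> * \<Psi>y (cx p)) \<partial>lborel)"
    unfolding \<Psi>x_def \<Psi>y_def using I by simp
  also have "\<dots> = (\<integral>p. 1/2 * (\<psi>x (cx p) + \<i> * \<psi>y (cx p)) * regker e (cx p)
      + \<psi> (cx p) * (1/2 * (regker_x e (cx p) + \<i> * regker_y e (cx p))) \<partial>lborel)"
    by (intro Bochner_Integration.integral_cong) (simp_all add: \<Psi>x_def \<Psi>y_def algebra_simps)
  also have "\<dots> = (\<integral>p. 1/2 * (\<psi>x (cx p) + \<i> * \<psi>y (cx p)) * regker e (cx p) \<partial>lborel)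
      + (\<integral>p. \<psi> (cx p) * (1/2 * (regker_x e (cx p) + \<i> * regker_y e (cx p))) \<partial>lborel)"
  proof (rule Bochner_Integration.integral_add)
    have "integrable lborel (\<lambda>p. 1/2 * (\<psi>x (cx p) * regker e (cx p) + \<i> * (\<psi>y (cx p) * regker e (cx p))))"
      using I by (intro integrable_mult_right Bochner_Integration.integrable_add)
    then show "integrable lborel (\<lambda>p. 1/2 * (\<psi>x (cx p) + \<i> * \<psi>y (cx p)) * regker e (cx p))"
      by (simp add: algebra_simps)
    have "integrable lborel (\<lambda>p. 1/2 * (\<psi> (cx p) * regker_x e (cx p) + \<i> * (\<psi> (cx p) * regker_y e (cx p))))"
      using I by (intro integrable_mult_right Bochner_Integration.integrable_add)
    then show "integrable lborel (\<lambda>p. \<psi> (cx p) * (1/2 * (regker_x e (cx p) + \<i> * regker_y e (cx p))))"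
      by (simp add: algebra_simps)
  qed
  finally show ?thesis unfolding cauchy_riemann_regker[OF e] by (simp add: eq_neg_iff_add_eq_0)
qed

text \<open>The limit \<open>e\<close> to \<open>0\<close> of the preceding identity. On the left,
  the integrable majorant of \<open>envelope / \<bar>z\<bar>\<close> dominates; on the right,
  rescaling by \<open>e\<close> turns the integrand into
  \<open>\<psi> (e w) / (1 + \<bar>w\<bar>\<^sup>2)\<^sup>2\<close>, which converges to
  \<open>\<psi> 0\<close> times the density defining \<kappa>.\<close>

lemma pompeiu:
  "(\<integral>p. 1/2 * (\<psi>x (cx p) + \<i> * \<psi>y (cx p)) * inverse (cx p) \<partial>lborel) = - of_real \<kappa> * \<psi> 0"
proof -
  define \<epsilon> where "\<epsilon> n = 1 / (real n + 1)" for n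
  have \<epsilon>: "0 < \<epsilon> n" for n by (simp add: \<epsilon>_def)
  have \<epsilon>0: "\<epsilon> \<longlonglongrightarrow> 0"
    unfolding \<epsilon>_def[abs_def] using LIMSEQ_inverse_real_of_nat by (simp add: inverse_eq_divide add.commute)
  define g where "g z = 1/2 * (\<psi>x z + \<i> * \<psi>y z)" for z
  have cg: "continuous_on UNIV g" unfolding g_def[abs_def] by (intro continuous_intros c\<psi>)
  have [measurable]: "g \<in> borel_measurable borel" "\<psi> \<in> borel_measurable borel"
    using cg continuous_\<psi> by (auto intro: borel_measurable_continuous_onI)
  have [measurable]: "regker (\<epsilon> n) \<in> borel_measurable borel" for n
    using continuous_regker(1)[OF \<epsilon>] by (rule borel_measurable_continuous_onI)
  have gb: "cmod (g z) \<le> C * envelope R z" for z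
  proof -
    have "cmod (g z) \<le> (cmod (\<psi>x z) + cmod (\<psi>y z)) / 2"
      unfolding g_def norm_mult using norm_triangle_ineq[of "\<psi>x z" "\<i> * \<psi>y z"] by (simp add: norm_mult)
    moreover have "a \<le> d" if "a \<le> (b + c) / 2" "b \<le> d" "c \<le> d" for a b c d :: real
      using that by simp
    ultimately show ?thesis using b\<psi>(2,3)[of z] by blast
  qed
  have lim1: "(\<lambda>n. \<integral>p. g (cx p) * regker (\<epsilon> n) (cx p) \<partial>lborel)
      \<longlonglongrightarrow> (\<integral>p. g (cx p) * inverse (cx p) \<partial>lborel)"
  proof (rule integral_dominated_convergence)
    show "integrable lborel (\<lambda>p. \<bar>C\<bar> * (envelope R (cx p) + sing (fst p) * sing (snd p)))"
      by (intro integrable_mult_right Bochner_Integration.integrable_add integrable_envelope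
          integrable_lborel_prod integrable_sing)
    show "AE p in lborel. cmod (g (cx p) * regker (\<epsilon> n) (cx p)) \<le> \<bar>C\<bar> * (envelope R (cx p) + sing (fst p) * sing (snd p))" for n
      using AE_cx_off_axes
    proof eventually_elim
      case (elim p)
      have "cmod (g (cx p) * regker (\<epsilon> n) (cx p)) \<le> (\<bar>C\<bar> * envelope R (cx p)) * inverse (cmod (cx p))"
        unfolding norm_mult
      proof (rule mult_mono)
        have "C * envelope R (cx p) \<le> \<bar>C\<bar> * envelope R (cx p)" by (intro mult_right_mono envelope_nonneg) simp
        with gb[of "cx p"] show "cmod (g (cx p)) \<le> \<bar>C\<bar> * envelope R (cx p)" by linarith
        show "cmod (regker (\<epsilon> n) (cx p)) \<le> inverse (cmod (cx p))" by (rule regker_le_inverse[OF \<epsilon>])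
      qed (auto simp: envelope_nonneg)
      also have "\<dots> = \<bar>C\<bar> * (envelope R (cx p) * inverse (cmod (cx p)))" by simp
      also have "\<dots> \<le> \<bar>C\<bar> * (envelope R (cx p) + sing (fst p) * sing (snd p))"
        using envelope_over_z[of "cx p" R] elim by (intro mult_left_mono) auto
      finally show ?case .
    qed
    have "(\<lambda>n. regker (\<epsilon> n) z) \<longlonglongrightarrow> inverse z" for z
    proof (cases "z = 0")
      case False
      have "(\<lambda>n. regker (\<epsilon> n) z) \<longlonglongrightarrow> cnj z * of_real (inverse ((cmod z)\<^sup>2 + 0\<^sup>2))"
        unfolding regker_def using False by (intro tendsto_intros \<epsilon>0) auto
      also have "cnj z * of_real (inverse ((cmod z)\<^sup>2 + 0\<^sup>2)) = inverse z"
        using False by (simp add: complex_norm_square field_simps del: of_real_power)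
      finally show ?thesis .
    qed (simp add: regker_def)
    then show "AE p in lborel. (\<lambda>n. g (cx p) * regker (\<epsilon> n) (cx p)) \<longlonglongrightarrow> g (cx p) * inverse (cx p)"
      by (intro AE_I2 tendsto_intros)
  qed measurable
  have scale: "(\<integral>p. \<psi> (cx p) * of_real ((\<epsilon> n)\<^sup>2 * (inverse ((cmod (cx p))\<^sup>2 + (\<epsilon> n)\<^sup>2))\<^sup>2) \<partial>lborel)
      = (\<integral>p. \<psi> (of_real (\<epsilon> n) * cx p) * of_real (inverse ((1 + (cmod (cx p))\<^sup>2)\<^sup>2)) \<partial>lborel)" for n
  proof -
    let ?f = "\<lambda>p. \<psi> (cx p) * of_real ((\<epsilon> n)\<^sup>2 * (inverse ((cmod (cx p))\<^sup>2 + (\<epsilon> n)\<^sup>2))\<^sup>2)"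
    have cxs: "cx (0 + \<epsilon> n *\<^sub>R p) = of_real (\<epsilon> n) * cx p" for p by (simp add: complex_eq_iff)
    have "integral\<^sup>L lborel ?f = (\<epsilon> n)\<^sup>2 *\<^sub>R (\<integral>p. ?f (0 + \<epsilon> n *\<^sub>R p) \<partial>lborel)"
      using \<epsilon>[of n] by (subst lborel_integral_affine[of "\<epsilon> n" ?f 0]) (auto simp: power2_eq_square)
    also have "\<dots> = (\<integral>p. (\<epsilon> n)\<^sup>2 *\<^sub>R ?f (0 + \<epsilon> n *\<^sub>R p) \<partial>lborel)" by simp
    also have "\<dots> = (\<integral>p. \<psi> (of_real (\<epsilon> n) * cx p) * of_real (inverse ((1 + (cmod (cx p))\<^sup>2)\<^sup>2)) \<partial>lborel)"
    proof (rule Bochner_Integration.integral_cong)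
      fix p
      define t where "t = 1 + (cmod (cx p))\<^sup>2"
      have t: "t \<noteq> 0" unfolding t_def by (metis add_pos_nonneg less_irrefl zero_le_power2 zero_less_one)
      have "(cmod (of_real (\<epsilon> n) * cx p))\<^sup>2 + (\<epsilon> n)\<^sup>2 = (\<epsilon> n)\<^sup>2 * t"
        by (simp add: t_def norm_mult power_mult_distrib algebra_simps)
      then have "(\<epsilon> n)\<^sup>2 * ((\<epsilon> n)\<^sup>2 * (inverse ((cmod (of_real (\<epsilon> n) * cx p))\<^sup>2 + (\<epsilon> n)\<^sup>2))\<^sup>2) = inverse (t\<^sup>2)"
        using \<epsilon>[of n] t by (simp add: field_simps power2_eq_square)
      then show "(\<epsilon> n)\<^sup>2 *\<^sub>R ?f (0 + \<epsilon> n *\<^sub>R p) = \<psi> (of_real (\<epsilon> n) * cx p) * of_real (inverse ((1 + (cmod (cx p))\<^sup>2)\<^sup>2))"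
        unfolding cxs t_def[symmetric] scaleR_conv_of_real by (metis mult.left_commute of_real_mult)
    qed simp
    finally show ?thesis .
  qed
  have lim2: "(\<lambda>n. \<integral>p. \<psi> (of_real (\<epsilon> n) * cx p) * of_real (inverse ((1 + (cmod (cx p))\<^sup>2)\<^sup>2)) \<partial>lborel)
      \<longlonglongrightarrow> (\<integral>p. \<psi> 0 * of_real (inverse ((1 + (cmod (cx p))\<^sup>2)\<^sup>2)) \<partial>lborel)"
  proof (rule integral_dominated_convergence)
    show "integrable lborel (\<lambda>p. \<bar>C\<bar> * inverse ((1 + (cmod (cx p))\<^sup>2)\<^sup>2))"
      by (intro integrable_mult_right integrable_\<kappa>)
    have "cmod (\<psi> z) \<le> \<bar>C\<bar>" for z
    proof -
      have "inverse (1 + (Re z)\<^sup>2) * indicator {-R..R} (Im z) \<le> 1 * (1::real)"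
        by (intro mult_mono) (auto simp: indicator_def inverse_le_1_iff)
      then have "\<bar>C\<bar> * envelope R z \<le> \<bar>C\<bar> * 1" by (intro mult_left_mono) (auto simp: envelope_def)
      moreover have "C * envelope R z \<le> \<bar>C\<bar> * envelope R z" by (intro mult_right_mono envelope_nonneg) simp
      ultimately show ?thesis using b\<psi>(1)[of z] by linarith
    qed
    then show "AE p in lborel. cmod (\<psi> (of_real (\<epsilon> n) * cx p) * of_real (inverse ((1 + (cmod (cx p))\<^sup>2)\<^sup>2)))
        \<le> \<bar>C\<bar> * inverse ((1 + (cmod (cx p))\<^sup>2)\<^sup>2)" for n
      unfolding norm_mult norm_of_real by (intro AE_I2 mult_mono) auto
    have "(\<lambda>n. \<psi> (of_real (\<epsilon> n) * z)) \<longlonglongrightarrow> \<psi> 0" for z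
    proof -
      have "(\<lambda>n. of_real (\<epsilon> n) * z) \<longlonglongrightarrow> of_real 0 * z" by (intro tendsto_intros \<epsilon>0)
      then show ?thesis
        using continuous_\<psi> continuous_on_tendsto_compose[of UNIV \<psi> _ 0] by simp
    qed
    then show "AE p in lborel. (\<lambda>n. \<psi> (of_real (\<epsilon> n) * cx p) * of_real (inverse ((1 + (cmod (cx p))\<^sup>2)\<^sup>2)))
        \<longlonglongrightarrow> \<psi> 0 * of_real (inverse ((1 + (cmod (cx p))\<^sup>2)\<^sup>2))"
      by (intro AE_I2 tendsto_intros)
  qed measurable
  have "(\<integral>p. \<psi> 0 * of_real (inverse ((1 + (cmod (cx p))\<^sup>2)\<^sup>2)) \<partial>lborel) = \<psi> 0 * of_real \<kappa>"
    unfolding \<kappa>_def by (simp only: integral_mult_right_zero integral_complex_of_real)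
  note lim3 = tendsto_minus[OF lim2[unfolded this]]
  have "(\<lambda>n. - (\<integral>p. \<psi> (of_real (\<epsilon> n) * cx p) * of_real (inverse ((1 + (cmod (cx p))\<^sup>2)\<^sup>2)) \<partial>lborel))
      = (\<lambda>n. \<integral>p. g (cx p) * regker (\<epsilon> n) (cx p) \<partial>lborel)"
    unfolding scale[symmetric] integral_regker_eq[OF \<epsilon>, symmetric] g_def ..
  from LIMSEQ_unique[OF lim1 lim3[unfolded this]]
  have "(\<integral>p. g (cx p) * inverse (cx p) \<partial>lborel) = - (\<psi> 0 * of_real \<kappa>)" .
  then show ?thesis by (simp add: g_def mult.commute)
qed

end

section \<open>Convolution kernels and peak functions\<close>

text \<open>The fundamental solution \<open>h z / (\<kappa> z)\<close>, cut off at height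
  \<open>2 * H\<close>. The cut is invisible for \<open>\<bar>Im z\<bar> < H\<close> and right-hand
  sides supported in \<open>\<bar>Im w\<bar> \<le> H\<close>, since then \<open>z - w\<close> has
  imaginary part below \<open>2 * H\<close> in modulus.\<close>

definition cker :: "real \<Rightarrow> (complex \<Rightarrow> complex) \<Rightarrow> real \<times> real \<Rightarrow> complex" where
  "cker H h p = (if \<bar>snd p\<bar> \<le> 2 * H then h (cx p) * inverse (cx p) * of_real (inverse \<kappa>) else 0)"

lemma inverse_square_nearby:
  fixes x y :: real
  assumes "\<bar>x - y\<bar> \<le> 1"
  shows "inverse (1 + y\<^sup>2) \<le> 3 * inverse (1 + x\<^sup>2)"
proof -
  have "\<bar>x\<bar> \<le> \<bar>y\<bar> + 1" using assms by linarith
  then have "\<bar>x\<bar>\<^sup>2 \<le> (\<bar>y\<bar> + 1)\<^sup>2" by (intro power_mono) auto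
  then have "x\<^sup>2 \<le> y\<^sup>2 + 2 * \<bar>y\<bar> + 1" by (simp add: power2_eq_square algebra_simps)
  moreover have "0 \<le> (\<bar>y\<bar> - 1)\<^sup>2" by simp
  then have "2 * \<bar>y\<bar> \<le> y\<^sup>2 + 1" by (simp add: power2_eq_square algebra_simps)
  moreover have "0 \<le> y\<^sup>2" by simp
  moreover have "1 + a \<le> 3 * (1 + b)" if "a \<le> b + 2 * t + 1" "2 * t \<le> b + 1" "0 \<le> b" for a b t :: real
    using that by simp
  ultimately have "1 + x\<^sup>2 \<le> 3 * (1 + y\<^sup>2)" by blast
  moreover have "0 < 1 + x\<^sup>2" "0 < 1 + y\<^sup>2" by (auto simp: add_pos_nonneg)
  ultimately show ?thesis by (simp add: field_simps)
qed

context
  fixes h :: "complex \<Rightarrow> complex" and H Ch :: real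
  assumes H: "0 < H" and h: "h holomorphic_on {z. \<bar>Im z\<bar> < 3 * H}"
    and hb: "\<And>z. \<bar>Im z\<bar> < 3 * H \<Longrightarrow> cmod (h z) \<le> Ch * inverse (1 + (Re z)\<^sup>2)"
begin

lemma kernel_bound_nonneg: "0 \<le> Ch"
  using hb[of 0] H norm_ge_zero[of "h 0"] by (simp del: norm_ge_zero)

lemma open_wide_strip: "open {z. \<bar>Im z\<bar> < 3 * H}"
  by (intro open_Collect_less continuous_intros)

lemma integrable_cker: "integrable lborel (cker H h)"
proof -
  define k where "k z = indicator {z. \<bar>Im z\<bar> \<le> 2 * H} z *\<^sub>R (h z * inverse z * of_real (inverse \<kappa>))" for z
  have "continuous_on {z. \<bar>Im z\<bar> \<le> 2 * H} h"
    by (rule continuous_on_subset[OF holomorphic_on_imp_continuous_on[OF h]]) (use H in auto)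
  moreover have "closed {z. \<bar>Im z\<bar> \<le> 2 * H}" by (intro closed_Collect_le continuous_intros)
  ultimately have "(\<lambda>z. indicator {z. \<bar>Im z\<bar> \<le> 2 * H} z *\<^sub>R h z) \<in> borel_measurable borel"
    by (intro borel_measurable_continuous_on_indicator) auto
  moreover have "(\<lambda>z::complex. inverse z) \<in> borel_measurable borel" by measurable
  ultimately have "(\<lambda>z. (indicator {z. \<bar>Im z\<bar> \<le> 2 * H} z *\<^sub>R h z) * (inverse z * of_real (inverse \<kappa>))) \<in> borel_measurable borel"
    by measurable
  then have "k \<in> borel_measurable borel" by (simp add: k_def[abs_def] mult.assoc)
  moreover have "cmod (k z) \<le> (Ch * inverse \<kappa>) * (envelope (2 * H) z * inverse (cmod z))" for z
  proof (cases "\<bar>Im z\<bar> \<le> 2 * H")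
    case True
    then have "Im z \<in> {- (2 * H)..2 * H}" by (auto simp: abs_le_iff)
    then have e: "envelope (2 * H) z = inverse (1 + (Re z)\<^sup>2)" by (simp add: envelope_def)
    have "cmod (k z) = cmod (h z) * inverse (cmod z) * inverse \<kappa>"
      using True \<kappa>_pos by (simp add: k_def norm_mult norm_inverse)
    also have "\<dots> \<le> (Ch * envelope (2 * H) z) * inverse (cmod z) * inverse \<kappa>"
      using hb[of z] True H \<kappa>_pos unfolding e by (intro mult_right_mono) auto
    finally show ?thesis by (simp add: mult_ac)
  next
    case False
    then show ?thesis using kernel_bound_nonneg \<kappa>_pos envelope_nonneg[of "2 * H" z] by (simp add: k_def)
  qed
  ultimately have "integrable lborel (\<lambda>p. k (cx p))"
    by (rule integrable_envelope_over_z) (use kernel_bound_nonneg \<kappa>_pos in simp)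
  moreover have "(\<lambda>p. k (cx p)) = cker H h"
    by (rule ext) (auto simp: k_def cker_def indicator_def)
  ultimately show ?thesis by simp
qed

text \<open>Cauchy's estimate on discs of radius at most \<open>H / 2\<close>; the margin between
  \<open>2 * H\<close> and \<open>3 * H\<close> in the assumptions on \<open>h\<close> makes room
  for them.\<close>

lemma deriv_kernel_bound: "\<exists>D\<ge>0. \<forall>z. \<bar>Im z\<bar> \<le> 2 * H \<longrightarrow> cmod (deriv h z) \<le> D * inverse (1 + (Re z)\<^sup>2)"
proof -
  define r where "r = min 1 (H / 2)"
  have r: "0 < r" "r \<le> 1" "r < H" using H by (auto simp: r_def)
  have "cmod (deriv h z) \<le> (3 * Ch / r) * inverse (1 + (Re z)\<^sup>2)" if z: "\<bar>Im z\<bar> \<le> 2 * H" for z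
  proof -
    have sub: "cball z r \<subseteq> {z. \<bar>Im z\<bar> < 3 * H}"
    proof
      fix w assume "w \<in> cball z r"
      then have "\<bar>Im (z - w)\<bar> \<le> r" using abs_Im_le_cmod[of "z - w"] by (simp add: dist_norm)
      then show "w \<in> {z. \<bar>Im z\<bar> < 3 * H}" using z r by simp
    qed
    have hol: "h holomorphic_on cball z r" by (rule holomorphic_on_subset[OF h sub])
    have "cmod ((deriv ^^ 1) h z) \<le> fact 1 * (3 * Ch * inverse (1 + (Re z)\<^sup>2)) / r ^ 1"
    proof (rule Cauchy_inequality)
      show "h holomorphic_on ball z r" by (rule holomorphic_on_subset[OF hol]) auto
      show "continuous_on (cball z r) h" by (rule holomorphic_on_imp_continuous_on[OF hol])
      fix w assume w: "cmod (z - w) = r"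
      then have wT: "\<bar>Im w\<bar> < 3 * H" using sub by (auto simp: dist_norm)
      have "\<bar>Re z - Re w\<bar> \<le> 1" using abs_Re_le_cmod[of "z - w"] w r by simp
      then have "Ch * inverse (1 + (Re w)\<^sup>2) \<le> Ch * (3 * inverse (1 + (Re z)\<^sup>2))"
        by (intro mult_left_mono inverse_square_nearby kernel_bound_nonneg)
      with hb[OF wT] show "cmod (h w) \<le> 3 * Ch * inverse (1 + (Re z)\<^sup>2)" by simp
    qed (use r in auto)
    then show ?thesis by simp
  qed
  with kernel_bound_nonneg r(1) show ?thesis by (intro exI[of _ "3 * Ch / r"]) simp
qed

text \<open>For fixed \<open>z\<close>, the Pompeiu formula is applied to
  \<open>\<psi> w = u (z - w) * h w\<close>. As \<open>h\<close> is holomorphic, the Cauchy--Riemann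
  derivative only hits \<open>u\<close>, with a sign from the reflection, and
  \<open>\<psi> 0 = u z\<close> because \<open>h 0 = 1\<close>.\<close>

lemma cauchy_riemann_conv:
  assumes u: "smooth_with UNIV sup_bounded u" and u0: "\<And>w. H < \<bar>Im w\<bar> \<Longrightarrow> u w = 0"
    and h0: "h 0 = 1" and z: "\<bar>Im z\<bar> < H"
  shows "cauchy_riemann (conv (cker H h) u) z = u z"
proof -
  note ux = smooth_withD(3)[OF u] and uy = smooth_withD(4)[OF u]
  obtain A1 where A1: "0 \<le> A1" "\<And>z. cmod (u z) \<le> A1" using smooth_withD(1)[OF u] sup_boundedD by blast
  obtain A2 where A2: "0 \<le> A2" "\<And>z. cmod (partial_x u z) \<le> A2" using smooth_withD(1)[OF ux] sup_boundedD by blast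
  obtain A3 where A3: "0 \<le> A3" "\<And>z. cmod (partial_y u z) \<le> A3" using smooth_withD(1)[OF uy] sup_boundedD by blast
  define A where "A = A1 + A2 + A3"
  have A: "0 \<le> A" "\<And>z. cmod (u z) \<le> A" "\<And>z. cmod (partial_x u z) \<le> A" "\<And>z. cmod (partial_y u z) \<le> A"
    using A1 A2 A3 by (auto simp: A_def intro: order_trans[OF A1(2)] order_trans[OF A2(2)] order_trans[OF A3(2)])
  obtain D where D: "0 \<le> D" "\<And>z. \<bar>Im z\<bar> \<le> 2 * H \<Longrightarrow> cmod (deriv h z) \<le> D * inverse (1 + (Re z)\<^sup>2)"
    using deriv_kernel_bound by blast
  have far: "u (z - w) = 0 \<and> partial_x u (z - w) = 0 \<and> partial_y u (z - w) = 0" if "2 * H < \<bar>Im w\<bar>" for w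
  proof -
    have o: "open {v. H < \<bar>Im v\<bar>}" by (intro open_Collect_less continuous_intros)
    have m: "z - w \<in> {v. H < \<bar>Im v\<bar>}" using that z by simp
    show ?thesis using partials_cong[OF o m, of "\<lambda>_. 0" u] u0 m by auto
  qed
  define \<psi> where "\<psi> w = u (z - w) * h w" for w
  define \<psi>x where "\<psi>x w = - partial_x u (z - w) * h w + u (z - w) * deriv h w" for w
  define \<psi>y where "\<psi>y w = - partial_y u (z - w) * h w + u (z - w) * (\<i> * deriv h w)" for w
  have far\<psi>: "\<psi> w = 0" "\<psi>x w = 0" "\<psi>y w = 0" if "2 * H < \<bar>Im w\<bar>" for w
    using far[OF that] by (auto simp: \<psi>_def \<psi>x_def \<psi>y_def)
  have of: "open {w. 2 * H < \<bar>Im w\<bar>}" by (intro open_Collect_less continuous_intros)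
  \<comment> \<open>Nothing is known about \<open>h\<close> at height \<open>3 * H\<close> and
    beyond, but \<psi> vanishes beyond height \<open>2 * H\<close>. The two open regions overlap and
    cover the plane.\<close>
  have d\<psi>: "(\<psi> has_derivative (\<lambda>k. Re k *\<^sub>R \<psi>x w + Im k *\<^sub>R \<psi>y w)) (at w)" for w
  proof (cases "\<bar>Im w\<bar> < 3 * H")
    case True
    have l: "((\<lambda>w. z - w) has_derivative (\<lambda>k. - k)) (at w)" by (auto intro!: derivative_eq_intros)
    have "((\<lambda>w. u (z - w)) has_derivative (\<lambda>k. Re (- k) *\<^sub>R partial_x u (z - w) + Im (- k) *\<^sub>R partial_y u (z - w))) (at w)"
      by (rule has_derivative_compose[OF l has_derivative_partials[OF smooth_withD(2)[OF u UNIV_I]]])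
    moreover have "(h has_derivative (\<lambda>k. deriv h w * k)) (at w)"
      using holomorphic_derivI[OF h open_wide_strip, of w UNIV] True by (simp add: has_field_derivative_def)
    ultimately have "((\<lambda>w. u (z - w) * h w) has_derivative (\<lambda>k. u (z - w) * (deriv h w * k)
        + (Re (- k) *\<^sub>R partial_x u (z - w) + Im (- k) *\<^sub>R partial_y u (z - w)) * h w)) (at w)"
      by (rule has_derivative_mult)
    moreover have "(\<lambda>k. u (z - w) * (deriv h w * k) + (Re (- k) *\<^sub>R partial_x u (z - w) + Im (- k) *\<^sub>R partial_y u (z - w)) * h w)
        = (\<lambda>k. Re k *\<^sub>R \<psi>x w + Im k *\<^sub>R \<psi>y w)"
      by (rule ext) (simp add: \<psi>x_def \<psi>y_def complex_eq_iff algebra_simps)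
    ultimately show ?thesis by (simp add: \<psi>_def[abs_def])
  next
    case False
    then have w: "w \<in> {w. 2 * H < \<bar>Im w\<bar>}" using H by simp
    have "((\<lambda>_. 0) has_derivative (\<lambda>k. Re k *\<^sub>R \<psi>x w + Im k *\<^sub>R \<psi>y w)) (at w)"
      using far\<psi>(2,3)[of w] w by simp
    then show ?thesis
      by (rule has_derivative_transform_within_open[OF _ of w]) (use far\<psi>(1) in simp)
  qed
  have cont: "continuous_on UNIV \<phi>"
    if "\<And>w. 2 * H < \<bar>Im w\<bar> \<Longrightarrow> \<phi> w = 0" "continuous_on {w. \<bar>Im w\<bar> < 3 * H} \<phi>" for \<phi> :: "complex \<Rightarrow> complex"
  proof -
    have "continuous_on {w. 2 * H < \<bar>Im w\<bar>} \<phi>"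
      by (rule continuous_on_eq[of _ "\<lambda>_. 0"]) (use that(1) in auto)
    then have "continuous_on ({w. 2 * H < \<bar>Im w\<bar>} \<union> {w. \<bar>Im w\<bar> < 3 * H}) \<phi>"
      by (intro continuous_on_open_Un of open_wide_strip that(2))
    moreover have "{w. 2 * H < \<bar>Im w\<bar>} \<union> {w. \<bar>Im w\<bar> < 3 * H} = UNIV" using H by auto
    ultimately show ?thesis by simp
  qed
  have ch: "continuous_on {w. \<bar>Im w\<bar> < 3 * H} h" "continuous_on {w. \<bar>Im w\<bar> < 3 * H} (deriv h)"
    using h holomorphic_deriv[OF h open_wide_strip] holomorphic_on_imp_continuous_on by blast+
  have cs: "continuous_on S (\<lambda>w. v (z - w))" if "smooth_with UNIV sup_bounded v" for v S
    by (rule continuous_on_compose2[OF smooth_with_continuous[OF that]]) (auto intro: continuous_intros)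
  have c3: "continuous_on {w. \<bar>Im w\<bar> < 3 * H} \<psi>x" "continuous_on {w. \<bar>Im w\<bar> < 3 * H} \<psi>y"
    unfolding \<psi>x_def[abs_def] \<psi>y_def[abs_def] by (intro continuous_intros ch cs u ux uy)+
  note c\<psi> = cont[where \<phi> = \<psi>x, OF far\<psi>(2) c3(1)] cont[where \<phi> = \<psi>y, OF far\<psi>(3) c3(2)]
  define C where "C = A * (Ch + D)"
  have main: "cmod (a * h w) \<le> A * Ch * envelope (2 * H) w" "cmod (a * deriv h w) \<le> A * D * envelope (2 * H) w"
    if "cmod a \<le> A" "\<bar>Im w\<bar> \<le> 2 * H" for a w
  proof -
    have "Im w \<in> {- (2 * H)..2 * H}" using that(2) by (auto simp: abs_le_iff)
    then have e: "envelope (2 * H) w = inverse (1 + (Re w)\<^sup>2)" by (simp add: envelope_def)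
    have "cmod a * cmod (h w) \<le> A * (Ch * envelope (2 * H) w)"
      unfolding e using that hb[of w] H A(1) by (intro mult_mono) auto
    then show "cmod (a * h w) \<le> A * Ch * envelope (2 * H) w" by (simp add: norm_mult)
    have "cmod a * cmod (deriv h w) \<le> A * (D * envelope (2 * H) w)"
      unfolding e using that D(2)[of w] A(1) by (intro mult_mono) auto
    then show "cmod (a * deriv h w) \<le> A * D * envelope (2 * H) w" by (simp add: norm_mult)
  qed
  have C0: "0 \<le> C * envelope (2 * H) w" "0 \<le> A * D * envelope (2 * H) w" for w
    using A(1) D(1) kernel_bound_nonneg envelope_nonneg[of "2 * H" w] by (simp_all add: C_def)
  have Ceq: "C * envelope (2 * H) w = A * Ch * envelope (2 * H) w + A * D * envelope (2 * H) w" for w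
    by (simp add: C_def algebra_simps)
  have b\<psi>: "cmod (\<psi> w) \<le> C * envelope (2 * H) w \<and> cmod (\<psi>x w) \<le> C * envelope (2 * H) w
      \<and> cmod (\<psi>y w) \<le> C * envelope (2 * H) w" for w
  proof (cases "\<bar>Im w\<bar> \<le> 2 * H")
    case True
    have "cmod (\<psi> w) \<le> C * envelope (2 * H) w"
      using main(1)[OF A(2)[of "z - w"] True] C0(2)[of w] unfolding \<psi>_def Ceq by linarith
    moreover have "cmod (\<psi>x w) \<le> C * envelope (2 * H) w"
      using norm_triangle_ineq[of "- partial_x u (z - w) * h w" "u (z - w) * deriv h w"]
        main(1)[of "- partial_x u (z - w)" w] main(2)[OF A(2)[of "z - w"] True] A(3)[of "z - w"] True
      unfolding \<psi>x_def Ceq by simp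
    moreover have "cmod (\<psi>y w) \<le> C * envelope (2 * H) w"
      using norm_triangle_ineq[of "- partial_y u (z - w) * h w" "(u (z - w) * \<i>) * deriv h w"]
        main(1)[of "- partial_y u (z - w)" w] main(2)[of "u (z - w) * \<i>" w] A(2)[of "z - w"] A(4)[of "z - w"] True
      unfolding \<psi>y_def Ceq by (simp add: norm_mult mult.assoc)
    ultimately show ?thesis by blast
  next
    case False
    then show ?thesis using far\<psi>[of w] C0[of w] by simp
  qed
  have P: "(\<integral>p. 1/2 * (\<psi>x (cx p) + \<i> * \<psi>y (cx p)) * inverse (cx p) \<partial>lborel) = - of_real \<kappa> * \<psi> 0"
    by (rule pompeiu[OF d\<psi> c\<psi>, of C "2 * H"]) (use b\<psi> in blast)+
  have int: "integrable lborel (\<lambda>p. v (z - cx p) * cker H h p)" if v: "smooth_with UNIV sup_bounded v" for v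
  proof -
    obtain B where "\<And>z. cmod (v z) \<le> B" using smooth_withD(1)[OF v] sup_boundedD by blast
    then show ?thesis using integrable_conv[OF integrable_cker smooth_with_continuous[OF v]] by blast
  qed
  have "cauchy_riemann (conv (cker H h) u) z
      = 1/2 * (conv (cker H h) (partial_x u) z + \<i> * conv (cker H h) (partial_y u) z)"
    unfolding cauchy_riemann_def using conv_partials[OF integrable_cker u] by simp
  also have "\<dots> = (\<integral>p. 1/2 * (partial_x u (z - cx p) * cker H h p + \<i> * (partial_y u (z - cx p) * cker H h p)) \<partial>lborel)"
    unfolding conv_def using int[OF ux] int[OF uy] by simp
  also have "\<dots> = (\<integral>p. - of_real (inverse \<kappa>) * (1/2 * (\<psi>x (cx p) + \<i> * \<psi>y (cx p)) * inverse (cx p)) \<partial>lborel)"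
  proof (rule Bochner_Integration.integral_cong)
    fix p
    show "1/2 * (partial_x u (z - cx p) * cker H h p + \<i> * (partial_y u (z - cx p) * cker H h p))
      = - of_real (inverse \<kappa>) * (1/2 * (\<psi>x (cx p) + \<i> * \<psi>y (cx p)) * inverse (cx p))"
    proof (cases "\<bar>snd p\<bar> \<le> 2 * H")
      case True
      \<comment> \<open>The factor \<open>1 + \<i> * \<i>\<close> is the Cauchy--Riemann equation of
        \<open>h\<close>.\<close>
      have "\<psi>x (cx p) + \<i> * \<psi>y (cx p) = - (partial_x u (z - cx p) + \<i> * partial_y u (z - cx p)) * h (cx p)
          + u (z - cx p) * deriv h (cx p) * (1 + \<i> * \<i>)"
        by (simp only: \<psi>x_def \<psi>y_def) (simp add: algebra_simps)
      then have X: "\<psi>x (cx p) + \<i> * \<psi>y (cx p) = - (partial_x u (z - cx p) + \<i> * partial_y u (z - cx p)) * h (cx p)" by simp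
      show ?thesis unfolding X using True by (simp add: cker_def algebra_simps)
    next
      case False
      then show ?thesis using far[of "cx p"] far\<psi>[of "cx p"] by (simp add: cker_def)
    qed
  qed simp
  also have "\<dots> = - of_real (inverse \<kappa>) * (- of_real \<kappa> * \<psi> 0)"
    by (simp only: integral_mult_right_zero P)
  also have "\<dots> = u z" using \<kappa>_pos h0 by (simp add: \<psi>_def)
  finally show ?thesis .
qed

end

text \<open>Pole pushing as in Runge's theorem; the error is the tail of a geometric series.\<close>

lemma push_inverse:
  fixes p p' :: complex
  assumes "cmod (p - p') \<le> d" "0 \<le> d" "d < \<rho>" "0 < e"
  shows "\<exists>r. \<forall>z. \<rho> \<le> cmod (z - p') \<longrightarrow> cmod (poly r (inverse (z - p')) - inverse (z - p)) \<le> e"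
proof -
  define x where "x = d / \<rho>"
  have x: "0 \<le> x" "x < 1" using assms by (auto simp: x_def)
  have "(\<lambda>n. (1 / \<rho> / (1 - x)) * x ^ n) \<longlonglongrightarrow> (1 / \<rho> / (1 - x)) * 0"
    by (intro tendsto_intros LIMSEQ_power_zero) (use x in simp)
  then have "\<forall>\<^sub>F n in sequentially. (1 / \<rho> / (1 - x)) * x ^ n < e"
    using assms(4) by (intro order_tendstoD(2)[of _ 0]) auto
  then obtain n where n: "(1 / \<rho> / (1 - x)) * x ^ n < e" by (auto simp: eventually_sequentially)
  define a where "a = p - p'"
  \<comment> \<open>A partial sum of the expansion of \<open>1 / (z - p)\<close> in powers of
    \<open>w = 1 / (z - p')\<close>, namely the sum of \<open>a ^ k * w ^ (k + 1)\<close>; its ratio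
    \<open>a * w\<close> is at most \<open>d / \<rho>\<close> in modulus.\<close>
  define r where "r = (\<Sum>k<n. monom (a ^ k) (k + 1))"
  have "cmod (poly r (inverse (z - p')) - inverse (z - p)) \<le> e" if z: "\<rho> \<le> cmod (z - p')" for z
  proof -
    define w where "w = inverse (z - p')"
    have z0: "z - p' \<noteq> 0" using z assms by auto
    have "inverse (cmod (z - p')) \<le> inverse \<rho>" using z assms by (intro le_imp_inverse_le) auto
    then have w: "cmod w \<le> 1 / \<rho>" by (simp add: w_def norm_inverse inverse_eq_divide norm_divide)
    have aw: "cmod (a * w) \<le> x"
      using mult_mono[OF assms(1) w] assms(2,3) by (simp add: norm_mult a_def x_def)
    have ne: "a * w \<noteq> 1" using aw x by auto
    have 1: "1 - x \<le> cmod (1 - a * w)" using norm_triangle_ineq2[of 1 "a * w"] aw by simp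
    have "poly r w = w * (\<Sum>k<n. (a * w) ^ k)"
      by (simp add: r_def poly_sum poly_monom sum_distrib_left power_mult_distrib mult_ac)
    also have "(\<Sum>k<n. (a * w) ^ k) = (1 - (a * w) ^ n) / (1 - a * w)"
      using ne by (simp add: sum_gp_strict)
    finally have r: "poly r w = w * ((1 - (a * w) ^ n) / (1 - a * w))" .
    have zw: "z - p = (1 - a * w) / w" using z0 by (simp add: w_def a_def field_simps)
    have "inverse (z - p) = w / (1 - a * w)" unfolding zw by (simp add: inverse_eq_divide)
    then have "poly r w - inverse (z - p) = - (w * (a * w) ^ n / (1 - a * w))"
      unfolding r using ne by (simp add: field_simps)
    then have "cmod (poly r w - inverse (z - p)) = cmod w * cmod (a * w) ^ n / cmod (1 - a * w)"
      by (simp add: norm_mult norm_divide norm_power)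
    also have "\<dots> \<le> (1 / \<rho>) * x ^ n / (1 - x)"
      using 1 x w aw assms by (intro frac_le mult_mono power_mono) auto
    also have "\<dots> < e" using n by simp
    finally show ?thesis by (simp add: w_def)
  qed
  then show ?thesis by blast
qed

text \<open>Substitute the approximation of \<open>1 / (z - p)\<close> into \<open>q\<close>. Both
  arguments stay in a fixed ball because \<open>z\<close> keeps distance at least
  \<open>\<rho> - d\<close> from \<open>p\<close>, and \<open>q\<close> is uniformly continuous
  there.\<close>

lemma push_poly:
  fixes p p' :: complex
  assumes "cmod (p - p') \<le> d" "0 \<le> d" "d < \<rho>" "0 < e"
  shows "\<exists>r. \<forall>z. \<rho> \<le> cmod (z - p') \<longrightarrow> cmod (poly r (inverse (z - p')) - poly q (inverse (z - p))) \<le> e"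
proof -
  define B where "B = 1 / (\<rho> - d)"
  have "uniformly_continuous_on (cball 0 (B + 1)) (poly q)"
    by (intro compact_uniformly_continuous continuous_intros) auto
  then obtain \<delta> where \<delta>: "0 < \<delta>" "\<And>x y. x \<in> cball 0 (B + 1) \<Longrightarrow> y \<in> cball 0 (B + 1) \<Longrightarrow> dist x y < \<delta> \<Longrightarrow> dist (poly q x) (poly q y) < e"
    using assms(4) unfolding uniformly_continuous_on_def by metis
  define t where "t = min 1 (\<delta> / 2)"
  have t: "0 < t" "t \<le> 1" "t < \<delta>" using \<delta>(1) by (auto simp: t_def)
  obtain r where r: "\<And>z. \<rho> \<le> cmod (z - p') \<Longrightarrow> cmod (poly r (inverse (z - p')) - inverse (z - p)) \<le> t"
    using push_inverse[OF assms(1-3) t(1)] by blast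
  have "cmod (poly (pcompose q r) (inverse (z - p')) - poly q (inverse (z - p))) \<le> e" if z: "\<rho> \<le> cmod (z - p')" for z
  proof -
    have "z - p = (z - p') - (p - p')" by simp
    then have "\<rho> - d \<le> cmod (z - p)" using norm_triangle_ineq2[of "z - p'" "p - p'"] z assms(1) by simp
    then have "inverse (cmod (z - p)) \<le> inverse (\<rho> - d)" using assms by (intro le_imp_inverse_le) auto
    then have "cmod (inverse (z - p)) \<le> B" by (simp add: B_def norm_inverse inverse_eq_divide norm_divide)
    moreover have "cmod (poly r (inverse (z - p'))) \<le> cmod (inverse (z - p)) + t"
      using norm_triangle_ineq2[of "poly r (inverse (z - p'))" "inverse (z - p)"] r[OF z] by simp
    ultimately have "dist (poly q (poly r (inverse (z - p')))) (poly q (inverse (z - p))) < e"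
      using r[OF z] t by (intro \<delta>(2)) (auto simp: dist_norm)
    then show ?thesis by (simp add: poly_pcompose dist_norm)
  qed
  then show ?thesis by blast
qed

text \<open>The initial function is \<open>1 / (z - p)\<^sup>4\<close> with \<open>p = 4/5 \<delta> \<i>\<close>, for which the ratio of the values is
  \<open>(5/4)\<^sup>4 > 2\<close>; then the pole climbs the imaginary axis in steps of length \<open>\<delta> / 10\<close>.\<close>

lemma peak_polynomial:
  assumes \<delta>: "0 < \<delta>"
  shows "\<exists>q c. 0 < c \<and> 2 * c < cmod (poly q (inverse (0 - \<i> * of_real (4/5 * \<delta> + real n * (\<delta> / 10)))))
    \<and> (\<forall>z. \<delta> \<le> \<bar>Re z\<bar> \<or> Im z \<le> - \<delta> \<longrightarrow> cmod (poly q (inverse (z - \<i> * of_real (4/5 * \<delta> + real n * (\<delta> / 10))))) \<le> c)"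
proof (induction n)
  case 0
  show ?case
  proof (intro exI[of _ "monom 1 4"] exI[of _ "(1 / \<delta>) ^ 4"] conjI allI impI)
    show "0 < (1 / \<delta>) ^ 4" using \<delta> by simp
    have "cmod (poly (monom 1 4) (inverse (0 - \<i> * of_real (4/5 * \<delta> + real 0 * (\<delta> / 10))))) = (5/4 * (1 / \<delta>)) ^ 4"
    proof -
      have "cmod (0 - \<i> * of_real (4/5 * \<delta> + real 0 * (\<delta> / 10))) = 4/5 * \<delta>"
        using \<delta> by (simp only: diff_0 norm_minus_cancel norm_mult norm_ii norm_of_real) simp
      then show ?thesis unfolding poly_monom norm_mult norm_power norm_inverse by (simp add: field_simps)
    qed
    also have "\<dots> = (5/4) ^ 4 * (1 / \<delta>) ^ 4" by (rule power_mult_distrib)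
    finally have eq: "cmod (poly (monom 1 4) (inverse (0 - \<i> * of_real (4/5 * \<delta> + real 0 * (\<delta> / 10))))) = (5/4) ^ 4 * (1 / \<delta>) ^ 4" .
    have "2 * (1 / \<delta>) ^ 4 < (5/4) ^ 4 * (1 / \<delta>) ^ 4" using \<delta> by (intro mult_strict_right_mono) (auto simp: power4_eq_xxxx)
    with eq show "2 * (1 / \<delta>) ^ 4 < cmod (poly (monom 1 4) (inverse (0 - \<i> * of_real (4/5 * \<delta> + real 0 * (\<delta> / 10)))))" by simp
    fix z assume z: "\<delta> \<le> \<bar>Re z\<bar> \<or> Im z \<le> - \<delta>"
    define v where "v = z - \<i> * of_real (4/5 * \<delta> + real 0 * (\<delta> / 10))"
    have "\<delta> \<le> \<bar>Re v\<bar> \<or> \<delta> \<le> \<bar>Im v\<bar>" using z \<delta> by (auto simp: v_def)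
    then have "\<delta> \<le> cmod v" using abs_Re_le_cmod[of v] abs_Im_le_cmod[of v] by linarith
    then have "inverse (cmod v) \<le> 1 / \<delta>" using \<delta> by (simp add: inverse_eq_divide frac_le)
    then have "inverse (cmod v) ^ 4 \<le> (1 / \<delta>) ^ 4" by (intro power_mono) auto
    then show "cmod (poly (monom 1 4) (inverse (z - \<i> * of_real (4/5 * \<delta> + real 0 * (\<delta> / 10))))) \<le> (1 / \<delta>) ^ 4"
      unfolding v_def[symmetric] by (simp add: poly_monom norm_power norm_inverse)
  qed
next
  case (Suc n)
  define p where "p = \<i> * of_real (4/5 * \<delta> + real n * (\<delta> / 10))"
  define s where "s = 4/5 * \<delta> + real (Suc n) * (\<delta> / 10)"
  define p' where "p' = \<i> * of_real s"
  have s: "9/10 * \<delta> \<le> s" using \<delta> by (simp add: s_def field_simps)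
  obtain q c where q: "0 < c" "2 * c < cmod (poly q (inverse (0 - p)))"
    "\<And>z. \<delta> \<le> \<bar>Re z\<bar> \<or> Im z \<le> - \<delta> \<Longrightarrow> cmod (poly q (inverse (z - p))) \<le> c"
    using Suc unfolding p_def by blast
  \<comment> \<open>An error \<open>e\<close> lowers the value at \<open>0\<close> by at most
    \<open>e\<close> and raises the bound to \<open>c + e\<close>. The strict ratio \<open>2\<close>
    survives when \<open>3 * e\<close> is less than the old excess over \<open>2 * c\<close>; a
    quarter of that excess qualifies.\<close>
  define e where "e = (cmod (poly q (inverse (0 - p))) - 2 * c) / 4"
  have e: "0 < e" using q(2) by (simp add: e_def)
  have "p - p' = - \<i> * of_real (\<delta> / 10)" by (simp add: p_def p'_def s_def algebra_simps)
  then have "cmod (p - p') \<le> \<delta> / 10" using \<delta> by (simp add: norm_mult del: of_real_divide)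
  \<comment> \<open>The radius \<open>17/20 * \<delta>\<close> lies above the step length
    \<open>\<delta> / 10\<close>, as the geometric series requires, and below
    \<open>9/10 * \<delta>\<close>, the least possible distance from the new pole to
    \<open>0\<close>. The points of the controlled region have distance at least
    \<open>\<delta>\<close>.\<close>
  then obtain r where r: "\<And>z. 17/20 * \<delta> \<le> cmod (z - p') \<Longrightarrow> cmod (poly r (inverse (z - p')) - poly q (inverse (z - p))) \<le> e"
    using push_poly[of p p' "\<delta> / 10" "17/20 * \<delta>" e q] e \<delta> by auto
  have 0: "cmod (poly q (inverse (0 - p))) - e \<le> cmod (poly r (inverse (0 - p')))"
  proof -
    have "17/20 * \<delta> \<le> cmod (0 - p')" using s \<delta> by (simp add: p'_def norm_mult)
    from r[OF this] show ?thesis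
      using norm_triangle_ineq3[of "poly r (inverse (0 - p'))" "poly q (inverse (0 - p))"] by linarith
  qed
  have K: "cmod (poly r (inverse (z - p'))) \<le> c + e" if z: "\<delta> \<le> \<bar>Re z\<bar> \<or> Im z \<le> - \<delta>" for z
  proof -
    have "\<delta> \<le> \<bar>Re (z - p')\<bar> \<or> \<delta> \<le> \<bar>Im (z - p')\<bar>" using z s \<delta> by (auto simp: p'_def)
    then have "\<delta> \<le> cmod (z - p')" using abs_Re_le_cmod[of "z - p'"] abs_Im_le_cmod[of "z - p'"] by linarith
    then have "17/20 * \<delta> \<le> cmod (z - p')" using \<delta> by simp
    from r[OF this] q(3)[OF z] show ?thesis
      using norm_triangle_ineq3[of "poly r (inverse (z - p'))" "poly q (inverse (z - p))"] by linarith
  qed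
  have "2 * (c + e) < cmod (poly r (inverse (0 - p')))" 
  proof -
    have "2 * (c + (a - 2 * c) / 4) < b" if "a - (a - 2 * c) / 4 \<le> b" "2 * c < a" for a b :: real
      using that by (simp add: field_simps)
    from this[OF 0[unfolded e_def] q(2)] show ?thesis by (simp only: e_def)
  qed
  then show ?case using K q(1) e unfolding p'_def s_def by (intro exI[of _ r] exI[of _ "c + e"]) auto
qed

text \<open>The exceptional half strip extends upwards without bound, so the pole can be moved
  inside it above the height \<open>L\<close>. What remains is holomorphic and bounded for
  \<open>\<bar>Im z\<bar> < L\<close>; the margin \<open>1\<close> in \<open>L + 1 < s\<close> gives
  the bound.\<close>

lemma peak_function:
  assumes \<delta>: "0 < \<delta>" and L: "0 < L"
  obtains E B where "E holomorphic_on {z. \<bar>Im z\<bar> < L}" "\<And>z. \<bar>Im z\<bar> < L \<Longrightarrow> cmod (E z) \<le> B" "E 0 = 1"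
    "\<And>z. \<delta> \<le> \<bar>Re z\<bar> \<or> Im z \<le> - \<delta> \<Longrightarrow> cmod (E z) \<le> 1 / 2"
proof -
  obtain n :: nat where n: "(L + 1) / (\<delta> / 10) < n" using reals_Archimedean2 by blast
  define s where "s = 4/5 * \<delta> + real n * (\<delta> / 10)"
  have s: "L + 1 < s" using n \<delta> by (simp add: s_def field_simps)
  define p where "p = \<i> * complex_of_real s"
  obtain q c where q: "0 < c" "2 * c < cmod (poly q (inverse (0 - p)))"
    "\<And>z. \<delta> \<le> \<bar>Re z\<bar> \<or> Im z \<le> - \<delta> \<Longrightarrow> cmod (poly q (inverse (z - p))) \<le> c"
    using peak_polynomial[OF \<delta>, of n] unfolding p_def s_def by blast
  define a where "a = poly q (inverse (0 - p))"
  have a: "a \<noteq> 0" using q by (auto simp: a_def)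
  define E where "E z = poly q (inverse (z - p)) / a" for z
  have far: "1 \<le> cmod (z - p)" if "\<bar>Im z\<bar> < L" for z
    using abs_Im_le_cmod[of "z - p"] that s by (simp add: p_def)
  have "bounded (poly q ` cball 0 1)"
    by (intro compact_imp_bounded compact_continuous_image continuous_intros) auto
  then obtain M where "\<forall>x\<in>poly q ` cball 0 1. cmod x \<le> M" unfolding bounded_iff by blast
  then have M: "\<And>w. cmod w \<le> 1 \<Longrightarrow> cmod (poly q w) \<le> M" by simp
  show ?thesis
  proof (rule that[of E "M / cmod a"])
    have ne: "z - p \<noteq> 0" if "\<bar>Im z\<bar> < L" for z using far[OF that] by auto
    then show "E holomorphic_on {z. \<bar>Im z\<bar> < L}"
      unfolding E_def[abs_def] poly_altdef by (intro holomorphic_intros) (use a ne in auto)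
    show "cmod (E z) \<le> M / cmod a" if "\<bar>Im z\<bar> < L" for z
      using M[of "inverse (z - p)"] far[OF that] a
      by (simp add: E_def norm_divide norm_inverse inverse_le_1_iff divide_right_mono)
    show "E 0 = 1" using a by (simp add: E_def a_def)
    show "cmod (E z) \<le> 1 / 2" if "\<delta> \<le> \<bar>Re z\<bar> \<or> Im z \<le> - \<delta>" for z
      using q(3)[OF that] q(2) a unfolding E_def norm_divide a_def[symmetric] by (simp add: field_simps)
  qed
qed

section \<open>Surjectivity of the Cauchy--Riemann operator\<close>

lemma exp_minus_abs_le: "exp (- \<bar>x\<bar>) \<le> 2 * inverse (1 + (x::real)\<^sup>2)"
proof -
  have "1 + \<bar>x\<bar> + \<bar>x\<bar>\<^sup>2 / 2 \<le> exp \<bar>x\<bar>" by (rule exp_lower_Taylor_quadratic) simp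
  moreover have "0 \<le> \<bar>x\<bar>" by simp
  ultimately have "(1 + x\<^sup>2) / 2 \<le> exp \<bar>x\<bar>" unfolding power2_abs add_divide_distrib by linarith
  moreover have "0 < 1 + x\<^sup>2" by (simp add: add_pos_nonneg)
  ultimately have "inverse (exp \<bar>x\<bar>) \<le> inverse ((1 + x\<^sup>2) / 2)" by (intro le_imp_inverse_le) auto
  moreover have "inverse ((1 + x\<^sup>2) / 2) = 2 * inverse (1 + x\<^sup>2)" by (simp add: inverse_eq_divide)
  ultimately show ?thesis by (simp only: exp_minus)
qed

section \<open>Weighted estimates for convolutions with the Cauchy kernels\<close>

context weighted_strip
begin

definition gbdd :: "(complex \<Rightarrow> complex) \<Rightarrow> bool" where
  "gbdd f \<longleftrightarrow> (\<forall>N. \<exists>S. \<forall>z. exp (W N \<bar>Re z\<bar>) * cmod (f z) \<le> S)"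

lemma exp_weight_ge_1: "1 \<le> exp (W N \<bar>t\<bar>)"
  using weight_nonneg[OF W, of "\<bar>t\<bar>" N] by simp

lemma gbdd_sup_bounded: "gbdd f \<Longrightarrow> sup_bounded f"
  unfolding sup_bounded_def
proof -
  assume "gbdd f"
  then obtain S where S: "\<And>z. exp (W 0 \<bar>Re z\<bar>) * cmod (f z) \<le> S" unfolding gbdd_def by blast
  have "cmod (f z) \<le> S" for z
    using mult_right_mono[OF exp_weight_ge_1[of 0 "Re z"] norm_ge_zero[of "f z"]] S[of z] by simp
  then show "\<exists>C. \<forall>z. cmod (f z) \<le> C" by blast
qed

lemma gbdd_wbdd: "gbdd f \<Longrightarrow> wbdd b f"
  unfolding gbdd_def wbdd_def by meson

lemma gbdd_K_space:
  assumes "smooth_with UNIV gbdd f"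
  shows "f \<in> K_space W F G"
  unfolding K_space_iff by (rule smooth_with_mono[OF assms subset_UNIV gbdd_wbdd])

lemma integrable_kernel_majorant: "integrable lborel (\<lambda>p. envelope R (cx p) * inverse (cmod (cx p)))"
proof -
  define k where "k z = complex_of_real (envelope R z * inverse (cmod z))" for z
  have "k \<in> borel_measurable borel"
    unfolding k_def[abs_def] envelope_def by measurable
  moreover have "cmod (k z) \<le> 1 * (envelope R z * inverse (cmod z))" for z
    unfolding k_def norm_of_real using envelope_nonneg[of R z] by simp
  ultimately have "integrable lborel (\<lambda>p. k (cx p))" by (rule integrable_envelope_over_z) simp
  then have "integrable lborel (\<lambda>p. Re (k (cx p)))" by (rule integrable_Re)
  then show ?thesis by (simp only: k_def Re_complex_of_real)
qed

text \<open>\<open>weight_add\<close> distributes the weight at \<open>z\<close> over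
  \<open>z - \<zeta>\<close> and \<zeta>. The order of quantifiers is essential: \<open>B\<close>
  does not depend on \<open>h\<close>, so a small \<open>q\<close> gives a small solution. The bound
  on \<open>h\<close> is demanded only where \<open>u (z - \<zeta>)\<close> is nonzero, which is
  where a peak function can be controlled.\<close>

lemma conv_cker_bound:
  assumes P: "\<And>N. \<exists>C\<ge>0. \<forall>z. \<bar>Im z\<bar> \<le> 2 * H \<longrightarrow> exp (W N \<bar>Re z\<bar>) * exp \<bar>Re z\<bar> * cmod (P z) \<le> C"
    and u: "gbdd u"
  shows "\<exists>B\<ge>0. \<forall>h q z. 0 \<le> q \<longrightarrow> (\<forall>\<zeta>. \<bar>Im \<zeta>\<bar> \<le> 2 * H \<longrightarrow> u (z - \<zeta>) \<noteq> 0 \<longrightarrow> cmod (h \<zeta>) \<le> q * cmod (P \<zeta>))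
    \<longrightarrow> exp (W N \<bar>Re z\<bar>) * cmod (conv (cker H h) u z) \<le> q * B"
proof -
  obtain M C where M: "\<And>s t. 0 \<le> s \<Longrightarrow> 0 \<le> t \<Longrightarrow> W N (s + t) \<le> W M s + W M t + C"
    using weight_add[OF W alpha] by metis
  obtain S where S: "\<And>z. exp (W M \<bar>Re z\<bar>) * cmod (u z) \<le> S" using u unfolding gbdd_def by blast
  have S0: "0 \<le> S" using S[of 0] by (meson exp_ge_zero mult_nonneg_nonneg norm_ge_zero order_trans)
  obtain D where D: "0 \<le> D" "\<And>z. \<bar>Im z\<bar> \<le> 2 * H \<Longrightarrow> exp (W M \<bar>Re z\<bar>) * exp \<bar>Re z\<bar> * cmod (P z) \<le> D"
    using P by meson
  define J where "J p = envelope (2 * H) (cx p) * inverse (cmod (cx p))" for p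
  have J: "integrable lborel J" "\<And>p. 0 \<le> J p"
    using integrable_kernel_majorant[of "2 * H"] envelope_nonneg by (auto simp: J_def[abs_def])
  define A where "A = exp C * S * (2 * D) * inverse \<kappa>"
  have A: "0 \<le> A" using S0 D(1) \<kappa>_pos by (simp add: A_def)
  show ?thesis
  proof (intro exI[of _ "A * integral\<^sup>L lborel J"] conjI allI impI)
    show "0 \<le> A * integral\<^sup>L lborel J" using A J(2) by (simp add: integral_nonneg_AE)
    fix h q z
    assume q: "0 \<le> (q::real)" and h: "\<forall>\<zeta>. \<bar>Im \<zeta>\<bar> \<le> 2 * H \<longrightarrow> u (z - \<zeta>) \<noteq> 0 \<longrightarrow> cmod (h \<zeta>) \<le> q * cmod (P \<zeta>)"
    define E where "E = exp (W N \<bar>Re z\<bar>)"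
    have pw: "cmod (of_real E * (u (z - cx p) * cker H h p)) \<le> q * A * J p" for p
    proof (cases "\<bar>snd p\<bar> \<le> 2 * H \<and> u (z - cx p) \<noteq> 0")
      case False
      then have 0: "u (z - cx p) * cker H h p = 0" by (auto simp: cker_def)
      show ?thesis unfolding 0 using q A J(2)[of p] by simp
    next
      case True
      then have p: "\<bar>Im (cx p)\<bar> \<le> 2 * H" "u (z - cx p) \<noteq> 0" by auto
      have e: "envelope (2 * H) (cx p) = inverse (1 + (fst p)\<^sup>2)"
      proof -
        have "snd p \<in> {- (2 * H)..2 * H}" using True by (auto simp: abs_le_iff)
        then show ?thesis by (simp add: envelope_def)
      qed
      have hp: "cmod (h (cx p)) \<le> q * cmod (P (cx p))" using h p by blast
      have "W N \<bar>Re z\<bar> \<le> W N (\<bar>Re (z - cx p)\<bar> + \<bar>fst p\<bar>)" by (intro weight_mono[OF W]) auto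
      also have "\<dots> \<le> W M \<bar>Re (z - cx p)\<bar> + W M \<bar>fst p\<bar> + C" by (rule M) auto
      finally have "E \<le> exp C * exp (W M \<bar>Re (z - cx p)\<bar>) * exp (W M \<bar>fst p\<bar>)"
        by (simp add: E_def flip: exp_add)
      then have "E * cmod (u (z - cx p)) * cmod (h (cx p))
          \<le> (exp C * exp (W M \<bar>Re (z - cx p)\<bar>) * exp (W M \<bar>fst p\<bar>)) * cmod (u (z - cx p)) * (q * cmod (P (cx p)))"
        using hp by (intro mult_mono) auto
      also have "\<dots> = exp C * q * (exp (W M \<bar>Re (z - cx p)\<bar>) * cmod (u (z - cx p))) * (exp (W M \<bar>fst p\<bar>) * cmod (P (cx p)))"
        by (simp add: mult_ac)
      also have "\<dots> \<le> exp C * q * S * (exp (W M \<bar>fst p\<bar>) * cmod (P (cx p)))"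
        using q S[of "z - cx p"] by (intro mult_mono mult_nonneg_nonneg S0) auto
      also have "exp (W M \<bar>fst p\<bar>) * cmod (P (cx p)) \<le> D * exp (- \<bar>fst p\<bar>)"
      proof -
        have "(exp (W M \<bar>fst p\<bar>) * cmod (P (cx p))) * (exp \<bar>fst p\<bar> * exp (- \<bar>fst p\<bar>))
            = exp (W M \<bar>Re (cx p)\<bar>) * exp \<bar>Re (cx p)\<bar> * cmod (P (cx p)) * exp (- \<bar>fst p\<bar>)"
          by (simp add: mult_ac)
        also have "\<dots> \<le> D * exp (- \<bar>fst p\<bar>)" using D(2)[OF p(1)] by (rule mult_right_mono) simp
        finally show ?thesis by (simp flip: exp_add)
      qed
      also have "D * exp (- \<bar>fst p\<bar>) \<le> D * (2 * inverse (1 + (fst p)\<^sup>2))"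
        by (intro mult_left_mono exp_minus_abs_le D)
      finally have "E * cmod (u (z - cx p)) * cmod (h (cx p)) \<le> exp C * q * S * (D * (2 * inverse (1 + (fst p)\<^sup>2)))"
        using q S0 by (simp add: mult_left_mono)
      then have "E * cmod (u (z - cx p)) * cmod (h (cx p)) \<le> exp C * q * S * (D * (2 * envelope (2 * H) (cx p)))"
        unfolding e .
      then have "E * cmod (u (z - cx p)) * cmod (h (cx p)) * (inverse (cmod (cx p)) * inverse \<kappa>)
          \<le> exp C * q * S * (D * (2 * envelope (2 * H) (cx p))) * (inverse (cmod (cx p)) * inverse \<kappa>)"
        using \<kappa>_pos by (intro mult_right_mono) auto
      then show ?thesis
        using True \<kappa>_pos by (simp add: cker_def norm_mult norm_inverse E_def J_def A_def mult_ac)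
    qed
    have "E * cmod (conv (cker H h) u z) = cmod (\<integral>p. of_real E * (u (z - cx p) * cker H h p) \<partial>lborel)"
      unfolding conv_def integral_mult_right_zero norm_mult by (simp add: E_def)
    also have "\<dots> \<le> (\<integral>p. q * A * J p \<partial>lborel)"
      by (rule norm_integral_le[OF _ pw]) (use J(1) in simp)
    finally show "exp (W N \<bar>Re z\<bar>) * cmod (conv (cker H h) u z) \<le> q * (A * integral\<^sup>L lborel J)"
      by (simp add: E_def mult.assoc)
  qed
qed

lemma conv_cker_K_space:
  assumes P: "\<And>N. \<exists>C\<ge>0. \<forall>z. \<bar>Im z\<bar> \<le> 2 * H \<longrightarrow> exp (W N \<bar>Re z\<bar>) * exp \<bar>Re z\<bar> * cmod (P z) \<le> C"
    and int: "integrable lborel (cker H h)" and hq: "0 \<le> q" "\<And>\<zeta>. \<bar>Im \<zeta>\<bar> \<le> 2 * H \<Longrightarrow> cmod (h \<zeta>) \<le> q * cmod (P \<zeta>)"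
    and u: "smooth_with UNIV gbdd u"
  shows "conv (cker H h) u \<in> K_space W F G"
proof (rule gbdd_K_space, rule smooth_with_coinduct[where R = "\<lambda>f. \<exists>u. smooth_with UNIV gbdd u \<and> f = conv (cker H h) u"])
  fix f assume "\<exists>u. smooth_with UNIV gbdd u \<and> f = conv (cker H h) u"
  then obtain u where u: "smooth_with UNIV gbdd u" and f: "f = conv (cker H h) u" by blast
  have su: "smooth_with UNIV sup_bounded u" by (rule smooth_with_mono[OF u subset_UNIV gbdd_sup_bounded])
  show "gbdd f"
    unfolding gbdd_def
  proof
    fix N
    obtain B where "\<And>h q z. 0 \<le> q \<Longrightarrow> (\<forall>\<zeta>. \<bar>Im \<zeta>\<bar> \<le> 2 * H \<longrightarrow> u (z - \<zeta>) \<noteq> 0 \<longrightarrow> cmod (h \<zeta>) \<le> q * cmod (P \<zeta>))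
        \<Longrightarrow> exp (W N \<bar>Re z\<bar>) * cmod (conv (cker H h) u z) \<le> q * B"
      using conv_cker_bound[OF P smooth_withD(1)[OF u], of N] by blast
    then have "exp (W N \<bar>Re z\<bar>) * cmod (f z) \<le> q * B" for z using hq f by simp
    then show "\<exists>S. \<forall>z. exp (W N \<bar>Re z\<bar>) * cmod (f z) \<le> S" by blast
  qed
  show "f differentiable (at z)" for z unfolding f by (rule conv_partials(3)[OF int su])
  have "partial_x f = conv (cker H h) (partial_x u)" "partial_y f = conv (cker H h) (partial_y u)"
    unfolding f by (rule ext, rule conv_partials[OF int su])+
  then show "\<exists>u. smooth_with UNIV gbdd u \<and> partial_x f = conv (cker H h) u"
    "\<exists>u. smooth_with UNIV gbdd u \<and> partial_y f = conv (cker H h) u"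
    using smooth_withD(3,4)[OF u] by blast+
qed (use u in blast)

context
  fixes m H :: real and P :: "complex \<Rightarrow> complex"
  assumes m: "0 < m" "m \<le> H" "\<And>t. m \<le> F t" "\<And>t. m \<le> G t" "\<And>t. F t \<le> H" "\<And>t. G t \<le> H"
    and P: "P holomorphic_on UNIV" "P 0 = 1"
      "\<And>N. \<exists>C\<ge>0. \<forall>z. \<bar>Im z\<bar> \<le> 3 * H \<longrightarrow> exp (W N \<bar>Re z\<bar>) * exp \<bar>Re z\<bar> * cmod (P z) \<le> C"
begin

lemma width_pos: "0 < H"
  using m by linarith

lemma kernel_decay: "\<exists>C\<ge>0. \<forall>z. \<bar>Im z\<bar> \<le> 2 * H \<longrightarrow> exp (W N \<bar>Re z\<bar>) * exp \<bar>Re z\<bar> * cmod (P z) \<le> C"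
proof -
  obtain C where C: "0 \<le> C" "\<And>z. \<bar>Im z\<bar> \<le> 3 * H \<Longrightarrow> exp (W N \<bar>Re z\<bar>) * exp \<bar>Re z\<bar> * cmod (P z) \<le> C"
    using P(3) by meson
  have "exp (W N \<bar>Re z\<bar>) * exp \<bar>Re z\<bar> * cmod (P z) \<le> C" if "\<bar>Im z\<bar> \<le> 2 * H" for z
    by (rule C(2)) (use that width_pos in linarith)
  with C(1) show ?thesis by blast
qed

lemma Im_T_1: "z \<in> T 1 \<Longrightarrow> \<bar>Im z\<bar> < H"
  using m(5,6)[of "Re z"] unfolding mem_T by linarith

text \<open>With \<open>h = P * E ^ k\<close> each admissible \<zeta> contributes a factor
  \<open>(1 / 2) ^ k\<close> as seen from \<open>T a\<close>, while the constant of the convolution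
  estimate is that of \<open>P\<close> alone, whatever \<open>k\<close> is. Elsewhere
  \<open>E\<close> is only bounded by \<open>B\<close>, so membership in \<open>K_space\<close> uses
  the factor \<open>B ^ k\<close>.\<close>

lemma solve_with_peak:
  assumes u: "smooth_with UNIV gbdd u" and off: "\<And>z. z \<notin> T 1 \<Longrightarrow> u z = 0"
    and E: "E holomorphic_on {z. \<bar>Im z\<bar> < 3 * H}" "\<And>z. \<bar>Im z\<bar> < 3 * H \<Longrightarrow> cmod (E z) \<le> B" "E 0 = 1"
    and small: "\<And>z \<zeta>. z \<in> T a \<Longrightarrow> \<bar>Im \<zeta>\<bar> \<le> 2 * H \<Longrightarrow> u (z - \<zeta>) \<noteq> 0 \<Longrightarrow> cmod (E \<zeta>) \<le> 1 / 2"
    and e: "0 < e"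
  shows "\<exists>f\<in>K_space W F G. (\<forall>z\<in>T 1. cauchy_riemann f z = u z) \<and>
    (\<forall>z\<in>T a. exp (W N \<bar>Re z\<bar>) * cmod (f z) \<le> e)"
proof -
  obtain S where S: "0 \<le> S" "\<And>h q z. 0 \<le> q \<Longrightarrow>
      (\<forall>\<zeta>. \<bar>Im \<zeta>\<bar> \<le> 2 * H \<longrightarrow> u (z - \<zeta>) \<noteq> 0 \<longrightarrow> cmod (h \<zeta>) \<le> q * cmod (P \<zeta>))
      \<Longrightarrow> exp (W N \<bar>Re z\<bar>) * cmod (conv (cker H h) u z) \<le> q * S"
    using conv_cker_bound[OF kernel_decay smooth_withD(1)[OF u], of N] by blast
  have "(\<lambda>k. (1 / 2) ^ k * S) \<longlonglongrightarrow> 0 * S" by (intro tendsto_intros LIMSEQ_power_zero) simp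
  then have "\<forall>\<^sub>F k in sequentially. (1 / 2) ^ k * S < e" using e by (intro order_tendstoD(2)[of _ 0]) auto
  then obtain k where k: "(1 / 2) ^ k * S < e" by (auto simp: eventually_sequentially)
  define h where "h z = P z * E z ^ k" for z
  have "cmod (E 0) \<le> B" using E(2)[of 0] width_pos by simp
  then have B: "0 \<le> B" by (rule order_trans[OF norm_ge_zero])
  have hP: "cmod (h z) \<le> B ^ k * cmod (P z)" if "\<bar>Im z\<bar> < 3 * H" for z
    unfolding h_def norm_mult norm_power
    using mult_right_mono[OF power_mono[OF E(2)[OF that] norm_ge_zero, of k] norm_ge_zero[of "P z"]]
    by (simp add: mult.commute)
  have hh: "h holomorphic_on {z. \<bar>Im z\<bar> < 3 * H}"
    unfolding h_def[abs_def] by (intro holomorphic_intros E(1) holomorphic_on_subset[OF P(1)]) auto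
  obtain C where C: "0 \<le> C" "\<And>z. \<bar>Im z\<bar> \<le> 3 * H \<Longrightarrow> exp (W 0 \<bar>Re z\<bar>) * exp \<bar>Re z\<bar> * cmod (P z) \<le> C"
    using P(3) by meson
  have hb: "cmod (h z) \<le> (B ^ k * (2 * C)) * inverse (1 + (Re z)\<^sup>2)" if z: "\<bar>Im z\<bar> < 3 * H" for z
  proof -
    have "1 * (exp \<bar>Re z\<bar> * cmod (P z)) \<le> exp (W 0 \<bar>Re z\<bar>) * (exp \<bar>Re z\<bar> * cmod (P z))"
      by (intro mult_right_mono exp_weight_ge_1) auto
    then have "exp \<bar>Re z\<bar> * cmod (P z) \<le> C" using C(2)[OF less_imp_le[OF z]]
      unfolding mult_1_left mult.assoc by linarith
    then have "exp (- \<bar>Re z\<bar>) * (exp \<bar>Re z\<bar> * cmod (P z)) \<le> exp (- \<bar>Re z\<bar>) * C" by (intro mult_left_mono) auto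
    then have "cmod (P z) \<le> exp (- \<bar>Re z\<bar>) * C" by (simp add: mult.assoc[symmetric] flip: exp_add)
    also have "\<dots> \<le> (2 * inverse (1 + (Re z)\<^sup>2)) * C" by (intro mult_right_mono exp_minus_abs_le C)
    finally have "B ^ k * cmod (P z) \<le> B ^ k * ((2 * inverse (1 + (Re z)\<^sup>2)) * C)" using B by (intro mult_left_mono) auto
    with hP[OF z] show ?thesis by (simp add: mult_ac)
  qed
  have h0: "h 0 = 1" by (simp add: h_def P(2) E(3))
  define f where "f = conv (cker H h) u"
  have su: "smooth_with UNIV sup_bounded u" by (rule smooth_with_mono[OF u subset_UNIV gbdd_sup_bounded])
  have "f \<in> K_space W F G"
    unfolding f_def
  proof (rule conv_cker_K_space[OF kernel_decay integrable_cker[OF width_pos hh hb] _ _ u])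
    show "0 \<le> B ^ k" using B by simp
    show "cmod (h \<zeta>) \<le> B ^ k * cmod (P \<zeta>)" if "\<bar>Im \<zeta>\<bar> \<le> 2 * H" for \<zeta>
      by (rule hP) (use that width_pos in linarith)
  qed
  moreover have "cauchy_riemann f z = u z" if z: "z \<in> T 1" for z
    unfolding f_def
  proof (rule cauchy_riemann_conv[OF width_pos hh hb su _ h0 Im_T_1[OF z]])
    fix w assume "H < \<bar>Im w\<bar>"
    then have "w \<notin> T 1" using Im_T_1[of w] by auto
    then show "u w = 0" by (rule off)
  qed
  moreover have "exp (W N \<bar>Re z\<bar>) * cmod (f z) \<le> e" if z: "z \<in> T a" for z
  proof -
    have "exp (W N \<bar>Re z\<bar>) * cmod (f z) \<le> (1 / 2) ^ k * S"
      unfolding f_def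
    proof (rule S(2), simp, intro allI impI)
      fix \<zeta> assume "\<bar>Im \<zeta>\<bar> \<le> 2 * H" "u (z - \<zeta>) \<noteq> 0"
      then have "cmod (E \<zeta>) ^ k \<le> (1 / 2) ^ k" using small[OF z] by (intro power_mono) auto
      then show "cmod (h \<zeta>) \<le> (1 / 2) ^ k * cmod (P \<zeta>)"
        unfolding h_def norm_mult norm_power by (simp add: mult.commute mult_left_mono)
    qed
    with k show ?thesis by simp
  qed
  ultimately show ?thesis by blast
qed

text \<open>The right-hand side is split into the parts above and below the strip \<open>T c\<close>; seen from \<open>T a\<close>,
  the singularities of the kernel lie in an upward, respectively downward, half strip, outside of
  which the powers of the peak function tend to zero.\<close>

lemma solve_layer:
  assumes u: "smooth_with UNIV gbdd u" and off: "\<And>z. z \<notin> T 1 \<Longrightarrow> u z = 0"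
    and a: "0 \<le> a" "a < c" and in0: "\<And>z. z \<in> T c \<Longrightarrow> u z = 0" and e: "0 < e"
  shows "\<exists>f\<in>K_space W F G. (\<forall>z\<in>T 1. cauchy_riemann f z = u z) \<and>
    (\<forall>z\<in>T a. exp (W N \<bar>Re z\<bar>) * cmod (f z) \<le> e)"
proof -
  obtain d1 where d1: "0 < d1" "\<And>s t. \<bar>s - t\<bar> < d1 \<Longrightarrow> a * F s + d1 \<le> c * F t"
    using strip_boundary_gap[OF F a] by blast
  obtain d2 where d2: "0 < d2" "\<And>s t. \<bar>s - t\<bar> < d2 \<Longrightarrow> a * G s + d2 \<le> c * G t"
    using strip_boundary_gap[OF G a] by blast
  \<comment> \<open>The transition zone \<open>\<bar>Im z\<bar> < c * m\<close> of the cut-off lies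
    in \<open>T c\<close>, where \<open>u\<close> vanishes. Hence \<open>u1\<close> lives above
    \<open>T c\<close> and \<open>u2\<close> below it.\<close>
  have cm: "0 < c * m" using a m by simp
  have "{z. 0 < Im z} \<in> sets borel"
    by (intro borel_open open_Collect_less continuous_intros)
  then obtain \<eta> where \<eta>: "smooth_with UNIV sup_bounded \<eta>"
    "\<And>z. ball z (c * m) \<subseteq> {z. 0 < Im z} \<Longrightarrow> \<eta> z = 1" "\<And>z. ball z (c * m) \<inter> {z. 0 < Im z} = {} \<Longrightarrow> \<eta> z = 0"
    using smooth_cutoff[OF _ cm] by blast
  have Imb: "\<bar>Im w - Im z\<bar> < c * m" if "w \<in> ball z (c * m)" for w z
    using that abs_Im_le_cmod[of "w - z"] by (simp add: dist_norm norm_minus_commute)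
  have up: "\<eta> z = 1" if "c * m \<le> Im z" for z
    by (rule \<eta>(2)) (use that Imb[of _ z] in fastforce)
  have lo: "\<eta> z = 0" if "Im z \<le> - (c * m)" for z
    by (rule \<eta>(3)) (use that Imb[of _ z] in fastforce)
  have gl: "local_on UNIV gbdd" by (simp add: local_on_def flip: fun_eq_iff)
  have ga: "add_closed gbdd"
    unfolding add_closed_def
  proof (intro allI impI)
    fix f g assume f: "gbdd f" and g: "gbdd g"
    show "gbdd (\<lambda>w. f w + g w)"
      unfolding gbdd_def
    proof
      fix N
      obtain C D where C: "\<And>z. exp (W N \<bar>Re z\<bar>) * cmod (f z) \<le> C" and D: "\<And>z. exp (W N \<bar>Re z\<bar>) * cmod (g z) \<le> D"
        using f g unfolding gbdd_def by metis
      have "exp (W N \<bar>Re z\<bar>) * cmod (f z + g z) \<le> C + D" for z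
      proof -
        have "exp (W N \<bar>Re z\<bar>) * cmod (f z + g z) \<le> exp (W N \<bar>Re z\<bar>) * (cmod (f z) + cmod (g z))"
          by (intro mult_left_mono norm_triangle_ineq) simp
        with C[of z] D[of z] show ?thesis by (simp add: distrib_left)
      qed
      then show "\<exists>S. \<forall>z. exp (W N \<bar>Re z\<bar>) * cmod (f z + g z) \<le> S" by blast
    qed
  qed
  have gm: "gbdd (\<lambda>w. f w * g w)" if f: "gbdd f" and g: "sup_bounded g" for f g
    unfolding gbdd_def
  proof
    fix N
    obtain C where C: "\<And>z. exp (W N \<bar>Re z\<bar>) * cmod (f z) \<le> C" using f unfolding gbdd_def by metis
    obtain D where D: "0 \<le> D" "\<And>z. cmod (g z) \<le> D" using g sup_boundedD by blast
    have "exp (W N \<bar>Re z\<bar>) * cmod (f z * g z) \<le> C * D" for z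
    proof -
      have "(exp (W N \<bar>Re z\<bar>) * cmod (f z)) * cmod (g z) \<le> C * D"
        by (rule mult_mono[OF C D(2)]) (use C[of z] in \<open>auto intro: order_trans[rotated]\<close>)
      then show ?thesis by (simp add: norm_mult mult.assoc)
    qed
    then show "\<exists>S. \<forall>z. exp (W N \<bar>Re z\<bar>) * cmod (f z * g z) \<le> S" by blast
  qed
  define u1 where "u1 z = u z * \<eta> z" for z
  define u2 where "u2 z = u z + (- 1) * u1 z" for z
  have u1: "smooth_with UNIV gbdd u1"
    unfolding u1_def[abs_def]
    by (rule smooth_with_mult[where ?Q1.0 = gbdd and ?Q2.0 = sup_bounded, OF u \<eta>(1) open_UNIV gl ga]) (rule gm)
  have u2: "smooth_with UNIV gbdd u2"
    unfolding u2_def[abs_def]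
  proof (rule smooth_with_add[OF u _ open_UNIV gl ga], rule smooth_with_cmult[OF u1 open_UNIV gl])
    show "gbdd (\<lambda>w. - 1 * f w)" if "gbdd f" for f
      using that by (simp add: gbdd_def)
  qed
  have 3: "0 < 3 * H" using width_pos by simp
  obtain E1 B1 where E1: "E1 holomorphic_on {z. \<bar>Im z\<bar> < 3 * H}" "\<And>z. \<bar>Im z\<bar> < 3 * H \<Longrightarrow> cmod (E1 z) \<le> B1" "E1 0 = 1"
    "\<And>z. d1 \<le> \<bar>Re z\<bar> \<or> Im z \<le> - d1 \<Longrightarrow> cmod (E1 z) \<le> 1 / 2"
    by (rule peak_function[OF d1(1) 3]) (rule that; assumption)
  obtain E2 B2 where E2: "E2 holomorphic_on {z. \<bar>Im z\<bar> < 3 * H}" "\<And>z. \<bar>Im z\<bar> < 3 * H \<Longrightarrow> cmod (E2 z) \<le> B2" "E2 0 = 1"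
    "\<And>z. d2 \<le> \<bar>Re z\<bar> \<or> Im z \<le> - d2 \<Longrightarrow> cmod (E2 z) \<le> 1 / 2"
    by (rule peak_function[OF d2(1) 3]) (rule that; assumption)
  have e2: "0 < e / 2" using e by simp
  have "\<exists>f\<in>K_space W F G. (\<forall>z\<in>T 1. cauchy_riemann f z = u1 z) \<and>
    (\<forall>z\<in>T a. exp (W N \<bar>Re z\<bar>) * cmod (f z) \<le> e / 2)"
  proof (rule solve_with_peak[OF u1 _ E1(1-3) _ e2])
    fix z \<zeta> assume z: "z \<in> T a" and nz: "u1 (z - \<zeta>) \<noteq> 0"
    define w where "w = z - \<zeta>"
    have "u w \<noteq> 0" "\<eta> w \<noteq> 0" using nz by (auto simp: u1_def w_def)
    then have w: "w \<notin> T c" "- (c * m) < Im w" using in0 lo[of w] not_le by blast+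
    have "c * m \<le> c * G (Re w)" using m(4) a by (intro mult_left_mono) auto
    then have Fw: "c * F (Re w) \<le> Im w" using w unfolding mem_T by linarith
    show "cmod (E1 \<zeta>) \<le> 1 / 2"
    proof (rule E1(4), rule ccontr)
      \<comment> \<open>If \<zeta> were in the exceptional half strip, the abscissae of
        \<open>z\<close> and \<open>w\<close> would differ by less than \<open>d1\<close>. The
        boundary gap then puts \<open>w\<close> more than \<open>d1\<close> above \<open>z\<close>,
        so \<open>Im \<zeta> < - d1\<close> after all.\<close>
      assume "\<not> (d1 \<le> \<bar>Re \<zeta>\<bar> \<or> Im \<zeta> \<le> - d1)"
      moreover from this have "a * F (Re z) + d1 \<le> c * F (Re w)" by (intro d1(2)) (simp add: w_def)
      moreover have "Im z < a * F (Re z)" using z unfolding mem_T by simp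
      moreover have "Im \<zeta> = Im z - Im w" by (simp add: w_def)
      ultimately show False using Fw by linarith
    qed
  qed (simp add: u1_def off)
  then obtain f1 where f1: "f1 \<in> K_space W F G" "\<And>z. z \<in> T 1 \<Longrightarrow> cauchy_riemann f1 z = u1 z"
    "\<And>z. z \<in> T a \<Longrightarrow> exp (W N \<bar>Re z\<bar>) * cmod (f1 z) \<le> e / 2" by blast
  have "\<exists>f\<in>K_space W F G. (\<forall>z\<in>T 1. cauchy_riemann f z = u2 z) \<and>
    (\<forall>z\<in>T a. exp (W N \<bar>Re z\<bar>) * cmod (f z) \<le> e / 2)"
  \<comment> \<open>The reflected peak function has its exceptional half strip pointing
    downwards.\<close>
  proof (rule solve_with_peak[OF u2, where E = "\<lambda>z. E2 (- z)" and B = B2])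
    have "(E2 \<circ> uminus) holomorphic_on {z. \<bar>Im z\<bar> < 3 * H}"
      by (rule holomorphic_on_compose_gen[OF _ E2(1)]) (auto intro!: holomorphic_intros)
    then show "(\<lambda>z. E2 (- z)) holomorphic_on {z. \<bar>Im z\<bar> < 3 * H}" by (simp add: o_def)
    fix z \<zeta> assume z: "z \<in> T a" and nz: "u2 (z - \<zeta>) \<noteq> 0"
    define w where "w = z - \<zeta>"
    have "u w \<noteq> 0" "\<eta> w \<noteq> 1" using nz by (auto simp: u2_def u1_def w_def)
    then have w: "w \<notin> T c" "Im w < c * m" using in0 up[of w] not_le by blast+
    have "c * m \<le> c * F (Re w)" using m(3) a by (intro mult_left_mono) auto
    then have Gw: "Im w \<le> - (c * G (Re w))" using w unfolding mem_T by linarith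
    show "cmod (E2 (- \<zeta>)) \<le> 1 / 2"
    proof (rule E2(4), rule ccontr)
      assume n: "\<not> (d2 \<le> \<bar>Re (- \<zeta>)\<bar> \<or> Im (- \<zeta>) \<le> - d2)"
      then have "a * G (Re z) + d2 \<le> c * G (Re w)" by (intro d2(2)) (simp add: w_def)
      moreover have "- (a * G (Re z)) < Im z" using z unfolding mem_T by simp
      moreover have "Im \<zeta> = Im z - Im w" by (simp add: w_def)
      ultimately show False using Gw n by simp
    qed
  qed (use E2 e off in \<open>auto simp: u1_def u2_def\<close>)
  then obtain f2 where f2: "f2 \<in> K_space W F G" "\<And>z. z \<in> T 1 \<Longrightarrow> cauchy_riemann f2 z = u2 z"
    "\<And>z. z \<in> T a \<Longrightarrow> exp (W N \<bar>Re z\<bar>) * cmod (f2 z) \<le> e / 2" by blast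
  show ?thesis
  proof (intro bexI conjI ballI)
    show "(\<lambda>w. f1 w + f2 w) \<in> K_space W F G" by (rule K_space_add[OF f1(1) f2(1)])
    show "cauchy_riemann (\<lambda>w. f1 w + f2 w) z = u z" if "z \<in> T 1" for z
      using cauchy_riemann_add[OF K_space_differentiable[OF f1(1) that] K_space_differentiable[OF f2(1) that]]
        f1(2)[OF that] f2(2)[OF that] by (simp add: u2_def)
    show "exp (W N \<bar>Re z\<bar>) * cmod (f1 z + f2 z) \<le> e" if "z \<in> T a" for z
    proof -
      have "exp (W N \<bar>Re z\<bar>) * cmod (f1 z + f2 z) \<le> exp (W N \<bar>Re z\<bar>) * (cmod (f1 z) + cmod (f2 z))"
        by (intro mult_left_mono norm_triangle_ineq) simp
      with f1(3)[OF that] f2(3)[OF that] show ?thesis by (simp add: distrib_left)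
    qed
  qed
qed

end

lemma strip_cutoff:
  assumes "0 \<le> a" "a < c"
  obtains \<eta> where "smooth_with UNIV sup_bounded \<eta>" "\<And>z. z \<in> T a \<Longrightarrow> \<eta> z = 1" "\<And>z. z \<notin> T c \<Longrightarrow> \<eta> z = 0"
proof -
  define b where "b = (a + c) / 2"
  have b: "a < b" "b < c" "0 \<le> b" using assms by (auto simp: b_def)
  obtain d1 where d1: "0 < d1" "\<And>z w. z \<in> T a \<Longrightarrow> cmod (w - z) < d1 \<Longrightarrow> w \<in> T b"
    using T_margin[OF assms(1) b(1)] by blast
  obtain d2 where d2: "0 < d2" "\<And>z w. z \<in> T b \<Longrightarrow> cmod (w - z) < d2 \<Longrightarrow> w \<in> T c"
    using T_margin[OF b(3,2)] by blast
  have d: "0 < min d1 d2" using d1 d2 by simp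
  obtain \<eta> where \<eta>: "smooth_with UNIV sup_bounded \<eta>"
    "\<And>z. ball z (min d1 d2) \<subseteq> T b \<Longrightarrow> \<eta> z = 1" "\<And>z. ball z (min d1 d2) \<inter> T b = {} \<Longrightarrow> \<eta> z = 0"
    using smooth_cutoff[OF borel_open[OF open_T] d] by blast
  show ?thesis
  proof (rule that[OF \<eta>(1)])
    show "\<eta> z = 1" if "z \<in> T a" for z
      by (rule \<eta>(2)) (use d1(2)[OF that] in \<open>auto simp: dist_norm norm_minus_commute\<close>)
    show "\<eta> z = 0" if "z \<notin> T c" for z
    proof (rule \<eta>(3), rule ccontr)
      assume "ball z (min d1 d2) \<inter> T b \<noteq> {}"
      then obtain w where "w \<in> T b" "cmod (z - w) < d2" by (auto simp: dist_norm)
      then show False using d2(2) that by blast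
    qed
  qed
qed

lemma cutoff_gbdd:
  assumes g: "g \<in> K_space W F G" and \<eta>: "smooth_with UNIV sup_bounded \<eta>" "\<And>z. z \<notin> T c \<Longrightarrow> \<eta> z = 0"
    and c: "0 < c" "c < 1"
  shows "smooth_with UNIV gbdd (\<lambda>z. g z * \<eta> z)"
proof (rule smooth_with_zero_outside[OF _ open_T])
  have \<eta>': "smooth_with (T 1) sup_bounded \<eta>" by (rule smooth_with_mono[OF \<eta>(1)]) auto
  show "smooth_with (T 1) (wbdd 1) (\<lambda>z. g z * \<eta> z)"
  proof (rule smooth_with_mult[where ?Q1.0 = "wbdd 1" and ?Q2.0 = sup_bounded,
        OF _ \<eta>' open_T local_on_wbdd add_closed_wbdd])
    show "smooth_with (T 1) (wbdd 1) g" using g by (simp only: K_space_iff)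
    show "wbdd 1 (\<lambda>w. f w * h w)" if f: "wbdd 1 f" and h: "sup_bounded h" for f h
    proof (rule wbdd_le_mult[OF f])
      obtain C where C: "\<And>z. cmod (h z) \<le> C" using h sup_boundedD by blast
      have "cmod (f z * h z) \<le> C * cmod (f z)" for z
        using mult_right_mono[OF C norm_ge_zero[of "f z"]] by (simp add: norm_mult mult.commute)
      then show "\<exists>c. \<forall>z\<in>T a. cmod (f z * h z) \<le> c * cmod (f z)" for a by blast
    qed
  qed
  show "closure (T c) \<subseteq> T 1" using closure_T c by blast
  show "g z * \<eta> z = 0" if "z \<notin> closure (T c)" for z
    using that \<eta>(2) closure_subset by fastforce
  fix f assume f: "wbdd 1 f" "\<And>z. z \<notin> closure (T c) \<Longrightarrow> f z = 0"
  show "gbdd f"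
    unfolding gbdd_def
  proof
    fix N
    obtain C where C: "0 \<le> C" "\<And>z. z \<in> T ((c + 1) / 2) \<Longrightarrow> exp (W N \<bar>Re z\<bar>) * cmod (f z) \<le> C"
      by (rule wbddD[OF f(1), of "(c + 1) / 2" N]) (use c in auto)
    have cl: "closure (T c) \<subseteq> T ((c + 1) / 2)" by (rule closure_T) (use c in auto)
    have "exp (W N \<bar>Re z\<bar>) * cmod (f z) \<le> C" for z
      using C f(2)[of z] cl by (cases "z \<in> closure (T c)") auto
    then show "\<exists>S. \<forall>z. exp (W N \<bar>Re z\<bar>) * cmod (f z) \<le> S" by blast
  qed
qed auto

section \<open>Summation over the layers\<close>

lemma zero_K_space: "(\<lambda>_. 0) \<in> K_space W F G"
  by (rule gbdd_K_space, rule smooth_with_coinduct[where R = "\<lambda>f. f = (\<lambda>_. 0)"]) (auto simp: gbdd_def)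

lemma K_space_sum: "(\<And>n. f n \<in> K_space W F G) \<Longrightarrow> (\<lambda>z. \<Sum>n<(k::nat). f n z) \<in> K_space W F G"
  by (induction k) (auto intro: zero_K_space K_space_add)

lemma cauchy_riemann_sum:
  assumes "\<And>n. f n \<in> K_space W F G" "z \<in> T 1"
  shows "cauchy_riemann (\<lambda>z. \<Sum>n<(k::nat). f n z) z = (\<Sum>n<k. cauchy_riemann (f n) z)"
proof (induction k)
  case 0
  show ?case by (simp add: cauchy_riemann_def)
next
  case (Suc k)
  then show ?case
    using cauchy_riemann_add[OF K_space_differentiable[OF K_space_sum[OF assms(1)] assms(2)]
        K_space_differentiable[OF assms(1) assms(2)]] by simp
qed

text \<open>Mittag-Leffler summation: the correction terms are small and holomorphic on larger and
  larger strips.\<close>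

lemma sum_of_small_solutions:
  fixes b :: "nat \<Rightarrow> real"
  assumes f: "\<And>n. f n \<in> K_space W F G" "\<And>n z. z \<in> T 1 \<Longrightarrow> cauchy_riemann (f n) z = U n z"
    and small: "\<And>n z. z \<in> T (b n) \<Longrightarrow> exp (W (Suc n) \<bar>Re z\<bar>) * cmod (f (Suc n) z) \<le> (1 / 2) ^ n"
    and U0: "\<And>n z. z \<in> T (b n) \<Longrightarrow> U (Suc n) z = 0"
    and Usum: "\<And>n z. z \<in> T (b n) \<Longrightarrow> (\<Sum>k<Suc n. U k z) = g z"
    and b: "mono b" "\<And>n. 0 < b n" "\<And>n. b n < 1" "\<And>a. a < 1 \<Longrightarrow> \<exists>n. a < b n"
  shows "\<exists>u\<in>K_space W F G. \<forall>z\<in>T 1. cauchy_riemann u z = g z"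
proof -
  define u where "u z = (\<Sum>n. f n z)" for z
  define A where "A m z = (\<Sum>n<Suc m. f n z)" for m z
  define R where "R m z = (\<Sum>n. f (Suc (n + m)) z)" for m z
  have A: "A m \<in> K_space W F G" for m unfolding A_def[abs_def] by (rule K_space_sum[OF f(1)])
  have T1: "T (b m) \<subseteq> T 1" for m using T_mono[of "b m" 1] b(3)[of m] by simp
  have Tb: "T (b m) \<subseteq> T (b (n + m))" for n m
    by (rule T_mono) (use b(1) in \<open>auto simp: mono_def\<close>)
  have w1: "exp (W (Suc (n + m)) \<bar>Re z\<bar>) * cmod (f (Suc (n + m)) z) \<le> (1 / 2) ^ n" if "z \<in> T (b m)" for n m z
  proof -
    have "exp (W (Suc (n + m)) \<bar>Re z\<bar>) * cmod (f (Suc (n + m)) z) \<le> (1 / 2) ^ (n + m)"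
      using small[of z "n + m"] Tb that by blast
    also have "\<dots> \<le> (1 / 2) ^ n" by (rule power_decreasing) auto
    finally show ?thesis .
  qed
  have w2: "cmod (f (Suc (n + m)) z) \<le> (1 / 2) ^ n" if "z \<in> T (b m)" for n m z
    using w1[OF that, of n] mult_right_mono[OF exp_weight_ge_1[of "Suc (n + m)" "Re z"] norm_ge_zero[of "f (Suc (n + m)) z"]]
    unfolding mult_1_left by linarith
  have geo: "summable (\<lambda>n. (1 / 2 :: real) ^ n)" by (rule summable_geometric) simp
  \<comment> \<open>The smallness of \<open>f (Suc n)\<close> on \<open>T (b n)\<close> makes the
    tail from index \<open>Suc m\<close> on uniformly convergent on \<open>T (b m)\<close>; this is
    why \<open>A m\<close> has \<open>Suc m\<close> terms.\<close>
  have split: "u z = A m z + R m z" if "z \<in> T (b m)" for m z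
  proof -
    have "summable (\<lambda>n. f (n + Suc m) z)"
      by (rule summable_comparison_test'[OF geo]) (use w2[OF that] in simp)
    then have "summable (\<lambda>n. f n z)" using summable_iff_shift[of "\<lambda>n. f n z" "Suc m"] by blast
    from suminf_split_initial_segment[OF this, of "Suc m"] show ?thesis
      by (simp add: u_def A_def R_def add.commute)
  qed
  have R: "R m holomorphic_on T (b m)" for m
  proof (rule holomorphic_uniform_sequence[OF open_T, where f = "\<lambda>k z. \<Sum>n<k. f (Suc (n + m)) z"])
    fix k
    show "(\<lambda>z. \<Sum>n<k. f (Suc (n + m)) z) holomorphic_on T (b m)"
    proof (rule holomorphic_on_sum)
      fix n
      show "f (Suc (n + m)) holomorphic_on T (b m)"
        unfolding holomorphic_on_def
      proof
        fix z assume z: "z \<in> T (b m)"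
        have "cauchy_riemann (f (Suc (n + m))) z = 0"
          using f(2)[OF subsetD[OF T1 z], of "Suc (n + m)"] U0[OF subsetD[OF Tb z], of n] by simp
        moreover have "f (Suc (n + m)) differentiable (at z)"
          using K_space_differentiable[OF f(1)] z T1 by blast
        ultimately show "f (Suc (n + m)) field_differentiable (at z within T (b m))"
          using field_differentiable_if_cauchy_riemann field_differentiable_at_within by blast
      qed
    qed
  next
    fix x assume x: "x \<in> T (b m)"
    obtain d where d: "0 < d" "cball x d \<subseteq> T (b m)" using open_T x open_contains_cball by blast
    have "uniform_limit (cball x d) (\<lambda>k z. \<Sum>n<k. f (Suc (n + m)) z) (R m) sequentially"
      unfolding R_def[abs_def] by (rule Weierstrass_m_test[OF _ geo]) (use w2 d in blast)
    with d show "\<exists>d>0. cball x d \<subseteq> T (b m) \<and> uniform_limit (cball x d) (\<lambda>k z. \<Sum>n<k. f (Suc (n + m)) z) (R m) sequentially"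
      by blast
  qed
  have Rw: "wbdd (b m) (R m)" for m
    unfolding wbdd_def
  proof (intro allI impI)
    fix N a assume a: "0 < a \<and> a < b m"
    have "\<exists>C\<ge>0. \<forall>z\<in>T a. exp (W N \<bar>Re z\<bar>) * cmod (f n z) \<le> C" for n
    proof -
      have "wbdd 1 (f n)" using f(1)[of n] by (auto simp only: K_space_iff dest: smooth_withD(1))
      from wbddD[OF this, of a N] show ?thesis using a b(3)[of m] by (metis less_trans)
    qed
    then obtain C where C: "\<And>n. 0 \<le> C n" "\<And>n z. z \<in> T a \<Longrightarrow> exp (W N \<bar>Re z\<bar>) * cmod (f n z) \<le> C n" by metis
    \<comment> \<open>For \<open>n < N\<close> the smallness of \<open>f (Suc (n + m))\<close> may
      refer to a weight below \<open>W N\<close>, so these finitely many terms are bounded by their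
      own seminorms. From \<open>n = N\<close> on, the weight index exceeds \<open>N\<close> and the
      geometric bound applies.\<close>
    define M where "M n = (1 / 2) ^ n + (if n < N then C (Suc (n + m)) else 0)" for n
    have M: "summable M"
      unfolding M_def[abs_def] by (intro summable_add geo) (rule summable_finite[of "{..<N}"], auto)
    have "exp (W N \<bar>Re z\<bar>) * cmod (R m z) \<le> (\<Sum>n. M n)" if z: "z \<in> T a" for z
    proof -
      have zb: "z \<in> T (b m)" using z T_mono[of a "b m"] a by auto
      have t: "norm (of_real (exp (W N \<bar>Re z\<bar>)) * f (Suc (n + m)) z) \<le> M n" for n
      proof (cases "n < N")
        case True
        have "norm (of_real (exp (W N \<bar>Re z\<bar>)) * f (Suc (n + m)) z) \<le> C (Suc (n + m))"
          using C(2)[OF z, of "Suc (n + m)"] by (simp add: norm_mult)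
        moreover have "0 \<le> (1 / 2 :: real) ^ n" by simp
        ultimately show ?thesis unfolding M_def if_P[OF True] by linarith
      next
        case False
        have "W N \<bar>Re z\<bar> \<le> W (Suc (n + m)) \<bar>Re z\<bar>" by (rule weight_index_mono[OF W]) (use False in auto)
        then have "exp (W N \<bar>Re z\<bar>) * cmod (f (Suc (n + m)) z) \<le> exp (W (Suc (n + m)) \<bar>Re z\<bar>) * cmod (f (Suc (n + m)) z)"
          by (intro mult_right_mono) auto
        with w1[OF zb, of n] show ?thesis using False by (simp add: norm_mult M_def)
      qed
      have s: "summable (\<lambda>n. f (Suc (n + m)) z)"
        by (rule summable_comparison_test'[OF geo]) (use w2[OF zb] in simp)
      have "exp (W N \<bar>Re z\<bar>) * cmod (R m z) = norm (of_real (exp (W N \<bar>Re z\<bar>)) * (\<Sum>n. f (Suc (n + m)) z))"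
        by (simp add: R_def norm_mult)
      also have "\<dots> = norm (\<Sum>n. of_real (exp (W N \<bar>Re z\<bar>)) * f (Suc (n + m)) z)"
        by (simp only: suminf_mult[OF s])
      also have "\<dots> \<le> (\<Sum>n. M n)" by (rule norm_suminf_le[OF t M])
      finally show ?thesis .
    qed
    then show "\<exists>C. \<forall>z\<in>T a. exp (W N \<bar>Re z\<bar>) * cmod (R m z) \<le> C" by blast
  qed
  have Rd: "R m differentiable (at z)" if "z \<in> T (b m)" for m z
    by (rule partials_holomorphic(3)[OF R open_T that])
  have Ad: "A m differentiable (at z)" if "z \<in> T (b m)" for m z
    using K_space_differentiable[OF A] that T1 by blast
  show ?thesis
  proof (intro bexI[of _ u] ballI)
    show "u \<in> K_space W F G"
    proof (rule K_space_localI)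
      fix a :: real assume "0 < a" "a < 1"
      then obtain m where m: "a < b m" using b(4) by blast
      have "smooth_with (T 1) (wbdd 1) (A m)" using A by (simp only: K_space_iff)
      then have "smooth_with (T (b m)) (wbdd (b m)) (A m)"
        by (rule smooth_with_mono[OF _ T1]) (rule wbdd_mono[OF _ less_imp_le[OF b(3)]])
      from smooth_with_add[OF this holomorphic_smooth_with_wbdd[OF R Rw] open_T local_on_wbdd add_closed_wbdd]
      have "smooth_with (T (b m)) (wbdd (b m)) u"
        by (rule smooth_with_cong[OF _ open_T local_on_wbdd]) (simp add: split)
      with m show "\<exists>b>a. smooth_with (T b) (wbdd b) u" by blast
    qed
    fix z assume z: "z \<in> T 1"
    obtain a where a: "a < 1" "z \<in> T a" using T_1_exhaust[OF z, of 0] by auto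
    obtain m where "a < b m" using b(4)[OF a(1)] by blast
    then have zb: "z \<in> T (b m)" using T_mono[of a "b m"] a by auto
    have "cauchy_riemann u z = cauchy_riemann (\<lambda>w. A m w + R m w) z"
      by (rule cauchy_riemann_cong[OF open_T zb]) (use split Ad[OF zb] Rd[OF zb] in auto)
    also have "\<dots> = cauchy_riemann (A m) z + cauchy_riemann (R m) z"
      by (rule cauchy_riemann_add[OF Ad[OF zb] Rd[OF zb]])
    also have "cauchy_riemann (R m) z = 0" by (rule cauchy_riemann_holomorphic[OF R open_T zb])
    also have "cauchy_riemann (A m) z = (\<Sum>n<Suc m. cauchy_riemann (f n) z)"
      unfolding A_def[abs_def] by (rule cauchy_riemann_sum[OF f(1) z])
    also have "\<dots> = (\<Sum>n<Suc m. U n z)" by (simp only: f(2)[OF z])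
    also have "\<dots> = g z" by (rule Usum[OF zb])
    finally show "cauchy_riemann u z = g z" by simp
  qed
qed

lemma cauchy_riemann_onto:
  assumes sub: "subexponential W"
  shows "surjective_on (strip F G) (K_space W F G) cauchy_riemann"
  unfolding surjective_on_def T_1
proof
  fix g assume g: "g \<in> K_space W F G"
  obtain m H where mH: "0 < m" "m \<le> H" "\<And>t. m \<le> F t" "\<And>t. m \<le> G t" "\<And>t. F t \<le> H" "\<And>t. G t \<le> H"
    using boundary_bounds by blast
  have "0 < 3 * H" using mH by simp
  then obtain P where P: "P holomorphic_on UNIV" "P 0 = 1"
    "\<And>N. \<exists>C\<ge>0. \<forall>z. \<bar>Im z\<bar> \<le> 3 * H \<longrightarrow> exp (W N \<bar>Re z\<bar>) * exp \<bar>Re z\<bar> * cmod (P z) \<le> C"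
    using exp_cosh_decay[OF sub] by blast
  \<comment> \<open>Any sequence increasing strictly to \<open>1\<close> would do; the shift by
    \<open>2\<close> keeps it positive from the start.\<close>
  define b where "b n = 1 - 1 / (real n + 2)" for n
  have bmono: "mono b" unfolding b_def mono_def by (auto intro!: divide_left_mono)
  have b01: "0 < b n" "b n < 1" "b n < b (Suc n)" for n by (auto simp: b_def field_simps)
  have blim: "\<exists>n. a < b n" if "a < 1" for a
  proof -
    obtain n :: nat where "1 / (1 - a) < n" using reals_Archimedean2 by blast
    then have "1 < (real n + 2) * (1 - a)" using that by (simp add: field_simps)
    then have "1 / (real n + 2) < 1 - a" by (simp add: field_simps)
    then show ?thesis by (auto simp: b_def intro!: exI[of _ n])
  qed
  have "\<exists>\<eta>. smooth_with UNIV sup_bounded \<eta> \<and> (\<forall>z\<in>T (b (Suc n)). \<eta> z = 1) \<and> (\<forall>z. z \<notin> T (b (Suc (Suc n))) \<longrightarrow> \<eta> z = 0)" for n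
    using strip_cutoff[of "b (Suc n)" "b (Suc (Suc n))"] b01(1)[of "Suc n"] b01(3)[of "Suc n"] less_imp_le by metis
  then obtain \<eta> where \<eta>: "\<And>n. smooth_with UNIV sup_bounded (\<eta> n)" "\<And>n z. z \<in> T (b (Suc n)) \<Longrightarrow> \<eta> n z = 1"
    "\<And>n z. z \<notin> T (b (Suc (Suc n))) \<Longrightarrow> \<eta> n z = 0" by metis
  \<comment> \<open>A telescoping decomposition of \<open>g\<close>. As the cut-off with index
    \<open>n\<close> equals \<open>1\<close> on \<open>T (b (Suc n))\<close>, the part
    \<open>U (Suc n)\<close> vanishes on that strip, and the gap between \<open>b n\<close> and
    \<open>b (Suc n)\<close> is the one \<open>solve_layer\<close> needs to be small on
    \<open>T (b n)\<close>.\<close>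
  define U where "U n = (\<lambda>z. g z * (case n of 0 \<Rightarrow> \<eta> 0 z | Suc k \<Rightarrow> \<eta> (Suc k) z + (- 1) * \<eta> k z))" for n
  have TT: "T (b n) \<subseteq> T (b (Suc n))" "T (b n) \<subseteq> T 1" for n
    using T_mono[of "b n" "b (Suc n)"] T_mono[of "b n" 1] b01[of n] by auto
  have out: "\<eta> n z = 0" if "z \<notin> T (b (Suc (Suc (Suc n))))" for n z
    using \<eta>(3) TT(1) that by blast
  have U: "smooth_with UNIV gbdd (U n)" for n
  proof (cases n)
    case 0
    show ?thesis unfolding U_def 0 nat.case
      by (rule cutoff_gbdd[OF g \<eta>(1)[of 0] \<eta>(3)[of _ 0] b01(1,2)])
  next
    case (Suc k)
    have const: "sup_bounded (\<lambda>_. c)" for c by (auto simp: sup_bounded_def)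
    have "smooth_with UNIV sup_bounded (\<lambda>z. \<eta> (Suc k) z + (- 1) * \<eta> k z)"
      by (rule smooth_with_add[OF \<eta>(1) _ open_UNIV local_on_sup_bounded add_closed_sup_bounded])
        (rule smooth_with_cmult[OF \<eta>(1) open_UNIV local_on_sup_bounded sup_bounded_mult[OF const]])
    then show ?thesis unfolding U_def Suc nat.case
    proof (rule cutoff_gbdd[OF g])
      show "\<eta> (Suc k) z + (- 1) * \<eta> k z = 0" if "z \<notin> T (b (Suc (Suc (Suc k))))" for z
        using \<eta>(3)[OF that] out[OF that] by simp
    qed (rule b01)+
  qed
  have Uoff: "U n z = 0" if "z \<notin> T 1" for n z
  proof -
    have "\<eta> k z = 0" for k using \<eta>(3) TT(2) that by blast
    then show ?thesis by (simp add: U_def split: nat.split)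
  qed
  have U0: "U (Suc n) z = 0" if "z \<in> T (b (Suc n))" for n z
  proof -
    have "z \<in> T (b (Suc (Suc n)))" using TT(1) that by blast
    then show ?thesis using \<eta>(2)[OF that] \<eta>(2)[of z "Suc n"] by (simp add: U_def)
  qed
  have s0: "\<exists>f\<in>K_space W F G. \<forall>z\<in>T 1. cauchy_riemann f z = U 0 z"
  proof -
    have "\<exists>f\<in>K_space W F G. (\<forall>z\<in>T 1. cauchy_riemann f z = U 0 z) \<and>
        (\<forall>z\<in>T 0. exp (W 0 \<bar>Re z\<bar>) * cmod (f z) \<le> 1)"
      \<comment> \<open>\<open>T 0\<close> is empty, so nothing has to be small for the first part
        and the constant \<open>1\<close> serves as peak function.\<close>
      by (rule solve_with_peak[OF mH P U Uoff, where E = "\<lambda>_. 1" and B = 1]) (auto simp: strip_def)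
    then show ?thesis by blast
  qed
  have s1: "\<exists>f\<in>K_space W F G. (\<forall>z\<in>T 1. cauchy_riemann f z = U (Suc n) z) \<and>
        (\<forall>z\<in>T (b n). exp (W (Suc n) \<bar>Re z\<bar>) * cmod (f z) \<le> (1 / 2) ^ n)" for n
    by (rule solve_layer[OF mH P U Uoff less_imp_le[OF b01(1)] b01(3) U0]) simp_all
  obtain f0 where f0: "f0 \<in> K_space W F G" "\<And>z. z \<in> T 1 \<Longrightarrow> cauchy_riemann f0 z = U 0 z" using s0 by blast
  obtain f1 where f1: "\<And>n. f1 n \<in> K_space W F G" "\<And>n z. z \<in> T 1 \<Longrightarrow> cauchy_riemann (f1 n) z = U (Suc n) z"
    "\<And>n z. z \<in> T (b n) \<Longrightarrow> exp (W (Suc n) \<bar>Re z\<bar>) * cmod (f1 n z) \<le> (1 / 2) ^ n" using s1 by metis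
  define f where "f n = (case n of 0 \<Rightarrow> f0 | Suc k \<Rightarrow> f1 k)" for n
  have Usum: "(\<Sum>k<Suc n. U k z) = g z * \<eta> n z" for n z
    by (induction n) (simp_all add: U_def algebra_simps)
  show "\<exists>u\<in>K_space W F G. \<forall>z\<in>T 1. cauchy_riemann u z = g z"
  proof (rule sum_of_small_solutions[where f = f and U = U and b = b])
    show "f n \<in> K_space W F G" for n by (simp add: f_def f0 f1 split: nat.split)
    show "cauchy_riemann (f n) z = U n z" if "z \<in> T 1" for n z
      using f0(2)[OF that] f1(2)[OF that] by (cases n) (simp_all add: f_def)
    show "exp (W (Suc n) \<bar>Re z\<bar>) * cmod (f (Suc n) z) \<le> (1 / 2) ^ n" if "z \<in> T (b n)" for n z
      using f1(3)[OF that] by (simp add: f_def)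
    show "U (Suc n) z = 0" if "z \<in> T (b n)" for n z
      using U0[of z n] TT(1)[of n] that by blast
    show "(\<Sum>k<Suc n. U k z) = g z" if "z \<in> T (b n)" for n z
      unfolding Usum using \<eta>(2)[of z n] TT(1)[of n] that by auto
  qed (fact bmono b01 blim)+
qed

text \<open>If \<open>\<eta>\<close> is a smooth step, equal to \<open>1\<close> on the left and to \<open>0\<close> on the right, and the
  Cauchy--Riemann derivatives of \<open>f\<close> and \<open>\<eta>\<close> agree, then \<open>f - \<eta>\<close> is holomorphic and decays on the right; it is
  not zero because \<open>f\<close> decays on the left and \<open>\<eta>\<close> does not.\<close>

lemma subexponential_of_cauchy_riemann_onto:
  assumes onto: "surjective_on (strip F G) (K_space W F G) cauchy_riemann"
  shows "subexponential W"
proof -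
  obtain m H where m: "0 < m" "\<And>t. m \<le> F t" "\<And>t. m \<le> G t" using boundary_bounds by metis
  have "{z. Re z < 0} \<in> sets borel" by (intro borel_open open_Collect_less continuous_intros)
  then obtain \<eta> where \<eta>: "smooth_with UNIV sup_bounded \<eta>"
    "\<And>z. ball z 1 \<subseteq> {z. Re z < 0} \<Longrightarrow> \<eta> z = 1" "\<And>z. ball z 1 \<inter> {z. Re z < 0} = {} \<Longrightarrow> \<eta> z = 0"
    using smooth_cutoff[OF _ zero_less_one] by blast
  have Reb: "\<bar>Re w - Re z\<bar> < 1" if "w \<in> ball z 1" for w z
    using that abs_Re_le_cmod[of "w - z"] by (simp add: dist_norm norm_minus_commute)
  have le: "\<eta> z = 1" if "Re z \<le> - 1" for z
    by (rule \<eta>(2)) (use that Reb[of _ z] in fastforce)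
  have ri: "\<eta> z = 0" if "1 \<le> Re z" for z
    by (rule \<eta>(3)) (use that Reb[of _ z] in fastforce)
  have d\<eta>: "\<eta> differentiable (at z)" for z using smooth_withD(2)[OF \<eta>(1)] by blast
  define g where "g z = 1/2 * (partial_x \<eta> z + \<i> * partial_y \<eta> z)" for z
  have const: "sup_bounded (\<lambda>_. c)" for c by (auto simp: sup_bounded_def)
  note cm = smooth_with_cmult[OF _ open_UNIV local_on_sup_bounded sup_bounded_mult[OF const]]
  have g1: "smooth_with UNIV sup_bounded g"
    unfolding g_def[abs_def]
    by (intro cm smooth_with_add[OF _ _ open_UNIV local_on_sup_bounded add_closed_sup_bounded] smooth_withD(3,4)[OF \<eta>(1)])
  have g0: "g z = 0" if "z \<notin> {z. \<bar>Re z\<bar> \<le> 1}" for z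
  proof (cases "1 < Re z")
    case True
    have "open {z. 1 < Re z}" by (intro open_Collect_less continuous_intros)
    from partials_cong[OF this, of z "\<lambda>_. 0" \<eta>] True ri show ?thesis by (simp add: g_def)
  next
    case False
    have "open {z. Re z < - 1}" by (intro open_Collect_less continuous_intros)
    from partials_cong[OF this, of z "\<lambda>_. 1" \<eta>] False that le show ?thesis by (simp add: g_def abs_if split: if_splits)
  qed
  \<comment> \<open>The derivative of the step lives on \<open>\<bar>Re z\<bar> \<le> 1\<close>,
    where every weight is at most \<open>W N 1\<close>; bounded data are therefore
    admissible.\<close>
  have "smooth_with UNIV gbdd g"
  proof (rule smooth_with_zero_outside[OF g1 open_UNIV _ subset_UNIV g0])
    show "closed {z. \<bar>Re z\<bar> \<le> 1}" by (intro closed_Collect_le continuous_intros)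
    fix f assume f: "sup_bounded f" "\<And>z. z \<notin> {z. \<bar>Re z\<bar> \<le> 1} \<Longrightarrow> f z = 0"
    obtain C where C: "0 \<le> C" "\<And>z. cmod (f z) \<le> C" using f(1) sup_boundedD by blast
    have "exp (W N \<bar>Re z\<bar>) * cmod (f z) \<le> exp (W N 1) * C" for N z
    proof (cases "\<bar>Re z\<bar> \<le> 1")
      case True
      have "W N \<bar>Re z\<bar> \<le> W N 1" by (rule weight_mono[OF W]) (use True in auto)
      then show ?thesis by (intro mult_mono C(2)) auto
    qed (use f(2) C(1) in simp)
    then show "gbdd f" unfolding gbdd_def by blast
  qed
  then have "g \<in> K_space W F G" by (rule gbdd_K_space)
  then obtain f where f: "f \<in> K_space W F G" "\<And>z. z \<in> T 1 \<Longrightarrow> cauchy_riemann f z = g z"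
    using onto unfolding surjective_on_def T_1 by blast
  have wf: "wbdd 1 f" using f(1) unfolding K_space_iff by (rule smooth_withD(1))
  define h where "h z = f z + (- 1) * \<eta> z" for z
  have dm: "(\<lambda>z. (- 1) * \<eta> z) differentiable (at z)" for z
    by (intro differentiable_mult differentiable_const d\<eta>)
  have hol: "h holomorphic_on T 1"
    unfolding holomorphic_on_def
  proof
    fix z assume z: "z \<in> T 1"
    have "cauchy_riemann h z = cauchy_riemann f z + cauchy_riemann (\<lambda>z. (- 1) * \<eta> z) z"
      unfolding h_def[abs_def] by (rule cauchy_riemann_add[OF K_space_differentiable[OF f(1) z] dm])
    also have "cauchy_riemann (\<lambda>z. (- 1) * \<eta> z) z = (- 1) * cauchy_riemann \<eta> z" by (rule cauchy_riemann_cmult[OF d\<eta>])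
    also have "cauchy_riemann \<eta> z = g z" by (simp add: g_def cauchy_riemann_def)
    finally have "cauchy_riemann h z = 0" using f(2)[OF z] by simp
    moreover have "h differentiable (at z)"
      unfolding h_def[abs_def] by (rule differentiable_add[OF K_space_differentiable[OF f(1) z] dm])
    ultimately show "h field_differentiable (at z within T 1)"
      using field_differentiable_if_cauchy_riemann field_differentiable_at_within by blast
  qed
  show ?thesis
  proof (rule subexponential_from_half_strip[of h 1 "m / 2"])
    show "h holomorphic_on {z. 1 < Re z \<and> \<bar>Im z\<bar> < m / 2}"
    proof (rule holomorphic_on_subset[OF hol], rule subsetI)
      fix z assume "z \<in> {z. 1 < Re z \<and> \<bar>Im z\<bar> < m / 2}"
      then have "\<bar>Im z\<bar> < m / 2" by simp
      then show "z \<in> T 1" using m(1) m(2,3)[of "Re z"] unfolding mem_T by linarith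
    qed
    show "\<exists>B. \<forall>z. 1 < Re z \<and> \<bar>Im z\<bar> < m / 2 \<longrightarrow> exp (W N \<bar>Re z\<bar>) * cmod (h z) \<le> B" for N
    proof -
      obtain B where "\<And>z. \<bar>Im z\<bar> < m / 2 \<Longrightarrow> exp (W N \<bar>Re z\<bar>) * cmod (f z) \<le> B"
        using strip_bound_of_wbdd[OF wf m(2,3,1), of N] by blast
      moreover have "h z = f z" if "1 < Re z" for z using ri[of z] that by (simp add: h_def)
      ultimately have "exp (W N \<bar>Re z\<bar>) * cmod (h z) \<le> B" if "1 < Re z" "\<bar>Im z\<bar> < m / 2" for z
        by (simp only: that)
      then show ?thesis by blast
    qed
    show "\<exists>x>1 + 2 * (m / 2) / pi * ln 2. h (of_real x) \<noteq> 0"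
    proof (rule ccontr)
      assume "\<not> ?thesis"
      then have 0: "h (of_real x) = 0" if "1 + 2 * (m / 2) / pi * ln 2 < x" for x using that by blast
      have real: "of_real x \<in> T 1" for x using F_pos[of x] G_pos[of x] by (simp add: strip_def)
      \<comment> \<open>If \<open>h\<close> vanished far out on the real axis, the identity theorem
        would give \<open>f = \<eta>\<close> on the whole strip, and the step equals
        \<open>1\<close> on the left.\<close>
      have f1: "f (of_real (- t)) = 1" if "1 \<le> t" for t
      proof -
        have "h (of_real (- t)) = 0"
          by (rule vanishing_on_real_ray[OF hol open_T connected_T real 0 real])
        then show ?thesis using le[of "of_real (- t)"] that by (simp add: h_def)
      qed
      obtain B where B: "\<And>z. \<bar>Im z\<bar> < m / 2 \<Longrightarrow> exp (W 0 \<bar>Re z\<bar>) * cmod (f z) \<le> B"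
        using strip_bound_of_wbdd[OF wf m(2,3,1), of 0] by blast
      \<comment> \<open>The weight is unbounded and \<open>exp (W 0 t)\<close> exceeds
        \<open>W 0 t\<close>, so a function equal to \<open>1\<close> far to the left violates its
        weighted bound.\<close>
      obtain s where s: "0 \<le> s" "\<And>t. s \<le> t \<Longrightarrow> B < W 0 t" using weight_unbounded[OF W] by blast
      define t where "t = max s 1"
      have t: "s \<le> t" "1 \<le> t" by (auto simp: t_def)
      have "exp (W 0 \<bar>Re (of_real (- t))\<bar>) * cmod (f (of_real (- t))) \<le> B"
        by (rule B) (use m(1) in simp)
      then have "exp (W 0 t) \<le> B" using f1[OF t(2)] t(2) by simp
      moreover have "W 0 t < exp (W 0 t)" using exp_ge_add_one_self[of "W 0 t"] by linarith
      ultimately show False using s(2)[OF t(1)] by linarith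
    qed
  qed (use m in auto)
qed

end

theorem theorem3p1:
  fixes F G :: "real \<Rightarrow> real" and W :: "nat \<Rightarrow> real \<Rightarrow> real"
  assumes "strip_boundary_fun F" and "strip_boundary_fun G"
    and "weight_system W" and "cond_alpha W" and "cond_N W"
  shows "(surjective_on (strip F G) (K_space W F G) cauchy_riemann
            \<longleftrightarrow> surjective_on (strip F G) (K_space W F G) laplace)
       \<and> (surjective_on (strip F G) (K_space W F G) laplace \<longleftrightarrow> cond_eps0 W)
       \<and> (cond_eps0 W \<longleftrightarrow> (\<exists>f\<in>U_space W F G. \<exists>z\<in>strip F G. f z \<noteq> 0))"
proof -
  interpret weighted_strip F G W
    using assms(1-4) by unfold_locales
  have "cond_eps0 W \<longleftrightarrow> subexponential W" by (rule cond_eps0_iff_subexponential[OF assms(3)])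
  then show ?thesis
    using cauchy_riemann_onto_iff_laplace_onto cauchy_riemann_onto subexponential_of_cauchy_riemann_onto
      U_space_nontrivial subexponential_of_U_space by blast
qed

end
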